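(* (i) The symbol $\psi$ is realised by the linear system $(-A,B,C)$, so $\psi(t)=Ce^{-tA}B$. (ii) There exists a solution $W$ of the Gelfand--Levitan equation $$W(x,y)+\Psi(x+y)+\int_x^\infty W(x,s)\ast\Psi(s+y)\,ds=0\qquad(0<x<y)$$ such that the tau function satisfies $$\frac{d}{dx}\log\tau(2x)=\operatorname{trace}H(x)\qquad(x>0).$$ (iii) Suppose moreover that $\int_0^\infty x\|\Psi(x)\|^2\,dx<1$. Then $$\Bigl(\frac{\partial^2}{\partial x^2}-\frac{\partial^2}{\partial y^2}\Bigr)W(x,y)=-2\frac{dH}{dx}\,W(x,y).$$
   Context: Let $v(x)=\sum_{j=0}^{2N}a_jx^j$ be a real polynomial with $a_{2N}>0$, and let $\rho$ be its equilibrium measure: the Borel probability measure on $\mathbf{R}$ minimizing $\int v\,d\rho-\iint\log|x-y|\,\rho(dx)\rho(dy)$. Its compact support is $S=\bigcup_{j=1}^{g+1}[\delta_{2j-1},\delta_{2j}]$. Let $u(z)=\int_S\frac{v'(z)-v'(x)}{z-x}\rho(dx)$; let $\delta_1,\dots,\delta_{4N-2}$ be the zeros of $v'(z)^2-4u(z)$ (the first $2g+2$ being the endpoints of $S$ in increasing order), and $w(x)=2Na_{2N}\bigl(-\prod_{j=1}^{4N-2}(x-\delta_j)\bigr)^{1/2}$, so $w^2=4u-v'^2$ and $\rho(dx)=\frac1{2\pi}\mathbf{I}_S(x)w(x)\,dx$. Let $p_j$ be the monic orthogonal polynomials for $\rho$, $h_j=\int_S p_j^2\,d\rho$, $$Y_n(z)=\begin{bmatrix}p_n(z)&\int_S\frac{p_n(t)\rho(dt)}{z-t}\\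 \frac{p_{n-1}(z)}{h_{n-1}}&\frac1{h_{n-1}}\int_S\frac{p_{n-1}(t)\rho(dt)}{z-t}\end{bmatrix},$$ $$A_n(z)=Y_n'Y_n^{-1}+Y_n\begin{bmatrix}0&0\\0&-w'/w\end{bmatrix}Y_n^{-1}=\sum_{j=1}^{4N-2}\frac{\alpha_j(n)}{z-\delta_j},$$ $\beta_j(n)=\alpha_j(n)-\frac12\operatorname{trace}(\alpha_j(n))I_2$, $B_n(z)=\sum_j\frac{\beta_j(n)}{z-\delta_j}$, $J=\begin{bmatrix}0&-1\\1&0\end{bmatrix}$; normalize $\delta_1=0$, $1<\delta_2$. Suppose $\beta_1(n)$ has eigenvalues $\pm\kappa_1(n)$, $\kappa_1=\kappa_1(n)>0$, $2\kappa_1\notin\mathbf{Z}$, and let $Z$ be a $2\times1$ real solution of $Z'=B_nZ$ with $Z(x)\to0$ as $x\to\delta_1$. The matrices $-\delta_kJ\beta_k(n)$ ($k\ge2$) are real symmetric, hence congruent to signature matrices $\sigma_k$ (diagonal $2\times2$ with entries in $\{1,-1,0\}$); $\sigma=\operatorname{diagonal}[\sigma_k]_{k=2}^{4N-2}$, and $\gamma(n)$ is block diagonal with $\gamma(n)^\dagger\sigma\gamma(n)=\operatorname{diagonal}[-\delta_kJ\beta_k(n)]_{k=2}^{4N-2}$. Define $\psi(x)=\gamma(n)\,\operatorname{column}\bigl[\frac{\sqrt x\,Z(x)}{x-\delta_k}\bigr]_{k=2}^{4N-2}$, and change variable from $x\in(0,1)$ to $t\in(0,\infty)$ by $x=\delta_1+e^{-t}$;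 in the new variable $$\psi(t)=\sum_{\ell=0}^\infty\chi_\ell e^{-(\kappa_1+\ell+1/2)t},\qquad \chi_\ell\in H_0=\mathbf{C}^{8N-6},\quad \sum_\ell\|\chi_\ell\|<\infty .$$ Linear system: the state space is $\ell^2$ (infinite columns); $C=(\chi_\ell/\|\chi_\ell\|^{1/2})_{\ell=0}^\infty$ is an infinite row of column vectors, $B=(\|\chi_\ell\|^{1/2})_{\ell=0}^\infty$ an infinite column, and $A=\operatorname{diagonal}[\ell+\kappa_1+1/2]_{\ell=0}^\infty$. Block matrices of size $(8N-5)\times(8N-5)$: $$W(x,y)=\begin{bmatrix}U(x,y)&v(x,y)\\ w(x,y)^\dagger&z(x,y)\end{bmatrix},\quad \Psi(x)=\begin{bmatrix}0&\psi(x)\\ \psi(\bar x)^\dagger&0\end{bmatrix},\quad H(x)=\begin{bmatrix}U(x,x)\sigma&v(x,x)\\ w(x,x)^\dagger\sigma&z(x,x)\end{bmatrix},$$ where (in these matrices) $v,w\in H_0$, $U$ operates on $H_0$ and $z$ is a scalar. The non-associative product $\ast$ is $$\begin{bmatrix}U&v\\ w^\dagger&z\end{bmatrix}\ast\begin{bmatrix}0&\psi\\ \psi^\dagger&0\end{bmatrix}=\begin{bmatrix}v\psi^\dagger&U\sigma\psi\\ z\psi^\dagger&w^\dagger\sigma\psi\end{bmatrix}.$$ The tau function is $\tau(2x)=\det\bigl(I-\Gamma_\psi^\dagger\sigma\Gamma_\psi P_{(2x,\infty)}\bigr)$, where $\Gamma_\psi f(x)=\int_0^\infty\psi(x+y)f(y)\,dy$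 is the Hankel operator from $L^2((0,\infty);\mathbf{C})$ to $L^2((0,\infty);H_0)$ and $P_{(a,\infty)}f=\mathbf{I}_{(a,\infty)}f$. In (iii), $W$ and $H$ are those of (ii), and the product on the right-hand side is ordinary matrix multiplication.
   Formalization: In (ii) the Gelfand–Levitan equation and the formula for d/dx log τ(2x) are asserted at those x > 0 where τ(2x) ≠ 0, since τ can vanish when Z is scaled up; τ(2x) ≠ 0 is proved for all large x, and for all x > 0 under the hypothesis of (iii). *)

theory Defs
  imports "HOL-Probability.Probability" "HOL-Computational_Algebra.Polynomial"
begin

section \<open>Equilibrium measure\<close>

definition measure_support :: "real measure \<Rightarrow> real set" where
  "measure_support \<rho> = {x. \<forall>U. open U \<longrightarrow> x \<in> U \<longrightarrow> emeasure \<rho> U > 0}"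

text \<open>In HOL \<open>ln 0 = 0\<close>, whereas the logarithmic energy uses \<open>log 0 = -\<infinity>\<close>; a measure with an atom
  therefore has infinite energy and is excluded explicitly.\<close>

definition finite_energy :: "real poly \<Rightarrow> real measure \<Rightarrow> bool" where
  "finite_energy v \<mu> \<longleftrightarrow> prob_space \<mu> \<and> sets \<mu> = sets borel \<and> integrable \<mu> (poly v) \<and>
     (\<forall>x. measure \<mu> {x} = 0) \<and>
     integrable (\<mu> \<Otimes>\<^sub>M \<mu>) (\<lambda>(x, y). ln \<bar>x - y\<bar>)"

definition energy :: "real poly \<Rightarrow> real measure \<Rightarrow> real" where
  "energy v \<mu> = (LINT x|\<mu>. poly v x) - (LINT z|(\<mu> \<Otimes>\<^sub>M \<mu>). (case z of (x, y) \<Rightarrow> ln \<bar>x - y\<bar>))"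

text \<open>Probability measures of infinite energy cannot compete for the minimum, so it is enough to
  compare with those of finite energy.\<close>

definition equilibrium_measure :: "real poly \<Rightarrow> real measure \<Rightarrow> bool" where
  "equilibrium_measure v \<rho> \<longleftrightarrow> finite_energy v \<rho> \<and> (\<forall>\<mu>. finite_energy v \<mu> \<longrightarrow> energy v \<rho> \<le> energy v \<mu>)"

definition u_fun :: "real poly \<Rightarrow> real measure \<Rightarrow> complex \<Rightarrow> complex" where
  "u_fun v \<rho> z = (LINT x:measure_support \<rho>|\<rho>.
     (poly (map_poly of_real (pderiv v)) z - of_real (poly (pderiv v) x)) / (z - of_real x))"

text \<open>The function \<open>w\<^sup>2\<close>, with \<open>a\<close> the leading coefficient of \<open>v\<close> (of degree \<open>2N\<close>).\<close>

definition w_sq :: "nat \<Rightarrow> real \<Rightarrow> (nat \<Rightarrow> complex) \<Rightarrow> complex \<Rightarrow> complex" where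
  "w_sq N a \<delta> z = (2 * of_nat N * of_real a)\<^sup>2 * (- (\<Prod>j=1..4*N-2. z - \<delta> j))"

definition w_fun :: "nat \<Rightarrow> real \<Rightarrow> (nat \<Rightarrow> complex) \<Rightarrow> real \<Rightarrow> real" where
  "w_fun N a \<delta> x = 2 * real N * a * sqrt (Re (- (\<Prod>j=1..4*N-2. of_real x - \<delta> j)))"

text \<open>The quotient \<open>w'/w\<close> off the zeros, written as \<open>(w\<^sup>2)' / (2 w\<^sup>2)\<close> so that it does not depend
  on the branch of the square root.\<close>

definition w_logderiv :: "nat \<Rightarrow> real \<Rightarrow> (nat \<Rightarrow> complex) \<Rightarrow> complex \<Rightarrow> complex" where
  "w_logderiv N a \<delta> z = deriv (w_sq N a \<delta>) z / (2 * w_sq N a \<delta> z)"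

section \<open>Orthogonal polynomials and the differential equation\<close>

definition monic_orthogonal :: "real measure \<Rightarrow> (nat \<Rightarrow> real poly) \<Rightarrow> bool" where
  "monic_orthogonal \<rho> p \<longleftrightarrow> (\<forall>j. degree (p j) = j \<and> lead_coeff (p j) = 1) \<and>
     (\<forall>i j. i \<noteq> j \<longrightarrow> (LINT x:measure_support \<rho>|\<rho>. poly (p i) x * poly (p j) x) = 0)"

definition h_norm :: "real measure \<Rightarrow> (nat \<Rightarrow> real poly) \<Rightarrow> nat \<Rightarrow> real" where
  "h_norm \<rho> p j = (LINT x:measure_support \<rho>|\<rho>. (poly (p j) x)\<^sup>2)"

definition cauchy_tr :: "real measure \<Rightarrow> real poly \<Rightarrow> complex \<Rightarrow> complex" where
  "cauchy_tr \<rho> q z = (LINT t:measure_support \<rho>|\<rho>. of_real (poly q t) / (z - of_real t))"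

definition mscale :: "complex \<Rightarrow> complex^'m^'n \<Rightarrow> complex^'m^'n" where
  "mscale c M = (\<chi> i j. c * M $ i $ j)"

definition Y_mat :: "real measure \<Rightarrow> (nat \<Rightarrow> real poly) \<Rightarrow> nat \<Rightarrow> complex \<Rightarrow> complex^2^2" where
  "Y_mat \<rho> p n z = vector
     [vector [poly (map_poly of_real (p n)) z, cauchy_tr \<rho> (p n) z],
      vector [poly (map_poly of_real (p (n-1))) z / of_real (h_norm \<rho> p (n-1)),
              cauchy_tr \<rho> (p (n-1)) z / of_real (h_norm \<rho> p (n-1))]]"

definition A_mat :: "nat \<Rightarrow> real \<Rightarrow> (nat \<Rightarrow> complex) \<Rightarrow> real measure \<Rightarrow> (nat \<Rightarrow> real poly) \<Rightarrow> nat \<Rightarrow>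
    complex \<Rightarrow> complex^2^2" where
  "A_mat N a \<delta> \<rho> p n z =
     (\<chi> i j. deriv (\<lambda>\<zeta>. Y_mat \<rho> p n \<zeta> $ i $ j) z) ** matrix_inv (Y_mat \<rho> p n z) +
     Y_mat \<rho> p n z ** vector [vector [0, 0], vector [0, - w_logderiv N a \<delta> z]] **
       matrix_inv (Y_mat \<rho> p n z)"

definition traceless :: "complex^2^2 \<Rightarrow> complex^2^2" where
  "traceless M = M - mscale (trace M / 2) (mat 1)"

definition B_mat :: "nat \<Rightarrow> (nat \<Rightarrow> complex) \<Rightarrow> (nat \<Rightarrow> complex^2^2) \<Rightarrow> complex \<Rightarrow> complex^2^2" where
  "B_mat N \<delta> \<beta> z = (\<Sum>j=1..4*N-2. mscale (1 / (z - \<delta> j)) (\<beta> j))"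

definition J_mat :: "complex^2^2" where
  "J_mat = vector [vector [0, -1], vector [1, 0]]"

definition is_eigenvalue :: "complex^'n^'n \<Rightarrow> complex \<Rightarrow> bool" where
  "is_eigenvalue M c \<longleftrightarrow> (\<exists>x. x \<noteq> 0 \<and> M *v x = c *s x)"

definition of_real_vec :: "real^'n \<Rightarrow> complex^'n" where
  "of_real_vec x = (\<chi> i. of_real (x $ i))"

definition dagger :: "complex^'m^'n \<Rightarrow> complex^'n^'m" where
  "dagger M = (\<chi> i j. cnj (M $ j $ i))"

definition conj_vec :: "complex^'n \<Rightarrow> complex^'n" where
  "conj_vec x = (\<chi> i. cnj (x $ i))"

definition dot :: "complex^'n \<Rightarrow> complex^'n \<Rightarrow> complex" where
  "dot r x = (\<Sum>i\<in>UNIV. r $ i * x $ i)"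

definition signature_matrix :: "complex^2^2 \<Rightarrow> bool" where
  "signature_matrix M \<longleftrightarrow> (\<forall>i j. i \<noteq> j \<longrightarrow> M $ i $ j = 0) \<and> (\<forall>i. M $ i $ i \<in> {1, -1, 0})"

text \<open>Columns and block diagonal matrices with blocks of size 2, indexed by a finite type \<open>'k\<close>.
  The space \<open>H\<^sub>0\<close> is \<open>complex^('k \<times> 2)\<close>.\<close>

definition block_column :: "('k \<Rightarrow> complex^2) \<Rightarrow> complex^('k::finite \<times> 2)" where
  "block_column f = (\<chi> q. f (fst q) $ snd q)"

definition block_diagonal :: "('k \<Rightarrow> complex^2^2) \<Rightarrow> complex^('k::finite \<times> 2)^('k \<times> 2)" where
  "block_diagonal M = (\<chi> q r. if fst q = fst r then M (fst q) $ snd q $ snd r else 0)"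

section \<open>Linear systems with state space \<open>\<ell>\<^sup>2\<close>\<close>

definition in_ell2 :: "(nat \<Rightarrow> complex) \<Rightarrow> bool" where
  "in_ell2 f \<longleftrightarrow> summable (\<lambda>l. (cmod (f l))\<^sup>2)"

definition ell2_norm :: "(nat \<Rightarrow> complex) \<Rightarrow> real" where
  "ell2_norm f = sqrt (\<Sum>l. (cmod (f l))\<^sup>2)"

definition diag_op :: "(nat \<Rightarrow> complex) \<Rightarrow> (nat \<Rightarrow> complex) \<Rightarrow> nat \<Rightarrow> complex" where
  "diag_op a f = (\<lambda>l. a l * f l)"

text \<open>The exponential series of \<open>-t A\<close>, evaluated in each coordinate (the operator \<open>A\<close> may be
  unbounded on \<open>\<ell>\<^sup>2\<close>).\<close>

definition exp_op :: "((nat \<Rightarrow> complex) \<Rightarrow> nat \<Rightarrow> complex) \<Rightarrow> real \<Rightarrow> (nat \<Rightarrow> complex) \<Rightarrow> nat \<Rightarrow> complex" where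
  "exp_op A t f = (\<lambda>l. \<Sum>m. of_real ((- t) ^ m / fact m) * (A ^^ m) f l)"

definition row_op :: "(nat \<Rightarrow> complex^'h) \<Rightarrow> (nat \<Rightarrow> complex) \<Rightarrow> complex^'h" where
  "row_op c f = (\<Sum>l. f l *s c l)"

definition realised_by :: "(real \<Rightarrow> complex^'h) \<Rightarrow> ((nat \<Rightarrow> complex) \<Rightarrow> nat \<Rightarrow> complex) \<Rightarrow>
    (nat \<Rightarrow> complex) \<Rightarrow> (nat \<Rightarrow> complex^'h) \<Rightarrow> bool" where
  "realised_by \<psi> A b c \<longleftrightarrow>
     in_ell2 b \<and>
     (\<forall>f. in_ell2 f \<longrightarrow> summable (\<lambda>l. f l *s c l)) \<and>
     (\<exists>M. \<forall>f. in_ell2 f \<longrightarrow> norm (row_op c f) \<le> M * ell2_norm f) \<and>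
     (\<forall>t>0. \<forall>f. in_ell2 f \<longrightarrow> in_ell2 (exp_op A t f)) \<and>
     (\<forall>t>0. \<psi> t = row_op c (exp_op A t b))"

section \<open>Hankel operators and the tau function\<close>

definition in_L2 :: "(real \<Rightarrow> complex) \<Rightarrow> bool" where
  "in_L2 f \<longleftrightarrow> f \<in> borel_measurable borel \<and> set_integrable lborel {0<..} (\<lambda>x. (cmod (f x))\<^sup>2)"

definition hankel :: "(real \<Rightarrow> complex^'h) \<Rightarrow> (real \<Rightarrow> complex) \<Rightarrow> real \<Rightarrow> complex^'h" where
  "hankel \<psi> f x = (LINT y:{0<..}|lborel. f y *s \<psi> (x + y))"

definition hankel_adj :: "(real \<Rightarrow> complex^'h) \<Rightarrow> (real \<Rightarrow> complex^'h) \<Rightarrow> real \<Rightarrow> complex" where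
  "hankel_adj \<psi> g x = (LINT y:{0<..}|lborel. dot (conj_vec (\<psi> (x + y))) (g y))"

text \<open>A continuous kernel of an operator on \<open>L\<^sup>2(0,\<infinity>)\<close>; on \<open>(0,\<infinity>) \<times> (0,\<infinity>)\<close> it is unique.\<close>

definition has_kernel :: "((real \<Rightarrow> complex) \<Rightarrow> real \<Rightarrow> complex) \<Rightarrow> (real \<Rightarrow> real \<Rightarrow> complex) \<Rightarrow> bool" where
  "has_kernel T k \<longleftrightarrow> continuous_on ({0<..} \<times> {0<..}) (\<lambda>(x, y). k x y) \<and>
     (\<forall>f. in_L2 f \<longrightarrow> (\<forall>x>0. set_integrable lborel {0<..} (\<lambda>y. k x y * f y) \<and>
        T f x = (LINT y:{0<..}|lborel. k x y * f y)))"

text \<open>The Fredholm determinant \<open>det (I - T P\<^sub>E)\<close>, where \<open>P\<^sub>E\<close> is multiplication by the indicator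
  function of \<open>E \<subseteq> (0,\<infinity>)\<close> and \<open>T\<close> is an integral operator with continuous kernel: Fredholm's series
  for the kernel \<open>k(x,y) I\<^sub>E(y)\<close>, with the \<open>m \<times> m\<close> determinants \<open>det[k(s\<^sub>i,s\<^sub>j)]\<close> expanded.\<close>

definition fredholm_det :: "((real \<Rightarrow> complex) \<Rightarrow> real \<Rightarrow> complex) \<Rightarrow> real set \<Rightarrow> complex" where
  "fredholm_det T E = (let k = (SOME k. has_kernel T k) in
     \<Sum>m. (-1) ^ m / fact m *
       (LINT s:({..<m} \<rightarrow>\<^sub>E E)|(\<Pi>\<^sub>M i\<in>{..<m}. lborel).
          (\<Sum>\<pi> | \<pi> permutes {..<m}. of_int (sign \<pi>) * (\<Prod>i<m. k (s i) (s (\<pi> i))))))"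

definition tau :: "complex^'h^'h \<Rightarrow> (real \<Rightarrow> complex^'h) \<Rightarrow> real \<Rightarrow> complex" where
  "tau \<sigma> \<psi> a = fredholm_det (\<lambda>f. hankel_adj \<psi> (\<lambda>s. \<sigma> *v hankel \<psi> f s)) {a<..}"

text \<open>\<open>D\<close> is the derivative of \<open>log f\<close> at \<open>x\<close>, for whichever local branch of the logarithm.\<close>

definition has_log_derivative :: "(real \<Rightarrow> complex) \<Rightarrow> complex \<Rightarrow> real \<Rightarrow> bool" where
  "has_log_derivative f D x \<longleftrightarrow> f x \<noteq> 0 \<and> (\<exists>f'. (f has_vector_derivative f') (at x) \<and> f' / f x = D)"

section \<open>The Gelfand--Levitan equation\<close>

text \<open>A \<open>(d+1) \<times> (d+1)\<close> matrix is indexed by \<open>'h + unit\<close>, where \<open>CARD('h) = d\<close>. The lower left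
  block is a row \<open>r\<close>, entered without conjugation, so a block \<open>w\<^sup>\<dagger>\<close> is \<open>r = conj_vec w\<close>.\<close>

type_synonym 'h bmat = "complex^('h + unit)^('h + unit)"

definition bmat :: "complex^'h^'h \<Rightarrow> complex^'h \<Rightarrow> complex^'h \<Rightarrow> complex \<Rightarrow> 'h::finite bmat" where
  "bmat U v r z = (\<chi> i j. case i of
      Inl a \<Rightarrow> (case j of Inl b \<Rightarrow> U $ a $ b | Inr _ \<Rightarrow> v $ a)
    | Inr _ \<Rightarrow> (case j of Inl b \<Rightarrow> r $ b | Inr _ \<Rightarrow> z))"

definition block_U :: "'h::finite bmat \<Rightarrow> complex^'h^'h" where
  "block_U M = (\<chi> a b. M $ Inl a $ Inl b)"
definition block_v :: "'h::finite bmat \<Rightarrow> complex^'h" where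
  "block_v M = (\<chi> a. M $ Inl a $ Inr ())"
definition block_r :: "'h::finite bmat \<Rightarrow> complex^'h" where
  "block_r M = (\<chi> b. M $ Inr () $ Inl b)"
definition block_z :: "'h::finite bmat \<Rightarrow> complex" where
  "block_z M = M $ Inr () $ Inr ()"

text \<open>For real \<open>x\<close> one has \<open>\<psi>(\<bar>x) = \<psi>(x)\<close>.\<close>

definition Psi :: "(real \<Rightarrow> complex^'h) \<Rightarrow> real \<Rightarrow> 'h::finite bmat" where
  "Psi \<psi> x = bmat 0 (\<psi> x) (conj_vec (\<psi> x)) 0"

text \<open>The product \<open>M * P\<close> for \<open>P\<close> with diagonal blocks 0, upper right block \<open>\<psi>\<close> and lower left
  block \<open>\<psi>\<^sup>\<dagger>\<close>.\<close>

definition star :: "complex^'h^'h \<Rightarrow> 'h bmat \<Rightarrow> 'h bmat \<Rightarrow> 'h::finite bmat" where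
  "star \<sigma> M P = bmat
     (\<chi> a b. block_v M $ a * block_r P $ b)
     (block_U M *v (\<sigma> *v block_v P))
     (block_z M *s block_r P)
     (dot (block_r M) (\<sigma> *v block_v P))"

definition H_mat :: "complex^'h^'h \<Rightarrow> (real \<Rightarrow> real \<Rightarrow> 'h bmat) \<Rightarrow> real \<Rightarrow> 'h::finite bmat" where
  "H_mat \<sigma> W x = bmat (block_U (W x x) ** \<sigma>) (block_v (W x x))
     (block_r (W x x) v* \<sigma>) (block_z (W x x))"

text \<open>The equation is imposed for \<open>y > x\<close>; the diagonal value \<open>W(x,x)\<close>, which enters \<open>H\<close>, is tied to
  it by continuity of \<open>W(x,\<cdot>)\<close> on \<open>[x,\<infinity>)\<close>.\<close>

definition GL_solution_at :: "complex^'h^'h \<Rightarrow> (real \<Rightarrow> complex^'h) \<Rightarrow>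
    (real \<Rightarrow> real \<Rightarrow> 'h::finite bmat) \<Rightarrow> real \<Rightarrow> bool" where
  "GL_solution_at \<sigma> \<psi> W x \<longleftrightarrow>
     continuous_on {x..} (W x) \<and>
     (\<forall>y>x. set_integrable lborel {x<..} (\<lambda>s. star \<sigma> (W x s) (Psi \<psi> (s + y))) \<and>
        W x y + Psi \<psi> (x + y) + (LINT s:{x<..}|lborel. star \<sigma> (W x s) (Psi \<psi> (s + y))) = 0)"

definition op_norm :: "complex^'n^'m \<Rightarrow> real" where
  "op_norm M = onorm (\<lambda>x. M *v x)"

text \<open>\<open>W\<^sub>x\<^sub>x - W\<^sub>y\<^sub>y = -2 H' W\<close> on \<open>0 < x < y\<close>, including existence of the derivatives.\<close>

definition GL_pde :: "(real \<Rightarrow> real \<Rightarrow> complex^'n^'n) \<Rightarrow> (real \<Rightarrow> complex^'n^'n) \<Rightarrow> bool" where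
  "GL_pde W H \<longleftrightarrow> (\<exists>Wx Wxx Wy Wyy H'. \<forall>x y. 0 < x \<and> x < y \<longrightarrow>
     ((\<lambda>\<xi>. W \<xi> y) has_vector_derivative Wx x y) (at x) \<and>
     ((\<lambda>\<xi>. Wx \<xi> y) has_vector_derivative Wxx x y) (at x) \<and>
     ((\<lambda>\<eta>. W x \<eta>) has_vector_derivative Wy x y) (at y) \<and>
     ((\<lambda>\<eta>. Wy x \<eta>) has_vector_derivative Wyy x y) (at y) \<and>
     (H has_vector_derivative H' x) (at x) \<and>
     Wxx x y - Wyy x y = (-2) *\<^sub>R (H' x ** W x y))"

end

theory Submission
  imports "Jordan_Normal_Form.Determinant" Defs "HOL-Complex_Analysis.Complex_Analysis"
begin

text \<open>With \<open>S = diag(\<sigma>, 1)\<close> the non-associative product is an ordinary one, \<open>W * \<Psi> = W S \<Psi>\<close>, and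
\<open>H(x) = W(x,x) S\<close>. The equation to be solved is thus the matrix equation
\<open>W(x,y) + \<Psi>(x+y) + \<integral>\<^sub>x\<^sup>\<infinity> W(x,s) S \<Psi>(s+y) ds = 0\<close>, whose kernel is a series of exponentials with
coefficients of rank one, \<open>\<Psi>\<^sub>k\<^sub>j(t) = \<Sum>\<^sub>\<nu> A\<^sub>k\<^sub>\<nu> C\<^sub>\<nu>\<^sub>j exp(-\<lambda>\<^sub>\<nu> t)\<close>; the index \<open>\<nu>\<close> runs through two copies of
the naturals, one for each off-diagonal block of \<open>\<Psi>\<close>.

Finite sums. Write \<open>e\<^sub>\<nu> = exp(-\<lambda>\<^sub>\<nu> x)\<close>, \<open>E\<^sub>\<nu>\<^sub>\<mu> = e\<^sub>\<nu> e\<^sub>\<mu> / (\<lambda>\<^sub>\<nu> + \<lambda>\<^sub>\<mu>)\<close> and \<open>G = C S A\<close>. Looking for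
\<open>W\<^sub>i\<^sub>j(x,y) = \<Sum>\<^sub>\<mu> \<omega>\<^sup>i\<^sub>\<mu>(x) C\<^sub>\<mu>\<^sub>j exp(-\<lambda>\<^sub>\<mu> y)\<close> turns the integral equation into the linear system
\<open>\<omega>\<^sup>i (I - M) = - A\<^sub>i e\<close>, where \<open>M\<^sub>\<nu>\<^sub>\<mu> = - G\<^sub>\<nu>\<^sub>\<mu> E\<^sub>\<nu>\<^sub>\<mu>\<close>. Let \<open>D(x) = det (I - M(x))\<close>. As \<open>E' = - e e\<^sup>T\<close>, Jacobi's
formula gives \<open>D'/D = trace H\<close> (\<open>log_deriv_finite\<close>). Differentiating the system twice shows that the
residual \<open>\<omega>'' - \<lambda>\<^sup>2 \<omega> + 2 H' \<omega>\<close> solves the homogeneous system, hence vanishes where \<open>D \<noteq> 0\<close>; this is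
the differential equation (\<open>wave_residual_homogeneous\<close>, \<open>PDE_finite\<close>).

Infinite sums. A minor is at most the product of the row sums of its entries, so the determinants of
the truncations converge uniformly on half planes \<open>Re x \<ge> \<epsilon>\<close> (\<open>det_id_minus_uniform_limit\<close>). By the matrix
determinant lemma \<open>W\<^sub>i\<^sub>j = N\<^sub>i\<^sub>j / D - 1\<close> with \<open>N\<^sub>i\<^sub>j\<close> a determinant of the same type, so that no inverse
has to be estimated: wherever the limit of \<open>D\<close> is not zero, all quantities converge locally uniformly.
They are holomorphic in \<open>x\<close> and \<open>y\<close>, so their derivatives converge as well and the identities for finite
sums pass to the limit (\<open>log_deriv\<close>, \<open>PDE\<close>, \<open>GL\<close>).

The tau function. For a truncated symbol the kernel of \<open>\<Gamma>\<^sup>\<dagger> \<sigma> \<Gamma>\<close> is degenerate, and the integrals in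
Fredholm's series are sums over tuples of indices that collect the principal minors of a product
\<open>R E\<close>; by block elimination \<open>det (I - R E)\<close> is the determinant \<open>D\<close> of the doubled system. The bounds
on minors allow exchanging the limit with the series, so \<open>\<tau>(2x)\<close> is the limit of \<open>D(x)\<close>
(\<open>tau_eq\<close>).

The smallness condition in (iii) says that the Hankel operator with symbol \<open>\<psi>\<close> has Hilbert--Schmidt
norm below 1. Every row of \<open>W(x,\<cdot>)\<close> then satisfies an \<open>L\<^sup>2\<close> estimate uniform in \<open>x\<close>, so the logarithmic
derivative of \<open>\<tau>\<close> is bounded wherever \<open>\<tau> \<noteq> 0\<close>. Since \<open>\<tau> \<rightarrow> 1\<close> at infinity, a zero would contradict this
bound (\<open>trace_bound\<close>, \<open>no_zero_of_bounded_log_derivative\<close>). Hence \<open>\<tau>\<close> has no zeros and the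
differential equation holds throughout.\<close>

no_notation Matrix.vec_index (infixl "$" 100)
no_notation fps_nth (infixl "$" 75)

section \<open>Determinants over finite index sets\<close>

text \<open>Arbitrary finite index sets let principal minors and truncations of one infinite matrix be
  compared without renumbering rows and columns.\<close>
definition det_on :: "'i set \<Rightarrow> ('i \<Rightarrow> 'i \<Rightarrow> complex) \<Rightarrow> complex" where
  "det_on F M = (\<Sum>p | p permutes F. of_int (sign p) * (\<Prod>i\<in>F. M i (p i)))"

definition det_id_minus :: "'i set \<Rightarrow> ('i \<Rightarrow> 'i \<Rightarrow> complex) \<Rightarrow> complex" where
  "det_id_minus F M = det_on F (\<lambda>i j. (if i = j then 1 else 0) - M i j)"

lemma det_on_cong: "(\<And>i j. i \<in> F \<Longrightarrow> j \<in> F \<Longrightarrow> M i j = N i j) \<Longrightarrow> det_on F M = det_on F N"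
  unfolding det_on_def
  by (intro sum.cong refl arg_cong2[where f="(*)"] prod.cong) (auto dest: permutes_in_image)

lemma det_id_minus_cong: "(\<And>i j. i \<in> F \<Longrightarrow> j \<in> F \<Longrightarrow> M i j = N i j) \<Longrightarrow> det_id_minus F M = det_id_minus F N"
  unfolding det_id_minus_def by (intro det_on_cong) auto

lemma det_on_reindex:
  assumes "finite F" and f: "bij_betw f F G"
  shows "det_on G M = det_on F (\<lambda>i j. M (f i) (f j))"
proof -
  have inj: "inj_on f F" and fF: "f ` F = G" using f by (auto simp: bij_betw_def)
  have g: "bij_betw (inv_into F f) G F" using f by (rule bij_betw_inv_into)
  have "det_on F (\<lambda>i j. M (f i) (f j)) =
      (\<Sum>p | p permutes F. of_int (sign (map_permutation F f p)) * (\<Prod>i\<in>G. M i (map_permutation F f p i)))"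
    unfolding det_on_def
  proof (intro sum.cong refl)
    fix p assume "p \<in> {p. p permutes F}"
    hence p: "p permutes F" by simp
    have "(\<Prod>i\<in>G. M i (map_permutation F f p i)) = (\<Prod>i\<in>F. M (f i) (f (p i)))"
      by (rule prod.reindex_bij_witness_not_neutral[where i=f and j="inv_into F f" and S'="{}" and T'="{}"])
        (use inj fF assms(1) in \<open>auto simp: map_permutation_apply f_inv_into_f inv_into_into\<close>)
    then show "of_int (sign p) * (\<Prod>i\<in>F. M (f i) (f (p i))) =
        of_int (sign (map_permutation F f p)) * (\<Prod>i\<in>G. M i (map_permutation F f p i))"
      using sign_map_permutation[OF inj p assms(1)] by simp
  qed
  also have "\<dots> = det_on G M"
    unfolding det_on_def
  proof (rule sum.reindex_bij_witness[where j="map_permutation F f" and i="map_permutation G (inv_into F f)"])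
    fix p assume "p \<in> {p. p permutes F}"
    hence p: "p permutes F" by simp
    show "map_permutation G (inv_into F f) (map_permutation F f p) = p"
      by (rule map_permutation_compose_inv[OF f p]) (use inj in auto)
    show "map_permutation F f p \<in> {p. p permutes G}"
      using map_permutation_permutes[OF f p] by simp
  next
    fix p assume "p \<in> {p. p permutes G}"
    hence p: "p permutes G" by simp
    show "map_permutation F f (map_permutation G (inv_into F f) p) = p"
      by (rule map_permutation_compose_inv[OF g p]) (use fF in \<open>auto simp: f_inv_into_f\<close>)
    show "map_permutation G (inv_into F f) p \<in> {p. p permutes F}"
      using map_permutation_permutes[OF g p] by simp
  qed simp
  finally show ?thesis ..
qed

lemma det_id_minus_reindex:
  assumes "finite F" and f: "bij_betw f F G"
  shows "det_id_minus G M = det_id_minus F (\<lambda>i j. M (f i) (f j))"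
  unfolding det_id_minus_def det_on_reindex[OF assms] using f
  by (intro det_on_cong) (auto simp: bij_betw_def inj_on_eq_iff)

lemma det_on_eq_det: "det_on {..<n} M = Determinant.det (Matrix.mat n n (\<lambda>(i, j). M i j))"
  unfolding det_on_def Determinant.det_def
  by (auto simp: atLeast0LessThan intro!: sum.cong prod.cong dest: permutes_in_image)

lemma det_on_identical_rows:
  assumes "finite F" "a \<in> F" "b \<in> F" "a \<noteq> b" "\<And>j. j \<in> F \<Longrightarrow> M a j = M b j"
  shows "det_on F M = 0"
proof -
  define n where "n = card F"
  obtain f where f: "bij_betw f {..<n} F"
    using ex_bij_betw_nat_finite[OF assms(1)] by (auto simp: n_def atLeast0LessThan)
  obtain i j where ij: "i < n" "j < n" "f i = a" "f j = b"
    using f assms(2,3) unfolding bij_betw_def by auto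
  have "det_on F M = Determinant.det (Matrix.mat n n (\<lambda>(i, j). M (f i) (f j)))"
    by (simp add: det_on_reindex[OF _ f] det_on_eq_det)
  also have "\<dots> = 0"
  proof (rule Determinant.det_identical_rows[where n=n and i=i and j=j])
    show "Matrix.row (Matrix.mat n n (\<lambda>(i, j). M (f i) (f j))) i = Matrix.row (Matrix.mat n n (\<lambda>(i, j). M (f i) (f j))) j"
      using ij f assms(5) by (intro eq_vecI) (auto simp: bij_betw_def)
  qed (use ij assms(4) in auto)
  finally show ?thesis .
qed

lemma det_on_mult:
  assumes "finite F"
  shows "det_on F (\<lambda>i k. \<Sum>j\<in>F. A i j * B j k) = det_on F A * det_on F B"
proof -
  define n where "n = card F"
  obtain f where f: "bij_betw f {..<n} F"
    using ex_bij_betw_nat_finite[OF assms(1)] by (auto simp: n_def atLeast0LessThan)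
  have s: "(\<Sum>j\<in>F. A (f i) j * B j (f k)) = (\<Sum>j<n. A (f i) (f j) * B (f j) (f k))" for i k
    using sum.reindex_bij_betw[OF f, of "\<lambda>j. A (f i) j * B j (f k)"] by simp
  have "det_on F (\<lambda>i k. \<Sum>j\<in>F. A i j * B j k) =
      Determinant.det (Matrix.mat n n (\<lambda>(i, k). \<Sum>j<n. A (f i) (f j) * B (f j) (f k)))"
    by (simp add: det_on_reindex[OF _ f] det_on_eq_det s)
  also have "Matrix.mat n n (\<lambda>(i, k). \<Sum>j<n. A (f i) (f j) * B (f j) (f k)) =
      Matrix.mat n n (\<lambda>(i, j). A (f i) (f j)) * Matrix.mat n n (\<lambda>(i, j). B (f i) (f j))"
    by (rule eq_matI) (auto simp: scalar_prod_def atLeast0LessThan)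
  also have "Determinant.det \<dots> = det_on F A * det_on F B"
    by (subst Determinant.det_mult) (auto simp: det_on_reindex[OF _ f] det_on_eq_det)
  finally show ?thesis .
qed

lemma det_on_inverse:
  assumes "finite F" "det_on F A \<noteq> 0"
  obtains Q where "\<And>i k. i \<in> F \<Longrightarrow> k \<in> F \<Longrightarrow> (\<Sum>j\<in>F. A i j * Q j k) = (if i = k then 1 else 0)"
    "\<And>i k. i \<in> F \<Longrightarrow> k \<in> F \<Longrightarrow> (\<Sum>j\<in>F. Q i j * A j k) = (if i = k then 1 else 0)"
proof -
  define n where "n = card F"
  obtain f where f: "bij_betw f {..<n} F"
    using ex_bij_betw_nat_finite[OF assms(1)] by (auto simp: n_def atLeast0LessThan)
  define g where "g = inv_into {..<n} f"
  have g: "bij_betw g F {..<n}" unfolding g_def by (rule bij_betw_inv_into[OF f])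
  have fg: "f (g i) = i" "g i < n" if "i \<in> F" for i
    using that f g by (auto simp: g_def bij_betw_def f_inv_into_f)
  have gf: "g (f i) = i" if "i < n" for i
    using that f by (auto simp: g_def bij_betw_def)
  define A' where "A' = Matrix.mat n n (\<lambda>(i, j). A (f i) (f j))"
  define d where "d = Determinant.det A'"
  have d: "d \<noteq> 0" using assms(2) by (simp add: d_def A'_def det_on_reindex[OF _ f] det_on_eq_det)
  have A': "A' \<in> carrier_mat n n" by (simp add: A'_def)
  define Q where "Q = (\<lambda>i j. adj_mat A' $$ (g i, g j) / d)"
  have s: "(\<Sum>j\<in>F. h j) = (\<Sum>j<n. h (f j))" for h :: "'a \<Rightarrow> complex"
    using sum.reindex_bij_betw[OF f, of h] by simp
  have eq: "g i = g k \<longleftrightarrow> i = k" if "i \<in> F" "k \<in> F" for i k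
    using g that by (auto simp: bij_betw_def inj_on_eq_iff)
  have car: "adj_mat A' \<in> carrier_mat n n" by (rule adj_mat[OF A'])
  have 1: "(\<Sum>j\<in>F. A i j * Q j k) = (if i = k then 1 else 0)" if "i \<in> F" "k \<in> F" for i k
  proof -
    have "(\<Sum>j\<in>F. A i j * Q j k) = (\<Sum>j<n. A' $$ (g i, j) * adj_mat A' $$ (j, g k)) / d"
      unfolding s Q_def using fg that by (simp add: gf A'_def sum_divide_distrib)
    also have "(\<Sum>j<n. A' $$ (g i, j) * adj_mat A' $$ (j, g k)) = (A' * adj_mat A') $$ (g i, g k)"
      using car A' fg that by (auto simp: scalar_prod_def atLeast0LessThan)
    also have "\<dots> = d * (if i = k then 1 else 0)"
      unfolding adj_mat(2)[OF A'] using fg that by (simp add: d_def eq)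
    finally show ?thesis using d by auto
  qed
  have 2: "(\<Sum>j\<in>F. Q i j * A j k) = (if i = k then 1 else 0)" if "i \<in> F" "k \<in> F" for i k
  proof -
    have "(\<Sum>j\<in>F. Q i j * A j k) = (\<Sum>j<n. adj_mat A' $$ (g i, j) * A' $$ (j, g k)) / d"
      unfolding s Q_def using fg that by (simp add: gf A'_def sum_divide_distrib)
    also have "(\<Sum>j<n. adj_mat A' $$ (g i, j) * A' $$ (j, g k)) = (adj_mat A' * A') $$ (g i, g k)"
      using car A' fg that by (auto simp: scalar_prod_def atLeast0LessThan)
    also have "\<dots> = d * (if i = k then 1 else 0)"
      unfolding adj_mat(3)[OF A'] using fg that by (simp add: d_def eq)
    finally show ?thesis using d by auto
  qed
  show ?thesis by (rule that[OF 1 2])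
qed

text \<open>Choosing in each factor of \<open>\<Prod> (\<delta>\<^sub>i\<^sub>,\<^sub>p\<^sub>i - M\<^sub>i\<^sub>,\<^sub>p\<^sub>i)\<close> one of the two terms leaves, for the set \<open>J\<close> of rows
  where \<open>M\<close> was chosen, exactly the permutations that fix the complement of \<open>J\<close>.\<close>
lemma det_id_minus_principal_minors:
  assumes "finite F"
  shows "det_id_minus F M = (\<Sum>J\<in>Pow F. (- 1) ^ card J * det_on J M)"
proof -
  have "det_id_minus F M = (\<Sum>p | p permutes F. \<Sum>J\<in>Pow F. of_int (sign p) *
      ((- 1) ^ card J * (\<Prod>i\<in>J. M i (p i)) * (\<Prod>i\<in>F - J. if i = p i then 1 else 0)))"
    unfolding det_id_minus_def det_on_def by (simp add: prod_diff_conv_sum[OF assms] sum_distrib_left)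
  also have "\<dots> = (\<Sum>J\<in>Pow F. \<Sum>p | p permutes F. of_int (sign p) *
      ((- 1) ^ card J * (\<Prod>i\<in>J. M i (p i)) * (\<Prod>i\<in>F - J. if i = p i then 1 else 0)))"
    by (rule sum.swap)
  also have "\<dots> = (\<Sum>J\<in>Pow F. (- 1) ^ card J * det_on J M)"
  proof (intro sum.cong refl)
    fix J assume J: "J \<in> Pow F"
    have "(\<Sum>p | p permutes F. of_int (sign p) *
      ((- 1) ^ card J * (\<Prod>i\<in>J. M i (p i)) * (\<Prod>i\<in>F - J. if i = p i then 1 else 0))) =
      (\<Sum>p | p permutes J. of_int (sign p) *
      ((- 1) ^ card J * (\<Prod>i\<in>J. M i (p i)) * (\<Prod>i\<in>F - J. if i = p i then 1 else 0)))"
    proof (rule sum.mono_neutral_right)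
      show "finite {p. p permutes F}" using assms by (rule finite_permutations)
      show "{p. p permutes J} \<subseteq> {p. p permutes F}" using J by (auto intro: permutes_subset)
      show "\<forall>p\<in>{p. p permutes F} - {p. p permutes J}. of_int (sign p) *
        ((- 1) ^ card J * (\<Prod>i\<in>J. M i (p i)) * (\<Prod>i\<in>F - J. if i = p i then (1::complex) else 0)) = 0"
      proof
        fix p assume p: "p \<in> {p. p permutes F} - {p. p permutes J}"
        have "\<exists>i\<in>F - J. p i \<noteq> i"
        proof (rule ccontr)
          assume "\<not> (\<exists>i\<in>F - J. p i \<noteq> i)"
          hence "p permutes J" using p by (auto intro: permutes_superset)
          with p show False by simp
        qed
        then obtain i where "i \<in> F - J" "p i \<noteq> i" by auto
        hence "(\<Prod>i\<in>F - J. if i = p i then (1::complex) else 0) = 0"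
          using assms by (intro prod_zero) (auto intro!: bexI[of _ i])
        then show "of_int (sign p) * ((- 1) ^ card J * (\<Prod>i\<in>J. M i (p i)) *
           (\<Prod>i\<in>F - J. if i = p i then (1::complex) else 0)) = 0" by (simp only: mult_zero_right)
      qed
    qed
    also have "\<dots> = (\<Sum>p | p permutes J. (- 1) ^ card J * (of_int (sign p) * (\<Prod>i\<in>J. M i (p i))))"
    proof (intro sum.cong refl)
      fix p assume "p \<in> {p. p permutes J}"
      hence "(\<Prod>i\<in>F - J. if i = p i then (1::complex) else 0) = 1"
        by (intro prod.neutral) (auto simp: permutes_not_in)
      then show "of_int (sign p) * ((- 1) ^ card J * (\<Prod>i\<in>J. M i (p i)) *
          (\<Prod>i\<in>F - J. if i = p i then (1::complex) else 0)) =
        (- 1) ^ card J * (of_int (sign p) * (\<Prod>i\<in>J. M i (p i)))" by (simp only:) (simp add: mult_ac)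
    qed
    finally show "(\<Sum>p | p permutes F. of_int (sign p) *
      ((- 1) ^ card J * (\<Prod>i\<in>J. M i (p i)) * (\<Prod>i\<in>F - J. if i = p i then 1 else 0))) =
      (- 1) ^ card J * det_on J M" by (simp only: det_on_def sum_distrib_left)
  qed
  finally show ?thesis .
qed

text \<open>Permutations of \<open>J\<close> are among all maps \<open>J \<Rightarrow> J\<close>, and summing over all maps factorises into row sums.
  The bound is multiplicative in \<open>J\<close> and carries no factorial, hence can be summed over all \<open>J\<close>.\<close>
lemma det_on_bound:
  assumes "finite J" "\<And>i. i \<in> J \<Longrightarrow> (\<Sum>j\<in>J. norm (M i j)) \<le> r i"
  shows "norm (det_on J M) \<le> (\<Prod>i\<in>J. r i)"
proof -
  have "norm (det_on J M) \<le> (\<Sum>p | p permutes J. norm (of_int (sign p) * (\<Prod>i\<in>J. M i (p i))))"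
    unfolding det_on_def by (rule norm_sum)
  also have "\<dots> = (\<Sum>p | p permutes J. (\<Prod>i\<in>J. norm (M i (p i))))"
    by (intro sum.cong refl) (auto simp: norm_mult prod_norm sign_def)
  also have "\<dots> = (\<Sum>f\<in>(\<lambda>p. restrict p J) ` {p. p permutes J}. (\<Prod>i\<in>J. norm (M i (f i))))"
  proof (subst sum.reindex)
    show "inj_on (\<lambda>p. restrict p J) {p. p permutes J}"
    proof (rule inj_onI)
      fix p q assume pq: "p \<in> {p. p permutes J}" "q \<in> {p. p permutes J}" "restrict p J = restrict q J"
      show "p = q"
      proof
        fix x show "p x = q x"
          using pq(1,2) fun_cong[OF pq(3), of x] by (cases "x \<in> J") (auto simp: permutes_not_in)
      qed
    qed
  qed simp
  also have "\<dots> \<le> (\<Sum>f\<in>J \<rightarrow>\<^sub>E J. (\<Prod>i\<in>J. norm (M i (f i))))"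
    proof (rule sum_mono2)
    show "finite (J \<rightarrow>\<^sub>E J)" using assms(1) by (intro finite_PiE) auto
    show "(\<lambda>p. restrict p J) ` {p. p permutes J} \<subseteq> J \<rightarrow>\<^sub>E J"
      by (auto simp: permutes_in_image)
  qed (auto intro: prod_nonneg)
  also have "\<dots> = (\<Prod>i\<in>J. \<Sum>j\<in>J. norm (M i j))"
    by (rule prod_sum_PiE[symmetric]) (use assms(1) in auto)
  also have "\<dots> \<le> (\<Prod>i\<in>J. r i)"
    by (intro prod_mono) (auto intro: assms sum_nonneg)
  finally show ?thesis .
qed

lemma det_on_rank_one:
  assumes "finite J" "card J \<ge> 2"
  shows "det_on J (\<lambda>i j. b i * a j) = 0"
proof -
  obtain x y where xy: "x \<in> J" "y \<in> J" "x \<noteq> y"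
    using assms by (metis card_le_Suc0_iff_eq not_less_eq_eq numeral_2_eq_2)
  have "det_on J (\<lambda>i j. b i * a j) = (\<Prod>i\<in>J. b i) * det_on J (\<lambda>i j. a j)"
    unfolding det_on_def by (simp add: prod.distrib sum_distrib_left mult_ac)
  also have "det_on J (\<lambda>i j. a j) = 0"
    by (rule det_on_identical_rows[OF assms(1) xy]) simp
  finally show ?thesis by simp
qed

lemma sum_Pow_small:
  assumes "finite F" "\<And>J. J \<subseteq> F \<Longrightarrow> card J \<ge> 2 \<Longrightarrow> f J = (0::complex)"
  shows "(\<Sum>J\<in>Pow F. f J) = f {} + (\<Sum>i\<in>F. f {i})"
proof -
  have "(\<Sum>J\<in>Pow F. f J) = (\<Sum>J\<in>insert {} ((\<lambda>i. {i}) ` F). f J)"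
  proof (rule sum.mono_neutral_right)
    show "\<forall>J\<in>Pow F - insert {} ((\<lambda>i. {i}) ` F). f J = 0"
    proof
      fix J assume J: "J \<in> Pow F - insert {} ((\<lambda>i. {i}) ` F)"
      hence "finite J" using assms(1) by (auto intro: finite_subset)
      have "card J \<noteq> 0" using J \<open>finite J\<close> by auto
      moreover have "card J \<noteq> 1" using J by (auto simp: card_1_singleton_iff)
      ultimately show "f J = 0" using J by (intro assms(2)) auto
    qed
  qed (use assms in auto)
  also have "\<dots> = f {} + (\<Sum>i\<in>F. f {i})"
    using assms(1) by (subst sum.insert) (auto simp: sum.reindex)
  finally show ?thesis .
qed

lemma det_on_empty [simp]: "det_on {} M = 1"
  by (simp add: det_on_def)

lemma det_on_singleton [simp]: "det_on {i} M = M i i"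
  by (simp add: det_on_def)

lemma det_id_minus_rank_one:
  assumes "finite F"
  shows "det_id_minus F (\<lambda>i j. b i * a j) = 1 - (\<Sum>i\<in>F. b i * a i)"
  unfolding det_id_minus_principal_minors[OF assms]
  by (subst sum_Pow_small[OF assms]) (auto simp: det_on_rank_one finite_subset[OF _ assms] sum_negf)

text \<open>The matrix determinant lemma: \<open>I - M - b a\<^sup>T = (I - M) (I - (Q b) a\<^sup>T)\<close>. It expresses the bilinear form
  \<open>a\<^sup>T Q b\<close> of the resolvent \<open>Q = (I - M)\<^sup>-\<^sup>1\<close> as a quotient of two determinants to which the same
  estimates apply.\<close>
lemma det_id_minus_rank_one_update:
  assumes "finite F"
    and Q: "\<And>i k. i \<in> F \<Longrightarrow> k \<in> F \<Longrightarrow>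
      (\<Sum>j\<in>F. ((if i = j then 1 else 0) - M i j) * Q j k) = (if i = k then 1 else 0)"
  shows "det_id_minus F (\<lambda>i j. M i j + b i * a j) = det_id_minus F M * (1 - (\<Sum>i\<in>F. \<Sum>j\<in>F. a i * Q i j * b j))"
proof -
  define c where "c i = (\<Sum>j\<in>F. Q i j * b j)" for i
  have "det_id_minus F M * det_id_minus F (\<lambda>i j. c i * a j) =
    det_on F (\<lambda>i k. \<Sum>j\<in>F. ((if i = j then 1 else 0) - M i j) * ((if j = k then 1 else 0) - c j * a k))"
    unfolding det_id_minus_def by (rule det_on_mult[OF assms(1), symmetric])
  also have "\<dots> = det_id_minus F (\<lambda>i j. M i j + b i * a j)"
    unfolding det_id_minus_def
  proof (rule det_on_cong)
    fix i k assume ik: "i \<in> F" "k \<in> F"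
    have "(\<Sum>j\<in>F. ((if i = j then 1 else 0) - M i j) * ((if j = k then 1 else 0) - c j * a k)) =
      (\<Sum>j\<in>F. ((if i = j then 1 else 0) - M i j) * (if j = k then 1 else 0)) -
      (\<Sum>j\<in>F. ((if i = j then 1 else 0) - M i j) * c j) * a k"
      by (simp add: right_diff_distrib sum_subtractf sum_distrib_right mult.assoc)
    also have "(\<Sum>j\<in>F. ((if i = j then 1 else 0) - M i j) * (if j = k then 1 else 0)) =
       (if i = k then 1 else 0) - M i k"
      using ik assms(1) by (simp add: mult_if_delta if_distrib[of "\<lambda>x. _ * x"] sum.delta cong: if_cong)
    also have "(\<Sum>j\<in>F. ((if i = j then 1 else 0) - M i j) * c j) =
       (\<Sum>l\<in>F. (\<Sum>j\<in>F. ((if i = j then 1 else 0) - M i j) * Q j l) * b l)"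
      unfolding c_def sum_distrib_left sum_distrib_right
      by (subst sum.swap) (simp add: mult.assoc)
    also have "\<dots> = (\<Sum>l\<in>F. (if i = l then 1 else 0) * b l)"
      using Q ik by (intro sum.cong) auto
    also have "\<dots> = b i" using ik assms(1) by (simp add: if_distrib[of "\<lambda>x. x * _"] sum.delta cong: if_cong)
    finally show "(\<Sum>j\<in>F. ((if i = j then 1 else 0) - M i j) * ((if j = k then 1 else 0) - c j * a k)) =
      (if i = k then 1 else 0) - (M i k + b i * a k)" by (simp only: diff_diff_eq)
  qed
  finally have "det_id_minus F (\<lambda>i j. M i j + b i * a j) = det_id_minus F M * (1 - (\<Sum>i\<in>F. c i * a i))"
    by (simp add: det_id_minus_rank_one[OF assms(1)])
  also have "(\<Sum>i\<in>F. c i * a i) = (\<Sum>i\<in>F. \<Sum>j\<in>F. a i * Q i j * b j)"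
    unfolding c_def sum_distrib_right by (intro sum.cong refl) (simp add: mult_ac)
  finally show ?thesis .
qed

text \<open>A tuple with a repeated entry gives a determinant with two equal rows; the injective ones enumerate
  each \<open>J\<close> of size \<open>m\<close> in \<open>m!\<close> ways.\<close>
lemma sum_tuples_eq_minors:
  assumes "finite A"
  shows "(\<Sum>l\<in>{..<m} \<rightarrow>\<^sub>E A. det_on {..<m} (\<lambda>i j. M (l i) (l j))) =
    fact m * (\<Sum>J | J \<subseteq> A \<and> card J = m. det_on J M)"
proof -
  have fin: "finite ({..<m} \<rightarrow>\<^sub>E A)" using assms by (auto intro: finite_PiE)
  define I where "I = {l \<in> {..<m} \<rightarrow>\<^sub>E A. inj_on l {..<m}}"
  have "(\<Sum>l\<in>{..<m} \<rightarrow>\<^sub>E A. det_on {..<m} (\<lambda>i j. M (l i) (l j))) =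
    (\<Sum>l\<in>I. det_on {..<m} (\<lambda>i j. M (l i) (l j)))"
  proof (rule sum.mono_neutral_right[OF fin])
    show "\<forall>l\<in>({..<m} \<rightarrow>\<^sub>E A) - I. det_on {..<m} (\<lambda>i j. M (l i) (l j)) = 0"
    proof
      fix l assume "l \<in> ({..<m} \<rightarrow>\<^sub>E A) - I"
      hence "\<not> inj_on l {..<m}" by (auto simp: I_def)
      then obtain i j where "i < m" "j < m" "i \<noteq> j" "l i = l j" by (auto simp: inj_on_def)
      then show "det_on {..<m} (\<lambda>i j. M (l i) (l j)) = 0"
        by (intro det_on_identical_rows[of _ i j]) auto
    qed
  qed (auto simp: I_def)
  also have "\<dots> = (\<Sum>l\<in>I. det_on (l ` {..<m}) M)"
    by (intro sum.cong refl det_on_reindex[symmetric]) (auto simp: I_def inj_on_imp_bij_betw)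
  also have "\<dots> = (\<Sum>J\<in>{J. J \<subseteq> A \<and> card J = m}. \<Sum>l\<in>{l\<in>I. l ` {..<m} = J}. det_on (l ` {..<m}) M)"
    proof (rule sum.group[symmetric])
    show "finite I" using fin by (simp add: I_def)
    show "finite {J. J \<subseteq> A \<and> card J = m}" using assms by simp
    show "(\<lambda>l. l ` {..<m}) ` I \<subseteq> {J. J \<subseteq> A \<and> card J = m}"
      by (auto simp: I_def card_image PiE_iff)
  qed
  also have "\<dots> = (\<Sum>J | J \<subseteq> A \<and> card J = m. fact m * det_on J M)"
  proof (intro sum.cong refl)
    fix J assume "J \<in> {J. J \<subseteq> A \<and> card J = m}"
    hence J: "J \<subseteq> A" "card J = m" "finite J" using assms by (auto intro: finite_subset)
    have "{l\<in>I. l ` {..<m} = J} = {l \<in> {..<m} \<rightarrow>\<^sub>E J. inj_on l {..<m}}" (is "?L = ?R")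
    proof
      show "?L \<subseteq> ?R" by (auto simp: I_def PiE_def)
      show "?R \<subseteq> ?L"
      proof
        fix l assume l: "l \<in> ?R"
        have "l ` {..<m} \<subseteq> J" using l by auto
        moreover have "card (l ` {..<m}) = card J" using l J by (simp add: card_image)
        ultimately have "l ` {..<m} = J" using J by (metis card_subset_eq)
        with l J show "l \<in> ?L" by (auto simp: I_def PiE_def Pi_def)
      qed
    qed
    moreover have "card ?R = fact m"
    proof -
      have "card ?R = prod ((-) m) {0..<m}"
        using card_inj_on_subset_funcset[of "{..<m}" J "{..<m}"] J by simp
      also have "\<dots> = fact m"
        unfolding fact_prod of_nat_id
        by (rule prod.reindex_bij_witness[where i="\<lambda>i. m - i" and j="\<lambda>i. m - i"]) auto
      finally show ?thesis .
    qed
    ultimately have "card {l\<in>I. l ` {..<m} = J} = fact m" by simp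
    then show "(\<Sum>l\<in>{l\<in>I. l ` {..<m} = J}. det_on (l ` {..<m}) M) = fact m * det_on J M"
      by simp
  qed
  finally show ?thesis by (simp add: sum_distrib_left)
qed

text \<open>Elimination of the off-diagonal blocks: the system with blocks \<open>I, X, Y, I\<close> has Schur complement
  \<open>I - X Y\<close>.\<close>
lemma det_id_minus_block:
  fixes X Y :: "nat \<Rightarrow> nat \<Rightarrow> complex"
  shows "det_id_minus ({..<n} <+> {..<n}) (\<lambda>i j. case i of Inl a \<Rightarrow> (case j of Inl b \<Rightarrow> 0 | Inr b \<Rightarrow> - X a b)
      | Inr a \<Rightarrow> (case j of Inl b \<Rightarrow> - Y a b | Inr b \<Rightarrow> 0)) =
   det_id_minus {..<n} (\<lambda>i k. \<Sum>j<n. X i j * Y j k)" (is "det_id_minus _ ?M = _")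
proof -
  define f :: "nat \<Rightarrow> nat + nat" where "f i = (if i < n then Inl i else Inr (i - n))" for i
  have f: "bij_betw f {..<n+n} ({..<n} <+> {..<n})"
    by (rule bij_betw_byWitness[where f'="\<lambda>s. case s of Inl a \<Rightarrow> a | Inr b \<Rightarrow> n + b"])
       (auto simp: f_def)
  define X' Y' where "X' = Matrix.mat n n (\<lambda>(i, j). X i j)" and "Y' = Matrix.mat n n (\<lambda>(i, j). Y i j)"
  have c: "X' \<in> carrier_mat n n" "Y' \<in> carrier_mat n n" by (auto simp: X'_def Y'_def)
  have "det_id_minus ({..<n} <+> {..<n}) ?M = det_id_minus {..<n+n} (\<lambda>i j. ?M (f i) (f j))"
    by (rule det_id_minus_reindex[OF _ f]) simp
  also have "\<dots> = Determinant.det (four_block_mat (1\<^sub>m n) X' Y' (1\<^sub>m n))"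
    unfolding det_id_minus_def det_on_eq_det
    by (rule arg_cong[where f="Determinant.det"], rule eq_matI) (auto simp: f_def X'_def Y'_def)
  also have "\<dots> = Determinant.det (1\<^sub>m n * 1\<^sub>m n - X' * Y')"
    by (rule det_four_block_mat) (use c in auto)
  also have "1\<^sub>m n * 1\<^sub>m n - X' * Y' =
     Matrix.mat n n (\<lambda>(i, k). (if i = k then 1 else 0) - (\<Sum>j<n. X i j * Y j k))"
    by (rule eq_matI) (auto simp: X'_def Y'_def scalar_prod_def atLeast0LessThan)
  also have "Determinant.det \<dots> = det_id_minus {..<n} (\<lambda>i k. \<Sum>j<n. X i j * Y j k)"
    by (simp add: det_id_minus_def det_on_eq_det)
  finally show ?thesis .
qed

section \<open>Determinants of absolutely summable infinite matrices\<close>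

text \<open>The two expansions into principal minors differ by the minors that are not contained in \<open>F\<close>.\<close>
lemma det_id_minus_diff_bound:
  assumes "finite F'" "F \<subseteq> F'" "\<And>i. i \<in> F' \<Longrightarrow> (\<Sum>j\<in>F'. norm (M i j)) \<le> r i"
  shows "norm (det_id_minus F' M - det_id_minus F M) \<le> (\<Prod>i\<in>F'. 1 + r i) - (\<Prod>i\<in>F. 1 + r i)"
proof -
  have F: "finite F" using assms by (auto intro: finite_subset)
  have sub: "Pow F \<subseteq> Pow F'" using assms by auto
  have P: "(\<Prod>i\<in>G. 1 + r i) = (\<Sum>J\<in>Pow G. \<Prod>i\<in>J. r i)" if "finite G" for G
    using prod_add[OF that, of r "\<lambda>_. 1"] by (simp add: add.commute)
  have "det_id_minus F' M - det_id_minus F M = (\<Sum>J\<in>Pow F' - Pow F. (- 1) ^ card J * det_on J M)"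
    using assms(1) F sub by (simp add: det_id_minus_principal_minors sum_diff)
  also have "norm \<dots> \<le> (\<Sum>J\<in>Pow F' - Pow F. \<Prod>i\<in>J. r i)"
  proof (rule sum_norm_le)
    fix J assume "J \<in> Pow F' - Pow F"
    hence J: "J \<subseteq> F'" by auto
    have "norm (det_on J M) \<le> (\<Prod>i\<in>J. r i)"
    proof (rule det_on_bound)
      show "finite J" using J assms by (auto intro: finite_subset)
      fix i assume "i \<in> J"
      have "(\<Sum>j\<in>J. norm (M i j)) \<le> (\<Sum>j\<in>F'. norm (M i j))"
        using J assms by (intro sum_mono2) auto
      also have "\<dots> \<le> r i" using \<open>i \<in> J\<close> J assms by auto
      finally show "(\<Sum>j\<in>J. norm (M i j)) \<le> r i" .
    qed
    then show "norm ((- 1) ^ card J * det_on J M) \<le> (\<Prod>i\<in>J. r i)"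
      by (simp add: norm_mult norm_power)
  qed
  also have "\<dots> = (\<Prod>i\<in>F'. 1 + r i) - (\<Prod>i\<in>F. 1 + r i)"
    using assms(1) F sub by (simp add: P sum_diff)
  finally show ?thesis .
qed

lemma prod_one_plus_le_exp:
  fixes r :: "'i \<Rightarrow> real"
  assumes "\<And>i. i \<in> F \<Longrightarrow> r i \<ge> 0" "(\<Sum>i\<in>F. r i) \<le> B" "finite F"
  shows "(\<Prod>i\<in>F. 1 + r i) \<le> exp B"
proof -
  have "(\<Prod>i\<in>F. 1 + r i) \<le> (\<Prod>i\<in>F. exp (r i))"
    using assms by (intro prod_mono) (auto intro: add_nonneg_nonneg)
  also have "\<dots> = exp (\<Sum>i\<in>F. r i)" using assms by (simp add: exp_sum)
  also have "\<dots> \<le> exp B" using assms by simp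
  finally show ?thesis .
qed

lemma det_id_minus_minus_one_bound:
  assumes "finite F" "\<And>i. i \<in> F \<Longrightarrow> (\<Sum>j\<in>F. norm (M i j)) \<le> r i" "(\<Sum>i\<in>F. r i) \<le> B"
  shows "norm (det_id_minus F M - 1) \<le> exp B - 1"
proof -
  have r: "r i \<ge> 0" if "i \<in> F" for i
    using order.trans[OF sum_nonneg assms(2)[OF that]] by simp
  have "norm (det_id_minus F M - det_id_minus {} M) \<le> (\<Prod>i\<in>F. 1 + r i) - (\<Prod>i\<in>{}. 1 + r i)"
    by (rule det_id_minus_diff_bound) (use assms in auto)
  also have "\<dots> \<le> exp B - 1" using prod_one_plus_le_exp[of F r B] assms r by simp
  finally show ?thesis by (simp add: det_id_minus_def)
qed

lemma det_id_minus_bound: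
  assumes "finite F" "\<And>i. i \<in> F \<Longrightarrow> (\<Sum>j\<in>F. norm (M i j)) \<le> r i" "(\<Sum>i\<in>F. r i) \<le> B"
  shows "norm (det_id_minus F M) \<le> exp B"
  using det_id_minus_minus_one_bound[OF assms] norm_triangle_ineq[of "det_id_minus F M - 1" 1] by simp

text \<open>The products \<open>\<Prod> (1 + r\<^sub>i)\<close> dominate the increments and do not depend on \<open>x\<close>, so one Cauchy sequence of
  real numbers controls the whole family.\<close>
lemma det_id_minus_uniform_limit:
  assumes fin: "\<And>n. finite (idx n)" and mono: "\<And>m n. m \<le> n \<Longrightarrow> idx m \<subseteq> idx n"
    and r0: "\<And>i. r i \<ge> 0" and B: "\<And>n. (\<Sum>i\<in>idx n. r i) \<le> B"
    and M: "\<And>x n i. x \<in> X \<Longrightarrow> i \<in> idx n \<Longrightarrow> (\<Sum>j\<in>idx n. norm (M x i j)) \<le> r i"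
  shows "uniform_limit X (\<lambda>n x. det_id_minus (idx n) (M x)) (\<lambda>x. lim (\<lambda>n. det_id_minus (idx n) (M x))) sequentially"
proof -
  define p where "p n = (\<Prod>i\<in>idx n. 1 + r i)" for n
  have inc: "p m \<le> p n" if "m \<le> n" for m n
    unfolding p_def using fin mono[OF that] r0 by (intro prod_mono2) (auto intro: add_nonneg_nonneg)
  have "p n \<le> exp B" for n unfolding p_def by (intro prod_one_plus_le_exp) (use r0 B fin in auto)
  hence "convergent p"
    by (intro Bseq_mono_convergent BseqI'[where K="exp B"])
      (use inc in \<open>auto simp: p_def abs_of_nonneg r0 prod_nonneg add_nonneg_nonneg\<close>)
  hence "Cauchy p" by (rule convergent_Cauchy)
  have "uniformly_Cauchy_on X (\<lambda>n x. det_id_minus (idx n) (M x))"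
  proof (rule uniformly_Cauchy_onI')
    fix e :: real assume "e > 0"
    with \<open>Cauchy p\<close> obtain N where N: "\<And>m n. m \<ge> N \<Longrightarrow> n \<ge> N \<Longrightarrow> dist (p m) (p n) < e"
      unfolding Cauchy_def by blast
    show "\<exists>N. \<forall>x\<in>X. \<forall>m\<ge>N. \<forall>n>m. dist (det_id_minus (idx m) (M x)) (det_id_minus (idx n) (M x)) < e"
    proof (intro exI[of _ N] ballI allI impI)
      fix x m n assume x: "x \<in> X" "N \<le> m" "m < n"
      have "dist (det_id_minus (idx m) (M x)) (det_id_minus (idx n) (M x)) = norm (det_id_minus (idx n) (M x) - det_id_minus (idx m) (M x))"
        by (simp add: dist_norm norm_minus_commute)
      also have "\<dots> \<le> p n - p m"
        unfolding p_def by (rule det_id_minus_diff_bound) (use x fin mono M in auto)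
      also have "\<dots> < e" using N[of n m] x by (auto simp: dist_real_def)
      finally show "dist (det_id_minus (idx m) (M x)) (det_id_minus (idx n) (M x)) < e" .
    qed
  qed
  then show ?thesis
    using Cauchy_uniformly_convergent uniformly_convergent_uniform_limit_iff by blast
qed

text \<open>A product of at least two factors that vanish at \<open>z\<close> vanishes to second order.\<close>
lemma det_on_has_derivative_0:
  assumes "finite J" "card J \<ge> 2" "\<And>i j. i \<in> J \<Longrightarrow> j \<in> J \<Longrightarrow> X z i j = 0"
    "\<And>i j. i \<in> J \<Longrightarrow> j \<in> J \<Longrightarrow> ((\<lambda>z. X z i j) has_field_derivative X' i j) (at z)"
  shows "((\<lambda>z. det_on J (X z)) has_field_derivative 0) (at z)"
  unfolding det_on_def
proof (rule DERIV_cong[OF DERIV_sum])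
  fix p assume "p \<in> {p. p permutes J}"
  hence p: "p permutes J" by simp
  have "((\<lambda>z. \<Prod>i\<in>J. X z i (p i)) has_field_derivative
      (\<Sum>i\<in>J. X' i (p i) * (\<Prod>k\<in>J - {i}. X z k (p k)))) (at z)"
    by (rule has_field_derivative_prod) (use assms p in \<open>auto simp: permutes_in_image\<close>)
  also have "(\<Sum>i\<in>J. X' i (p i) * (\<Prod>k\<in>J - {i}. X z k (p k))) = 0"
  proof (intro sum.neutral ballI)
    fix i assume "i \<in> J"
    obtain k where "k \<in> J - {i}"
      using assms(1,2) \<open>i \<in> J\<close> by (metis DiffI card_le_Suc0_iff_eq not_less_eq_eq numeral_2_eq_2 singletonD)
    hence "(\<Prod>k\<in>J - {i}. X z k (p k)) = 0"
      using assms p by (intro prod_zero) (auto intro!: bexI[of _ k] simp: permutes_in_image)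
    then show "X' i (p i) * (\<Prod>k\<in>J - {i}. X z k (p k)) = 0" by simp
  qed
  finally show "((\<lambda>z. of_int (sign p) * (\<Prod>i\<in>J. X z i (p i))) has_field_derivative of_int (sign p) * 0) (at z)"
    by (rule DERIV_cmult)
qed simp

text \<open>Jacobi's formula. Factor \<open>I - M(y) = (I - M(z)) (I - Q (M(y) - M(z)))\<close> and expand the second
  determinant into principal minors: those of size at least 2 have derivative 0 at \<open>z\<close>, those of size 1
  add up to a trace.\<close>
lemma det_id_minus_has_derivative:
  assumes "finite F"
    and Q: "\<And>i k. i \<in> F \<Longrightarrow> k \<in> F \<Longrightarrow>
      (\<Sum>j\<in>F. ((if i = j then 1 else 0) - M z i j) * Q j k) = (if i = k then 1 else 0)"
    and M': "\<And>i j. i \<in> F \<Longrightarrow> j \<in> F \<Longrightarrow> ((\<lambda>z. M z i j) has_field_derivative M' i j) (at z)"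
  shows "((\<lambda>z. det_id_minus F (M z)) has_field_derivative - det_id_minus F (M z) * (\<Sum>i\<in>F. \<Sum>j\<in>F. Q i j * M' j i)) (at z)"
proof -
  define X where "X y i k = (\<Sum>j\<in>F. Q i j * (M y j k - M z j k))" for y i k
  define X' where "X' i k = (\<Sum>j\<in>F. Q i j * M' j k)" for i k
  have eq: "det_id_minus F (M y) = det_id_minus F (M z) * det_id_minus F (X y)" for y
  proof -
    have "det_id_minus F (M z) * det_id_minus F (X y) =
      det_on F (\<lambda>i k. \<Sum>j\<in>F. ((if i = j then 1 else 0) - M z i j) * ((if j = k then 1 else 0) - X y j k))"
      unfolding det_id_minus_def by (rule det_on_mult[OF assms(1), symmetric])
    also have "\<dots> = det_id_minus F (M y)"
      unfolding det_id_minus_def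
    proof (rule det_on_cong)
      fix i k assume ik: "i \<in> F" "k \<in> F"
      have "(\<Sum>j\<in>F. ((if i = j then 1 else 0) - M z i j) * ((if j = k then 1 else 0) - X y j k)) =
        (\<Sum>j\<in>F. ((if i = j then 1 else 0) - M z i j) * (if j = k then 1 else 0)) -
        (\<Sum>j\<in>F. ((if i = j then 1 else 0) - M z i j) * X y j k)"
        by (simp add: right_diff_distrib sum_subtractf)
      also have "(\<Sum>j\<in>F. ((if i = j then 1 else 0) - M z i j) * (if j = k then 1 else 0)) =
         (if i = k then 1 else 0) - M z i k"
        using ik assms(1) by (simp add: if_distrib[of "\<lambda>x. _ * x"] sum.delta cong: if_cong)
      also have "(\<Sum>j\<in>F. ((if i = j then 1 else 0) - M z i j) * X y j k) =
         (\<Sum>l\<in>F. (\<Sum>j\<in>F. ((if i = j then 1 else 0) - M z i j) * Q j l) * (M y l k - M z l k))"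
        unfolding X_def sum_distrib_left sum_distrib_right
        by (subst sum.swap) (simp add: mult.assoc)
      also have "\<dots> = (\<Sum>l\<in>F. (if i = l then 1 else 0) * (M y l k - M z l k))"
        using Q ik by (intro sum.cong) auto
      also have "\<dots> = M y i k - M z i k"
        using ik assms(1) by (simp add: if_distrib[of "\<lambda>x. x * _"] sum.delta cong: if_cong)
      finally show "(\<Sum>j\<in>F. ((if i = j then 1 else 0) - M z i j) * ((if j = k then 1 else 0) - X y j k)) =
        (if i = k then 1 else 0) - M y i k" by (simp only:) simp
    qed
    finally show ?thesis ..
  qed
  have X: "((\<lambda>y. X y i k) has_field_derivative X' i k) (at z)" if "i \<in> F" "k \<in> F" for i k
    unfolding X_def X'_def using that
    by (auto intro!: derivative_eq_intros M' sum.cong)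
  have X0: "X z i k = 0" for i k by (simp add: X_def)
  have "((\<lambda>y. det_id_minus F (X y)) has_field_derivative
     (\<Sum>J\<in>Pow F. (- 1) ^ card J * (if card J = 1 then X' (the_elem J) (the_elem J) else 0))) (at z)"
    unfolding det_id_minus_principal_minors[OF assms(1)]
  proof (rule DERIV_sum)
    fix J assume "J \<in> Pow F"
    hence J: "J \<subseteq> F" "finite J" using assms by (auto intro: finite_subset)
    have "((\<lambda>y. det_on J (X y)) has_field_derivative (if card J = 1 then X' (the_elem J) (the_elem J) else 0)) (at z)"
    proof -
      consider "J = {}" | i where "J = {i}" | "card J \<ge> 2"
      proof -
        have "card J = 0 \<or> card J = 1 \<or> card J \<ge> 2" by linarith
        then show ?thesis using that J(2) by (auto simp: card_1_singleton_iff)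
      qed
      then show ?thesis
      proof cases
        case 2
        have "i \<in> F" using 2 J by blast
        from X[OF this this] show ?thesis unfolding 2 by simp
      next
        case 3
        have "((\<lambda>y. det_on J (X y)) has_field_derivative 0) (at z)"
          by (rule det_on_has_derivative_0[OF J(2) 3 X0 X]) (use J(1) in blast)+
        moreover have "card J \<noteq> 1" using 3 by linarith
        ultimately show ?thesis by simp
      qed simp
    qed
    then show "((\<lambda>y. (- 1) ^ card J * det_on J (X y)) has_field_derivative
      (- 1) ^ card J * (if card J = 1 then X' (the_elem J) (the_elem J) else 0)) (at z)"
      by (rule DERIV_cmult)
  qed
  also have "(\<Sum>J\<in>Pow F. (- 1) ^ card J * (if card J = 1 then X' (the_elem J) (the_elem J) else 0)) = - (\<Sum>i\<in>F. X' i i)"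
    by (subst sum_Pow_small[OF assms(1)]) (auto simp: sum_negf)
  finally have "((\<lambda>y. det_id_minus F (M z) * det_id_minus F (X y)) has_field_derivative det_id_minus F (M z) * - (\<Sum>i\<in>F. X' i i)) (at z)"
    by (rule DERIV_cmult)
  then show ?thesis unfolding eq[symmetric] by (simp add: X'_def)
qed

lemma det_id_minus_holomorphic:
  assumes "finite F" "\<And>i j. i \<in> F \<Longrightarrow> j \<in> F \<Longrightarrow> (\<lambda>z. M z i j) holomorphic_on S"
  shows "(\<lambda>z. det_id_minus F (M z)) holomorphic_on S"
  unfolding det_id_minus_def det_on_def
  by (intro holomorphic_intros assms) (auto simp: permutes_in_image)

text \<open>The \<open>m\<close>-th coefficient of Fredholm's series for the counting measure on \<open>A\<close>; the same sums arise from
  integrals of degenerate kernels, see \<open>tuple_integral\<close>.\<close>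
definition tuple_sum :: "'i set \<Rightarrow> nat \<Rightarrow> ('i \<Rightarrow> 'i \<Rightarrow> complex) \<Rightarrow> complex" where
  "tuple_sum A m M = (\<Sum>l\<in>{..<m} \<rightarrow>\<^sub>E A. det_on {..<m} (\<lambda>i j. M (l i) (l j)))"

lemma tuple_sum_sums:
  assumes "finite A"
  shows "(\<lambda>m. (- 1) ^ m / fact m * tuple_sum A m M) sums det_id_minus A M"
proof -
  have "(\<lambda>m. (- 1) ^ m / fact m * tuple_sum A m M) sums
     (\<Sum>m\<in>{..card A}. (- 1) ^ m / fact m * tuple_sum A m M)"
  proof (rule sums_finite)
    fix m assume "m \<notin> {..card A}"
    hence e: "{J. J \<subseteq> A \<and> card J = m} = {}" using assms by (auto dest: card_mono)
    show "(- 1) ^ m / fact m * tuple_sum A m M = 0"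
      unfolding tuple_sum_def sum_tuples_eq_minors[OF assms] e by simp
  qed simp
  also have "(\<Sum>m\<in>{..card A}. (- 1) ^ m / fact m * tuple_sum A m M) =
     (\<Sum>m\<in>{..card A}. \<Sum>J | J \<in> Pow A \<and> card J = m. (- 1) ^ card J * det_on J M)"
    unfolding tuple_sum_def sum_tuples_eq_minors[OF assms]
    by (intro sum.cong refl) (simp add: sum_distrib_left)
  also have "\<dots> = (\<Sum>J\<in>Pow A. (- 1) ^ card J * det_on J M)"
    by (rule sum.group) (use assms in \<open>auto intro: card_mono\<close>)
  finally show ?thesis by (simp add: det_id_minus_principal_minors[OF assms])
qed

text \<open>Summing \<open>\<Prod> r\<^sub>i\<close> over the sets of size \<open>m\<close> only costs \<open>2\<^sup>-\<^sup>m \<Prod> (1 + 2 r\<^sub>i)\<close>, because each such set carries a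
  factor \<open>2\<^sup>m\<close> in the expansion of the last product.\<close>
lemma tuple_sum_bound:
  assumes "finite A" "\<And>i. i \<in> A \<Longrightarrow> (\<Sum>j\<in>A. norm (M i j)) \<le> r i" "(\<Sum>i\<in>A. r i) \<le> B"
  shows "norm ((- 1) ^ m / fact m * tuple_sum A m M) \<le> exp (2 * B) / 2 ^ m"
proof -
  have r: "r i \<ge> 0" if "i \<in> A" for i
    using order.trans[OF sum_nonneg assms(2)[OF that]] by simp
  have "norm ((- 1) ^ m / fact m * tuple_sum A m M) = norm (\<Sum>J | J \<subseteq> A \<and> card J = m. det_on J M)"
    unfolding tuple_sum_def sum_tuples_eq_minors[OF assms(1)]
    by (simp add: norm_mult norm_divide norm_power)
  also have "\<dots> \<le> (\<Sum>J | J \<subseteq> A \<and> card J = m. (\<Prod>i\<in>J. 2 * r i) / 2 ^ m)"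
  proof (rule sum_norm_le)
    fix J assume "J \<in> {J. J \<subseteq> A \<and> card J = m}"
    hence J: "J \<subseteq> A" "card J = m" by auto
    have "norm (det_on J M) \<le> (\<Prod>i\<in>J. r i)"
    proof (rule det_on_bound)
      show "finite J" using J assms by (auto intro: finite_subset)
      fix i assume "i \<in> J"
      have "(\<Sum>j\<in>J. norm (M i j)) \<le> (\<Sum>j\<in>A. norm (M i j))"
        using J assms by (intro sum_mono2) auto
      also have "\<dots> \<le> r i" using \<open>i \<in> J\<close> J assms by auto
      finally show "(\<Sum>j\<in>J. norm (M i j)) \<le> r i" .
    qed
    also have "\<dots> = (\<Prod>i\<in>J. 2 * r i) / 2 ^ m" using J by (simp add: prod.distrib)
    finally show "norm (det_on J M) \<le> (\<Prod>i\<in>J. 2 * r i) / 2 ^ m" .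
  qed
  also have "\<dots> \<le> (\<Sum>J\<in>Pow A. (\<Prod>i\<in>J. 2 * r i) / 2 ^ m)"
    using assms(1) r by (intro sum_mono2) (auto intro!: divide_nonneg_nonneg prod_nonneg)
  also have "\<dots> = (\<Prod>i\<in>A. 1 + 2 * r i) / 2 ^ m"
    using prod_add[OF assms(1), of "\<lambda>i. 2 * r i" "\<lambda>_. 1"] by (simp add: add.commute sum_divide_distrib)
  also have "\<dots> \<le> exp (2 * B) / 2 ^ m"
    by (intro divide_right_mono prod_one_plus_le_exp) (use assms r in \<open>auto simp: sum_distrib_left[symmetric]\<close>)
  finally show ?thesis .
qed

section \<open>The Gelfand--Levitan system of a finite exponential sum\<close>

text \<open>The algebra behind the differential equation, at a fixed point \<open>x\<close>. Here \<open>p\<close> and \<open>p2\<close> are the solution of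
  the linear system and its second derivative, \<open>h\<close> is the potential matrix, \<open>h1\<close> its derivative, and \<open>e2\<close>
  is the system differentiated twice. Forming \<open>q + q (G \<circ> E)\<close> and inserting \<open>e0\<close> and \<open>e2\<close>, everything
  cancels because \<open>(\<lambda>\<^sub>\<mu>\<^sup>2 - \<lambda>\<^sub>\<nu>\<^sup>2) E\<^sub>\<nu>\<^sub>\<mu> = (\<lambda>\<^sub>\<mu> - \<lambda>\<^sub>\<nu>) e\<^sub>\<nu> e\<^sub>\<mu>\<close>.\<close>
lemma wave_residual_homogeneous:
  fixes l e :: "'n \<Rightarrow> complex" and A h h1 d0 d1 :: "'k::finite \<Rightarrow> _"
  assumes G: "\<And>\<nu> \<mu>. G \<nu> \<mu> = (\<Sum>k\<in>UNIV. B \<nu> k * A k \<mu>)"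
    and E: "\<And>\<nu> \<mu>. \<mu> \<in> F \<Longrightarrow> \<nu> \<in> F \<Longrightarrow> (l \<nu> + l \<mu>) * E \<nu> \<mu> = e \<nu> * e \<mu>"
    and e0: "\<And>i \<mu>. \<mu> \<in> F \<Longrightarrow> p i \<mu> + (\<Sum>\<nu>\<in>F. p i \<nu> * G \<nu> \<mu> * E \<nu> \<mu>) = - A i \<mu> * e \<mu>"
    and h: "\<And>i k. h i k = (\<Sum>\<nu>\<in>F. p i \<nu> * e \<nu> * B \<nu> k)"
    and d0: "\<And>i k. d0 i k = (\<Sum>\<nu>\<in>F. l \<nu> * p i \<nu> * e \<nu> * B \<nu> k)"
    and h1: "\<And>i k. h1 i k = d1 i k - d0 i k"
    and e2: "\<And>i \<mu>. \<mu> \<in> F \<Longrightarrow> p2 i \<mu> + (\<Sum>\<nu>\<in>F. p2 i \<nu> * G \<nu> \<mu> * E \<nu> \<mu>) =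
      (\<Sum>k\<in>UNIV. d1 i k * A k \<mu>) * e \<mu> + (\<Sum>k\<in>UNIV. h1 i k * A k \<mu>) * e \<mu>
      - l \<mu> * (\<Sum>k\<in>UNIV. h i k * A k \<mu>) * e \<mu> - (l \<mu>)\<^sup>2 * A i \<mu> * e \<mu>"
    and q: "\<And>i \<mu>. q i \<mu> = p2 i \<mu> - (l \<mu>)\<^sup>2 * p i \<mu> + 2 * (\<Sum>k\<in>UNIV. h1 i k * p k \<mu>)"
    and mu: "\<mu> \<in> F"
  shows "q i \<mu> + (\<Sum>\<nu>\<in>F. q i \<nu> * G \<nu> \<mu> * E \<nu> \<mu>) = 0"
proof -
  have hA: "(\<Sum>k\<in>UNIV. h i k * A k \<mu>) = (\<Sum>\<nu>\<in>F. p i \<nu> * G \<nu> \<mu> * e \<nu>)"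
    unfolding h G sum_distrib_left sum_distrib_right
    by (subst sum.swap) (simp add: mult_ac)
  have dA: "(\<Sum>k\<in>UNIV. d0 i k * A k \<mu>) = (\<Sum>\<nu>\<in>F. l \<nu> * p i \<nu> * G \<nu> \<mu> * e \<nu>)"
    unfolding d0 G sum_distrib_left sum_distrib_right
    by (subst sum.swap) (simp add: mult_ac)
  have t: "((l \<mu>)\<^sup>2 - (l \<nu>)\<^sup>2) * (p i \<nu> * G \<nu> \<mu> * E \<nu> \<mu>) =
      l \<mu> * (p i \<nu> * G \<nu> \<mu> * e \<nu>) * e \<mu> - (l \<nu> * p i \<nu> * G \<nu> \<mu> * e \<nu>) * e \<mu>" if "\<nu> \<in> F" for \<nu>
  proof -
    have "((l \<mu>)\<^sup>2 - (l \<nu>)\<^sup>2) * (p i \<nu> * G \<nu> \<mu> * E \<nu> \<mu>) =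
      (l \<mu> - l \<nu>) * p i \<nu> * G \<nu> \<mu> * ((l \<nu> + l \<mu>) * E \<nu> \<mu>)"
      by (simp add: power2_eq_square algebra_simps)
    then show ?thesis unfolding E[OF mu that] by (simp add: algebra_simps)
  qed
  have f1: "(l \<mu>)\<^sup>2 * (\<Sum>\<nu>\<in>F. p i \<nu> * G \<nu> \<mu> * E \<nu> \<mu>) - (\<Sum>\<nu>\<in>F. (l \<nu>)\<^sup>2 * (p i \<nu> * G \<nu> \<mu> * E \<nu> \<mu>)) =
      l \<mu> * (\<Sum>k\<in>UNIV. h i k * A k \<mu>) * e \<mu> - (\<Sum>k\<in>UNIV. d0 i k * A k \<mu>) * e \<mu>"
  proof -
    have "(l \<mu>)\<^sup>2 * (\<Sum>\<nu>\<in>F. p i \<nu> * G \<nu> \<mu> * E \<nu> \<mu>) - (\<Sum>\<nu>\<in>F. (l \<nu>)\<^sup>2 * (p i \<nu> * G \<nu> \<mu> * E \<nu> \<mu>)) =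
      (\<Sum>\<nu>\<in>F. ((l \<mu>)\<^sup>2 - (l \<nu>)\<^sup>2) * (p i \<nu> * G \<nu> \<mu> * E \<nu> \<mu>))"
      by (simp only: sum_distrib_left sum_subtractf left_diff_distrib)
    also have "\<dots> = (\<Sum>\<nu>\<in>F. l \<mu> * (p i \<nu> * G \<nu> \<mu> * e \<nu>) * e \<mu> - (l \<nu> * p i \<nu> * G \<nu> \<mu> * e \<nu>) * e \<mu>)"
      by (intro sum.cong refl t)
    finally show ?thesis unfolding hA dA
      by (simp only: sum_distrib_left sum_distrib_right sum_subtractf)
  qed
  have f2: "(\<Sum>\<nu>\<in>F. (\<Sum>k\<in>UNIV. h1 i k * p k \<nu>) * G \<nu> \<mu> * E \<nu> \<mu>) =
      (\<Sum>k\<in>UNIV. h1 i k * (\<Sum>\<nu>\<in>F. p k \<nu> * G \<nu> \<mu> * E \<nu> \<mu>))"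
    unfolding sum_distrib_left sum_distrib_right
    by (subst sum.swap) (simp add: mult_ac)
  have f3: "(\<Sum>k\<in>UNIV. h1 i k * p k \<mu>) + (\<Sum>k\<in>UNIV. h1 i k * (\<Sum>\<nu>\<in>F. p k \<nu> * G \<nu> \<mu> * E \<nu> \<mu>)) =
      - (\<Sum>k\<in>UNIV. h1 i k * A k \<mu>) * e \<mu>"
  proof -
    have "(\<Sum>k\<in>UNIV. h1 i k * p k \<mu>) + (\<Sum>k\<in>UNIV. h1 i k * (\<Sum>\<nu>\<in>F. p k \<nu> * G \<nu> \<mu> * E \<nu> \<mu>)) =
      (\<Sum>k\<in>UNIV. h1 i k * (p k \<mu> + (\<Sum>\<nu>\<in>F. p k \<nu> * G \<nu> \<mu> * E \<nu> \<mu>)))"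
      by (simp add: sum.distrib distrib_left)
    also have "\<dots> = - (\<Sum>k\<in>UNIV. h1 i k * A k \<mu>) * e \<mu>"
      unfolding e0[OF mu] by (simp add: sum_distrib_right sum_negf mult.assoc)
    finally show ?thesis .
  qed
  have f4: "(\<Sum>k\<in>UNIV. h1 i k * A k \<mu>) = (\<Sum>k\<in>UNIV. d1 i k * A k \<mu>) - (\<Sum>k\<in>UNIV. d0 i k * A k \<mu>)"
    unfolding h1 by (simp add: left_diff_distrib sum_subtractf)
  have S1: "(\<Sum>\<nu>\<in>F. q i \<nu> * G \<nu> \<mu> * E \<nu> \<mu>) = (\<Sum>\<nu>\<in>F. p2 i \<nu> * G \<nu> \<mu> * E \<nu> \<mu>)
     - (\<Sum>\<nu>\<in>F. (l \<nu>)\<^sup>2 * (p i \<nu> * G \<nu> \<mu> * E \<nu> \<mu>))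
     + 2 * (\<Sum>\<nu>\<in>F. (\<Sum>k\<in>UNIV. h1 i k * p k \<nu>) * G \<nu> \<mu> * E \<nu> \<mu>)"
  proof -
    have "(\<Sum>\<nu>\<in>F. q i \<nu> * G \<nu> \<mu> * E \<nu> \<mu>) = (\<Sum>\<nu>\<in>F. p2 i \<nu> * G \<nu> \<mu> * E \<nu> \<mu>
        - (l \<nu>)\<^sup>2 * (p i \<nu> * G \<nu> \<mu> * E \<nu> \<mu>)
        + 2 * ((\<Sum>k\<in>UNIV. h1 i k * p k \<nu>) * G \<nu> \<mu> * E \<nu> \<mu>))"
      unfolding q by (intro sum.cong refl) (simp add: ring_distribs mult.assoc)
    then show ?thesis by (simp only: sum.distrib sum_subtractf sum_distrib_left)
  qed
  have comb: "p2' - l2 * p' + 2 * s + (P2 - L + 2 * t) = (0::complex)"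
    if "l2 * P - L = rate * hA' * e' - dA' * e'" "s + t = - h1A * e'" "h1A = d1A - dA'"
      "p' + P = - a * e'" "p2' + P2 = d1A * e' + h1A * e' - rate * hA' * e' - l2 * a * e'"
    for p2' l2 p' s P2 L t P rate hA' e' dA' h1A d1A a
  proof -
    have "p2' - l2 * p' + 2 * s + (P2 - L + 2 * t) = (p2' + P2) - l2 * (p' + P) + (l2 * P - L) + 2 * (s + t)"
      by (simp add: algebra_simps)
    then show ?thesis unfolding that by (simp add: algebra_simps)
  qed
  show ?thesis unfolding S1 f2 unfolding q by (rule comb[OF f1 f3 f4 e0[OF mu] e2[OF mu]])
qed

text \<open>Data of the kernel \<open>\<Sum>\<^sub>\<nu> A\<^sub>k\<^sub>\<nu> C\<^sub>\<nu>\<^sub>j exp(-\<lambda>\<^sub>\<nu> t)\<close> and of the constant matrix \<open>S\<close>; the sets \<open>idx n\<close> define the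
  truncations. The coefficients are only bounded: convergence for \<open>t > 0\<close> comes from the exponentials.\<close>
locale exp_kernel =
  fixes idx :: "nat \<Rightarrow> 'n set" and lam :: "'n \<Rightarrow> real"
    and A :: "'k::finite \<Rightarrow> 'n \<Rightarrow> complex" and C :: "'n \<Rightarrow> 'k \<Rightarrow> complex"
    and S :: "'k \<Rightarrow> 'k \<Rightarrow> complex" and lam0 K :: real
  assumes fin: "finite (idx n)" and mono: "m \<le> n \<Longrightarrow> idx m \<subseteq> idx n"
    and lam0: "lam0 > 0" and lam: "lam0 \<le> lam \<nu>"
    and A_bound: "norm (A k \<nu>) \<le> K" and C_bound: "norm (C \<nu> k) \<le> K"
    and exp_summable: "0 < t \<Longrightarrow> \<exists>B. \<forall>n. (\<Sum>\<nu>\<in>idx n. exp (- (t * lam \<nu>))) \<le> B"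
begin

definition expo :: "'n \<Rightarrow> complex \<Rightarrow> complex" where "expo \<nu> z = exp (- (of_real (lam \<nu>) * z))"
definition CS :: "'n \<Rightarrow> 'k \<Rightarrow> complex" where "CS \<nu> k = (\<Sum>j\<in>UNIV. C \<nu> j * S j k)"
definition G :: "'n \<Rightarrow> 'n \<Rightarrow> complex" where "G \<nu> \<mu> = (\<Sum>k\<in>UNIV. CS \<nu> k * A k \<mu>)"
definition E :: "'n \<Rightarrow> 'n \<Rightarrow> complex \<Rightarrow> complex" where
  "E \<nu> \<mu> z = expo \<nu> z * expo \<mu> z / of_real (lam \<nu> + lam \<mu>)"
definition M :: "complex \<Rightarrow> 'n \<Rightarrow> 'n \<Rightarrow> complex" where "M z \<nu> \<mu> = - (G \<nu> \<mu> * E \<nu> \<mu> z)"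
definition D :: "nat \<Rightarrow> complex \<Rightarrow> complex" where "D n z = det_id_minus (idx n) (M z)"
text \<open>The rank one update of \<open>M x\<close> that yields the entry \<open>W\<^sub>i\<^sub>j(x,y)\<close> by the matrix determinant lemma; it is
  again entire in both variables.\<close>
definition N :: "nat \<Rightarrow> 'k \<Rightarrow> 'k \<Rightarrow> complex \<Rightarrow> complex \<Rightarrow> complex" where
  "N n i j x y = det_id_minus (idx n) (\<lambda>\<nu> \<mu>. M x \<nu> \<mu> + (C \<nu> j * expo \<nu> y) * (A i \<mu> * expo \<mu> x))"
definition W :: "nat \<Rightarrow> 'k \<Rightarrow> 'k \<Rightarrow> complex \<Rightarrow> complex \<Rightarrow> complex" where
  "W n i j x y = N n i j x y / D n x - 1"
text \<open>The inverse of \<open>I - M\<close>, see \<open>Q_inverse\<close>, written through determinants so that its holomorphy is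
  immediate.\<close>
definition Q :: "nat \<Rightarrow> complex \<Rightarrow> 'n \<Rightarrow> 'n \<Rightarrow> complex" where
  "Q n z \<nu> \<mu> = 1 - det_id_minus (idx n) (\<lambda>\<kappa> \<tau>. M z \<kappa> \<tau> + (if \<kappa> = \<mu> then 1 else 0) * (if \<tau> = \<nu> then 1 else 0)) / D n z"
text \<open>The coefficients \<open>\<omega>\<^sup>i\<^sub>\<mu>\<close> of the solution \<open>W\<close> in the exponentials \<open>exp(-\<lambda>\<^sub>\<mu> y)\<close>.\<close>
definition coef :: "nat \<Rightarrow> 'k \<Rightarrow> 'n \<Rightarrow> complex \<Rightarrow> complex" where
  "coef n i \<mu> z = - (\<Sum>\<nu>\<in>idx n. A i \<nu> * expo \<nu> z * Q n z \<nu> \<mu>)"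
text \<open>The potential \<open>W(x,x) S\<close>, see \<open>H_fin_eq\<close>.\<close>
definition H_fin :: "nat \<Rightarrow> 'k \<Rightarrow> 'k \<Rightarrow> complex \<Rightarrow> complex" where
  "H_fin n i k z = (\<Sum>\<nu>\<in>idx n. coef n i \<nu> z * expo \<nu> z * CS \<nu> k)"

lemma lam_pos: "lam \<nu> > 0" using lam0 lam[of \<nu>] by linarith

lemma lam_sum_nz [simp]: "complex_of_real (lam \<nu>) + complex_of_real (lam \<mu>) \<noteq> 0"
  using lam_pos[of \<nu>] lam_pos[of \<mu>] by (metis add_pos_pos less_irrefl of_real_add of_real_eq_0_iff)

lemma E_mult: "(of_real (lam \<nu>) + of_real (lam \<mu>)) * E \<nu> \<mu> z = expo \<nu> z * expo \<mu> z"
  by (simp add: E_def)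

lemma Q_inverse:
  assumes "D n z \<noteq> 0"
  shows "\<And>i k. i \<in> idx n \<Longrightarrow> k \<in> idx n \<Longrightarrow>
      (\<Sum>j\<in>idx n. ((if i = j then 1 else 0) - M z i j) * Q n z j k) = (if i = k then 1 else 0)"
    "\<And>i k. i \<in> idx n \<Longrightarrow> k \<in> idx n \<Longrightarrow>
      (\<Sum>j\<in>idx n. Q n z i j * ((if j = k then 1 else 0) - M z j k)) = (if i = k then 1 else 0)"
proof -
  obtain P where
   P: "\<And>i k. i \<in> idx n \<Longrightarrow> k \<in> idx n \<Longrightarrow>
      (\<Sum>j\<in>idx n. ((if i = j then 1 else 0) - M z i j) * P j k) = (if i = k then 1 else 0)"
    "\<And>i k. i \<in> idx n \<Longrightarrow> k \<in> idx n \<Longrightarrow>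
      (\<Sum>j\<in>idx n. P i j * ((if j = k then 1 else 0) - M z j k)) = (if i = k then 1 else 0)"
    by (rule det_on_inverse[OF fin assms[unfolded D_def det_id_minus_def]]) (rule that)
  have QP: "Q n z \<nu> \<mu> = P \<nu> \<mu>" if "\<nu> \<in> idx n" "\<mu> \<in> idx n" for \<nu> \<mu>
  proof -
    have "(\<Sum>i\<in>idx n. \<Sum>j\<in>idx n. (if i = \<nu> then 1 else 0) * P i j * (if j = \<mu> then 1 else 0)) = P \<nu> \<mu>"
      using that fin by (simp add: if_distrib[of "\<lambda>x. x * _"] if_distrib[of "\<lambda>x. _ * x"] sum.delta cong: if_cong)
    moreover have "det_id_minus (idx n) (\<lambda>\<kappa> \<tau>. M z \<kappa> \<tau> + (if \<kappa> = \<mu> then 1 else 0) * (if \<tau> = \<nu> then 1 else 0)) =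
      D n z * (1 - (\<Sum>i\<in>idx n. \<Sum>j\<in>idx n. (if i = \<nu> then 1 else 0) * P i j * (if j = \<mu> then 1 else 0)))"
      unfolding D_def by (rule det_id_minus_rank_one_update[OF fin P(1)])
    ultimately show ?thesis
      unfolding Q_def using assms by simp
  qed
  show "(\<Sum>j\<in>idx n. ((if i = j then 1 else 0) - M z i j) * Q n z j k) = (if i = k then 1 else 0)"
    if "i \<in> idx n" "k \<in> idx n" for i k
    using P(1)[OF that] that by (simp add: QP cong: sum.cong)
  show "(\<Sum>j\<in>idx n. Q n z i j * ((if j = k then 1 else 0) - M z j k)) = (if i = k then 1 else 0)"
    if "i \<in> idx n" "k \<in> idx n" for i k
    using P(2)[OF that] that by (simp add: QP cong: sum.cong)
qed

lemma coef_eq: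
  assumes "D n z \<noteq> 0" "\<mu> \<in> idx n"
  shows "coef n i \<mu> z + (\<Sum>\<nu>\<in>idx n. coef n i \<nu> z * G \<nu> \<mu> * E \<nu> \<mu> z) = - A i \<mu> * expo \<mu> z"
proof -
  have "coef n i \<mu> z + (\<Sum>\<nu>\<in>idx n. coef n i \<nu> z * G \<nu> \<mu> * E \<nu> \<mu> z) =
     (\<Sum>\<nu>\<in>idx n. coef n i \<nu> z * ((if \<nu> = \<mu> then 1 else 0) - M z \<nu> \<mu>))"
    using assms(2) fin
    by (simp add: M_def algebra_simps sum.distrib if_distrib[of "\<lambda>x. _ * x"] if_distrib[of "\<lambda>x. x * _"]
        sum.delta cong: if_cong)
  also have "\<dots> = - (\<Sum>\<kappa>\<in>idx n. A i \<kappa> * expo \<kappa> z * (\<Sum>\<nu>\<in>idx n. Q n z \<kappa> \<nu> * ((if \<nu> = \<mu> then 1 else 0) - M z \<nu> \<mu>)))"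
    unfolding coef_def sum_distrib_left sum_distrib_right sum_negf[symmetric] minus_mult_left
    by (subst sum.swap) (simp add: mult.assoc)
  also have "\<dots> = - (\<Sum>\<kappa>\<in>idx n. A i \<kappa> * expo \<kappa> z * (if \<kappa> = \<mu> then 1 else 0))"
    using Q_inverse(2)[OF assms(1) _ assms(2)] by (simp cong: sum.cong)
  also have "\<dots> = - A i \<mu> * expo \<mu> z"
    using assms(2) fin by (simp add: if_distrib[of "\<lambda>x. _ * x"] sum.delta cong: if_cong)
  finally show ?thesis .
qed

lemma W_eq:
  assumes "D n x \<noteq> 0"
  shows "W n i j x y = (\<Sum>\<mu>\<in>idx n. coef n i \<mu> x * C \<mu> j * expo \<mu> y)"
proof -
  have "W n i j x y = - (\<Sum>\<nu>\<in>idx n. \<Sum>\<mu>\<in>idx n. (A i \<nu> * expo \<nu> x) * Q n x \<nu> \<mu> * (C \<mu> j * expo \<mu> y))"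
  proof -
    have "N n i j x y = D n x * (1 - (\<Sum>\<nu>\<in>idx n. \<Sum>\<mu>\<in>idx n. (A i \<nu> * expo \<nu> x) * Q n x \<nu> \<mu> * (C \<mu> j * expo \<mu> y)))"
      unfolding N_def D_def by (rule det_id_minus_rank_one_update[OF fin Q_inverse(1)[OF assms]])
    then show ?thesis unfolding W_def using assms by simp
  qed
  also have "\<dots> = (\<Sum>\<mu>\<in>idx n. coef n i \<mu> x * C \<mu> j * expo \<mu> y)"
    unfolding coef_def by (subst sum.swap) (simp add: sum_distrib_right sum_negf mult.assoc)
  finally show ?thesis .
qed

lemma H_fin_eq:
  assumes "D n z \<noteq> 0"
  shows "H_fin n i k z = (\<Sum>j\<in>UNIV. W n i j z z * S j k)"
proof -
  have "(\<Sum>j\<in>UNIV. W n i j z z * S j k) = (\<Sum>j\<in>UNIV. \<Sum>\<mu>\<in>idx n. coef n i \<mu> z * expo \<mu> z * (C \<mu> j * S j k))"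
    unfolding W_eq[OF assms] sum_distrib_right by (simp add: mult_ac)
  also have "\<dots> = H_fin n i k z"
    unfolding H_fin_def CS_def sum_distrib_left by (rule sum.swap)
  finally show ?thesis ..
qed

lemma expo_deriv: "((\<lambda>z. expo \<nu> z) has_field_derivative - of_real (lam \<nu>) * expo \<nu> z) (at z)"
  unfolding expo_def by (auto intro!: derivative_eq_intros)

lemma E_deriv: "((\<lambda>z. E \<nu> \<mu> z) has_field_derivative - (expo \<nu> z * expo \<mu> z)) (at z)"
proof -
  have "((\<lambda>z. E \<nu> \<mu> z) has_field_derivative
    (- of_real (lam \<nu>) * expo \<nu> z * expo \<mu> z + expo \<nu> z * (- of_real (lam \<mu>) * expo \<mu> z)) / of_real (lam \<nu> + lam \<mu>)) (at z)"
    unfolding E_def by (auto intro!: derivative_eq_intros expo_deriv)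
  also have "(- of_real (lam \<nu>) * expo \<nu> z * expo \<mu> z + expo \<nu> z * (- of_real (lam \<mu>) * expo \<mu> z)) / of_real (lam \<nu> + lam \<mu>) =
     - (expo \<nu> z * expo \<mu> z)"
    by (simp add: field_simps)
  finally show ?thesis .
qed

lemma expo_holo [holomorphic_intros]: "f holomorphic_on X \<Longrightarrow> (\<lambda>z. expo \<nu> (f z)) holomorphic_on X"
  unfolding expo_def by (intro holomorphic_intros)

lemma E_holo [holomorphic_intros]: "(\<lambda>z. E \<nu> \<mu> z) holomorphic_on X"
  unfolding E_def by (intro holomorphic_intros) auto

lemma M_holo [holomorphic_intros]: "(\<lambda>z. M z \<nu> \<mu>) holomorphic_on X"
  unfolding M_def by (intro holomorphic_intros)

lemma D_holo [holomorphic_intros]: "(\<lambda>z. D n z) holomorphic_on X"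
  unfolding D_def by (intro det_id_minus_holomorphic fin holomorphic_intros)

lemma N_holo [holomorphic_intros]:
  "f holomorphic_on X \<Longrightarrow> g holomorphic_on X \<Longrightarrow> (\<lambda>z. N n i j (f z) (g z)) holomorphic_on X"
  unfolding N_def M_def E_def by (intro det_id_minus_holomorphic fin holomorphic_intros) auto

lemma Q_holo [holomorphic_intros]: "X \<subseteq> {z. D n z \<noteq> 0} \<Longrightarrow> (\<lambda>z. Q n z \<nu> \<mu>) holomorphic_on X"
  unfolding Q_def by (intro holomorphic_intros det_id_minus_holomorphic fin) auto

lemma coef_holo [holomorphic_intros]: "X \<subseteq> {z. D n z \<noteq> 0} \<Longrightarrow> (\<lambda>z. coef n i \<mu> z) holomorphic_on X"
  unfolding coef_def by (intro holomorphic_intros)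

lemma open_D: "open {z. D n z \<noteq> 0}"
proof -
  have "continuous_on UNIV (D n)" using D_holo[of n UNIV] by (intro holomorphic_on_imp_continuous_on) simp
  then show ?thesis by (intro open_Collect_neq) auto
qed

text \<open>As \<open>E' = - e e\<^sup>T\<close>, the derivative of \<open>M\<close> is a sum of \<open>CARD('k)\<close> matrices of rank one, and Jacobi's formula
  becomes a trace of size \<open>CARD('k)\<close>.\<close>
lemma log_deriv_finite:
  assumes "D n z \<noteq> 0"
  shows "((\<lambda>z. D n z) has_field_derivative D n z * (\<Sum>i\<in>UNIV. H_fin n i i z)) (at z)"
proof -
  have "((\<lambda>z. D n z) has_field_derivative
     - det_id_minus (idx n) (M z) * (\<Sum>i\<in>idx n. \<Sum>j\<in>idx n. Q n z i j * (G j i * (expo j z * expo i z)))) (at z)"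
    unfolding D_def
  proof (rule det_id_minus_has_derivative[where M=M and z=z, OF fin Q_inverse(1)[OF assms]])
    show "((\<lambda>z. M z i j) has_field_derivative G i j * (expo i z * expo j z)) (at z)" for i j
      unfolding M_def using DERIV_minus[OF DERIV_cmult[OF E_deriv, of "G i j"]] by simp
  qed auto
  also have "(\<Sum>i\<in>idx n. \<Sum>j\<in>idx n. Q n z i j * (G j i * (expo j z * expo i z))) =
     (\<Sum>i\<in>idx n. \<Sum>j\<in>idx n. \<Sum>k\<in>UNIV. A k i * expo i z * Q n z i j * (expo j z * CS j k))"
    unfolding G_def sum_distrib_left sum_distrib_right by (simp add: mult_ac)
  also have "\<dots> = (\<Sum>k\<in>UNIV. \<Sum>j\<in>idx n. \<Sum>i\<in>idx n. A k i * expo i z * Q n z i j * (expo j z * CS j k))"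
    by (subst (2) sum.swap) (subst sum.swap, intro sum.cong refl, rule sum.swap)
  also have "\<dots> = - (\<Sum>k\<in>UNIV. H_fin n k k z)"
    unfolding H_fin_def coef_def sum_distrib_right sum_negf[symmetric] minus_mult_left
    by (simp add: mult_ac)
  finally show ?thesis by (simp add: D_def)
qed

lemma deriv_eq_on_open:
  assumes "open U" "z \<in> U" "\<And>w. w \<in> U \<Longrightarrow> f w = g w" "(g has_field_derivative d) (at z)"
  shows "(f has_field_derivative d) (at z)"
  using assms by (metis has_field_derivative_transform_within_open)

lemma deriv_coef:
  assumes "D n z \<noteq> 0"
  shows "((\<lambda>z. coef n i \<mu> z) has_field_derivative deriv (coef n i \<mu>) z) (at z)"
    "((\<lambda>z. deriv (coef n i \<mu>) z) has_field_derivative deriv (deriv (coef n i \<mu>)) z) (at z)"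
proof -
  have h: "coef n i \<mu> holomorphic_on {z. D n z \<noteq> 0}" using coef_holo[of _ n i \<mu>] by simp
  show "((\<lambda>z. coef n i \<mu> z) has_field_derivative deriv (coef n i \<mu>) z) (at z)"
    by (rule holomorphic_derivI[OF h open_D]) (use assms in auto)
  show "((\<lambda>z. deriv (coef n i \<mu>) z) has_field_derivative deriv (deriv (coef n i \<mu>)) z) (at z)"
    by (rule holomorphic_derivI[OF holomorphic_deriv[OF h open_D] open_D]) (use assms in auto)
qed

text \<open>\<open>coef_eq\<close> holds on the open set where \<open>D n\<close> does not vanish, so it may be differentiated there.\<close>
lemma coef_eq_deriv:
  assumes "D n z \<noteq> 0" "\<mu> \<in> idx n"
  shows "deriv (coef n i \<mu>) z + (\<Sum>\<nu>\<in>idx n. deriv (coef n i \<nu>) z * G \<nu> \<mu> * E \<nu> \<mu> z)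
      - (\<Sum>\<nu>\<in>idx n. coef n i \<nu> z * G \<nu> \<mu> * expo \<nu> z) * expo \<mu> z - of_real (lam \<mu>) * A i \<mu> * expo \<mu> z = 0"
proof -
  let ?F = "\<lambda>z. coef n i \<mu> z + (\<Sum>\<nu>\<in>idx n. coef n i \<nu> z * G \<nu> \<mu> * E \<nu> \<mu> z) + A i \<mu> * expo \<mu> z"
  have 1: "(?F has_field_derivative deriv (coef n i \<mu>) z + (\<Sum>\<nu>\<in>idx n. deriv (coef n i \<nu>) z * G \<nu> \<mu> * E \<nu> \<mu> z
      + coef n i \<nu> z * G \<nu> \<mu> * (- (expo \<nu> z * expo \<mu> z))) + A i \<mu> * (- of_real (lam \<mu>) * expo \<mu> z)) (at z)"
    by (intro DERIV_add DERIV_sum DERIV_cmult deriv_coef[OF assms(1)] expo_deriv)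
      (auto intro!: derivative_eq_intros deriv_coef[OF assms(1)] E_deriv simp: algebra_simps)
  have 2: "(?F has_field_derivative 0) (at z)"
    by (rule deriv_eq_on_open[OF open_D, where g="\<lambda>_. 0"]) (use assms in \<open>auto simp: coef_eq\<close>)
  have "deriv (coef n i \<mu>) z + (\<Sum>\<nu>\<in>idx n. deriv (coef n i \<nu>) z * G \<nu> \<mu> * E \<nu> \<mu> z
      + coef n i \<nu> z * G \<nu> \<mu> * (- (expo \<nu> z * expo \<mu> z))) + A i \<mu> * (- of_real (lam \<mu>) * expo \<mu> z) = 0"
    using DERIV_unique[OF 1 2] .
  note 3 = this
  have 4: "(\<Sum>\<nu>\<in>idx n. deriv (coef n i \<nu>) z * G \<nu> \<mu> * E \<nu> \<mu> z
      + coef n i \<nu> z * G \<nu> \<mu> * (- (expo \<nu> z * expo \<mu> z))) = (\<Sum>\<nu>\<in>idx n. deriv (coef n i \<nu>) z * G \<nu> \<mu> * E \<nu> \<mu> z)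
      - (\<Sum>\<nu>\<in>idx n. coef n i \<nu> z * G \<nu> \<mu> * expo \<nu> z) * expo \<mu> z"
    by (simp add: sum.distrib sum_negf sum_subtractf sum_distrib_right mult.assoc)
  show ?thesis using 3 unfolding 4 by (simp add: algebra_simps)
qed

lemma coef_eq_deriv2:
  assumes "D n z \<noteq> 0" "\<mu> \<in> idx n"
  shows "deriv (deriv (coef n i \<mu>)) z + (\<Sum>\<nu>\<in>idx n. deriv (deriv (coef n i \<nu>)) z * G \<nu> \<mu> * E \<nu> \<mu> z)
      - (\<Sum>\<nu>\<in>idx n. deriv (coef n i \<nu>) z * G \<nu> \<mu> * expo \<nu> z) * expo \<mu> z
      - ((\<Sum>\<nu>\<in>idx n. deriv (coef n i \<nu>) z * G \<nu> \<mu> * expo \<nu> z)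
          - (\<Sum>\<nu>\<in>idx n. of_real (lam \<nu>) * coef n i \<nu> z * G \<nu> \<mu> * expo \<nu> z)) * expo \<mu> z
      + of_real (lam \<mu>) * (\<Sum>\<nu>\<in>idx n. coef n i \<nu> z * G \<nu> \<mu> * expo \<nu> z) * expo \<mu> z
      + (of_real (lam \<mu>))\<^sup>2 * A i \<mu> * expo \<mu> z = 0"
proof -
  let ?F = "\<lambda>z. deriv (coef n i \<mu>) z + (\<Sum>\<nu>\<in>idx n. deriv (coef n i \<nu>) z * G \<nu> \<mu> * E \<nu> \<mu> z)
      - (\<Sum>\<nu>\<in>idx n. coef n i \<nu> z * G \<nu> \<mu> * expo \<nu> z) * expo \<mu> z - of_real (lam \<mu>) * A i \<mu> * expo \<mu> z"
  let ?a = "\<Sum>\<nu>\<in>idx n. deriv (deriv (coef n i \<nu>)) z * G \<nu> \<mu> * E \<nu> \<mu> z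
      + deriv (coef n i \<nu>) z * G \<nu> \<mu> * (- (expo \<nu> z * expo \<mu> z))"
  let ?b = "\<Sum>\<nu>\<in>idx n. deriv (coef n i \<nu>) z * G \<nu> \<mu> * expo \<nu> z
      + coef n i \<nu> z * G \<nu> \<mu> * (- of_real (lam \<nu>) * expo \<nu> z)"
  let ?g = "\<Sum>\<nu>\<in>idx n. coef n i \<nu> z * G \<nu> \<mu> * expo \<nu> z"
  have a: "((\<lambda>z. \<Sum>\<nu>\<in>idx n. deriv (coef n i \<nu>) z * G \<nu> \<mu> * E \<nu> \<mu> z) has_field_derivative ?a) (at z)"
    by (intro DERIV_sum) (auto intro!: derivative_eq_intros deriv_coef[OF assms(1)] E_deriv simp: algebra_simps)
  have b: "((\<lambda>z. \<Sum>\<nu>\<in>idx n. coef n i \<nu> z * G \<nu> \<mu> * expo \<nu> z) has_field_derivative ?b) (at z)"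
    by (intro DERIV_sum) (auto intro!: derivative_eq_intros deriv_coef[OF assms(1)] expo_deriv simp: algebra_simps)
  have 1: "(?F has_field_derivative deriv (deriv (coef n i \<mu>)) z + ?a
      - (?b * expo \<mu> z + (- of_real (lam \<mu>) * expo \<mu> z) * ?g)
      - of_real (lam \<mu>) * A i \<mu> * (- of_real (lam \<mu>) * expo \<mu> z)) (at z)"
    by (intro DERIV_add DERIV_diff DERIV_mult DERIV_cmult deriv_coef[OF assms(1)] expo_deriv a b)
  have 2: "(?F has_field_derivative 0) (at z)"
    by (rule deriv_eq_on_open[OF open_D, where g="\<lambda>_. 0"])
      (use assms in \<open>auto simp del: diff_eq_eq right_minus_eq eq_iff_diff_eq_0 intro: coef_eq_deriv\<close>)
  have 3: "deriv (deriv (coef n i \<mu>)) z + ?a - (?b * expo \<mu> z + (- of_real (lam \<mu>) * expo \<mu> z) * ?g)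
      - of_real (lam \<mu>) * A i \<mu> * (- of_real (lam \<mu>) * expo \<mu> z) = 0"
    using DERIV_unique[OF 1 2] .
  have a': "?a = (\<Sum>\<nu>\<in>idx n. deriv (deriv (coef n i \<nu>)) z * G \<nu> \<mu> * E \<nu> \<mu> z)
      - (\<Sum>\<nu>\<in>idx n. deriv (coef n i \<nu>) z * G \<nu> \<mu> * expo \<nu> z) * expo \<mu> z"
    by (simp add: sum.distrib sum_negf sum_subtractf sum_distrib_right mult.assoc)
  have b': "?b = (\<Sum>\<nu>\<in>idx n. deriv (coef n i \<nu>) z * G \<nu> \<mu> * expo \<nu> z)
          - (\<Sum>\<nu>\<in>idx n. of_real (lam \<nu>) * coef n i \<nu> z * G \<nu> \<mu> * expo \<nu> z)"
    by (simp add: sum.distrib sum_negf sum_subtractf mult_ac)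
  show ?thesis using 3 unfolding a' b' by (simp add: algebra_simps power2_eq_square)
qed

text \<open>Multiply by the right inverse \<open>Q\<close> of \<open>I - M\<close>.\<close>
lemma homogeneous_zero:
  assumes "D n z \<noteq> 0" "\<And>\<mu>. \<mu> \<in> idx n \<Longrightarrow> q \<mu> + (\<Sum>\<nu>\<in>idx n. q \<nu> * G \<nu> \<mu> * E \<nu> \<mu> z) = 0" "\<mu> \<in> idx n"
  shows "q \<mu> = 0"
proof -
  have q: "(\<Sum>\<nu>\<in>idx n. q \<nu> * ((if \<nu> = \<kappa> then 1 else 0) - M z \<nu> \<kappa>)) = 0" if "\<kappa> \<in> idx n" for \<kappa>
    using assms(2)[OF that] that fin
    by (simp add: M_def algebra_simps sum.distrib if_distrib[of "\<lambda>x. _ * x"] if_distrib[of "\<lambda>x. x * _"]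
        sum.delta cong: if_cong)
  have "q \<mu> = (\<Sum>\<nu>\<in>idx n. q \<nu> * (if \<nu> = \<mu> then 1 else 0))"
    using assms(3) fin by (simp add: if_distrib[of "\<lambda>x. _ * x"] sum.delta cong: if_cong)
  also have "\<dots> = (\<Sum>\<nu>\<in>idx n. q \<nu> * (\<Sum>\<kappa>\<in>idx n. ((if \<nu> = \<kappa> then 1 else 0) - M z \<nu> \<kappa>) * Q n z \<kappa> \<mu>))"
    using Q_inverse(1)[OF assms(1) _ assms(3)] by (intro sum.cong refl) simp
  also have "\<dots> = (\<Sum>\<kappa>\<in>idx n. (\<Sum>\<nu>\<in>idx n. q \<nu> * ((if \<nu> = \<kappa> then 1 else 0) - M z \<nu> \<kappa>)) * Q n z \<kappa> \<mu>)"
    unfolding sum_distrib_left sum_distrib_right by (subst sum.swap) (simp only: mult.assoc)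
  also have "\<dots> = 0" by (intro sum.neutral ballI) (simp only: q mult_zero_left)
  finally show ?thesis .
qed

text \<open>The \<open>y\<close>-derivatives multiply the coefficients by \<open>\<lambda>\<^sub>\<mu>\<^sup>2\<close>, so the claim is the vanishing of the residual of
  \<open>wave_residual_homogeneous\<close>, coefficient by coefficient.\<close>
lemma PDE_finite:
  assumes D: "D n x \<noteq> 0"
  shows "(deriv ^^ 2) (\<lambda>x. W n i j x y) x - (deriv ^^ 2) (\<lambda>y. W n i j x y) y =
     - 2 * (\<Sum>k\<in>UNIV. deriv (H_fin n i k) x * W n k j x y)"
proof -
  let ?U = "{z. D n z \<noteq> 0}"
  define p2 where "p2 i \<mu> = deriv (deriv (coef n i \<mu>)) x" for i \<mu>
  define d1 where "d1 i k = (\<Sum>\<nu>\<in>idx n. deriv (coef n i \<nu>) x * expo \<nu> x * CS \<nu> k)" for i k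
  define d0 where "d0 i k = (\<Sum>\<nu>\<in>idx n. of_real (lam \<nu>) * coef n i \<nu> x * expo \<nu> x * CS \<nu> k)" for i k
  define h1 where "h1 i k = d1 i k - d0 i k" for i k
  define q where "q i \<mu> = p2 i \<mu> - (of_real (lam \<mu>))\<^sup>2 * coef n i \<mu> x + 2 * (\<Sum>k\<in>UNIV. h1 i k * coef n k \<mu> x)" for i \<mu>
  have sw: "(\<Sum>k\<in>UNIV. (\<Sum>\<nu>\<in>idx n. f \<nu> * expo \<nu> x * CS \<nu> k) * A k \<mu>) =
      (\<Sum>\<nu>\<in>idx n. f \<nu> * G \<nu> \<mu> * expo \<nu> x)" for f :: "'n \<Rightarrow> complex" and \<mu>
    unfolding G_def sum_distrib_left sum_distrib_right
    by (subst sum.swap) (simp add: mult_ac)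
  have "q i \<mu> + (\<Sum>\<nu>\<in>idx n. q i \<nu> * G \<nu> \<mu> * E \<nu> \<mu> x) = 0" if "\<mu> \<in> idx n" for i \<mu>
  proof (rule wave_residual_homogeneous[where F="idx n" and l="\<lambda>\<mu>. of_real (lam \<mu>)" and e="\<lambda>\<mu>. expo \<mu> x"
     and A=A and B=CS and G=G and E="\<lambda>\<nu> \<mu>. E \<nu> \<mu> x" and p="\<lambda>i \<mu>. coef n i \<mu> x" and h="\<lambda>i k. H_fin n i k x"
     and ?h1.0=h1 and ?d0.0=d0 and ?d1.0=d1 and ?p2.0=p2 and q=q])
    show "p2 i \<mu> + (\<Sum>\<nu>\<in>idx n. p2 i \<nu> * G \<nu> \<mu> * E \<nu> \<mu> x) =
      (\<Sum>k\<in>UNIV. d1 i k * A k \<mu>) * expo \<mu> x + (\<Sum>k\<in>UNIV. h1 i k * A k \<mu>) * expo \<mu> x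
      - of_real (lam \<mu>) * (\<Sum>k\<in>UNIV. H_fin n i k x * A k \<mu>) * expo \<mu> x - (of_real (lam \<mu>))\<^sup>2 * A i \<mu> * expo \<mu> x"
      if "\<mu> \<in> idx n" for i \<mu>
    proof -
      have h1A: "(\<Sum>k\<in>UNIV. h1 i k * A k \<mu>) = (\<Sum>k\<in>UNIV. d1 i k * A k \<mu>) - (\<Sum>k\<in>UNIV. d0 i k * A k \<mu>)"
        unfolding h1_def by (simp add: left_diff_distrib sum_subtractf)
      show ?thesis
        unfolding h1A unfolding d1_def d0_def H_fin_def sw
        using coef_eq_deriv2[OF D that, of i] unfolding p2_def by (simp add: algebra_simps)
    qed
  qed (use fin coef_eq[OF D] that in \<open>auto simp: G_def E_mult H_fin_def d0_def h1_def q_def\<close>)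
  then have q0: "q i \<mu> = 0" if "\<mu> \<in> idx n" for i \<mu>
    using homogeneous_zero[OF D, of "q i"] that by blast
  have Hd: "deriv (H_fin n i k) x = h1 i k" for i k
  proof (rule DERIV_imp_deriv)
    have "((\<lambda>z. H_fin n i k z) has_field_derivative (\<Sum>\<nu>\<in>idx n. deriv (coef n i \<nu>) x * expo \<nu> x * CS \<nu> k
      - of_real (lam \<nu>) * coef n i \<nu> x * expo \<nu> x * CS \<nu> k)) (at x)"
      unfolding H_fin_def
      by (intro DERIV_sum) (auto intro!: derivative_eq_intros deriv_coef[OF D] expo_deriv simp: algebra_simps)
    then show "(H_fin n i k has_field_derivative h1 i k) (at x)"
      by (simp add: h1_def d1_def d0_def sum_subtractf)
  qed
  have x1: "((\<lambda>x. W n i j x y) has_field_derivative (\<Sum>\<mu>\<in>idx n. deriv (coef n i \<mu>) z * C \<mu> j * expo \<mu> y)) (at z)"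
    if "D n z \<noteq> 0" for z
  proof (rule deriv_eq_on_open[OF open_D])
    show "((\<lambda>x. \<Sum>\<mu>\<in>idx n. coef n i \<mu> x * C \<mu> j * expo \<mu> y) has_field_derivative
       (\<Sum>\<mu>\<in>idx n. deriv (coef n i \<mu>) z * C \<mu> j * expo \<mu> y)) (at z)"
      by (intro DERIV_sum DERIV_cmult_right deriv_coef that)
  qed (use that W_eq in auto)
  have x2: "(deriv ^^ 2) (\<lambda>x. W n i j x y) x = (\<Sum>\<mu>\<in>idx n. p2 i \<mu> * C \<mu> j * expo \<mu> y)"
  proof -
    have "(deriv (\<lambda>x. W n i j x y) has_field_derivative (\<Sum>\<mu>\<in>idx n. p2 i \<mu> * C \<mu> j * expo \<mu> y)) (at x)"
    proof (rule deriv_eq_on_open[OF open_D])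
      show "((\<lambda>x. \<Sum>\<mu>\<in>idx n. deriv (coef n i \<mu>) x * C \<mu> j * expo \<mu> y) has_field_derivative
         (\<Sum>\<mu>\<in>idx n. p2 i \<mu> * C \<mu> j * expo \<mu> y)) (at x)"
        unfolding p2_def by (intro DERIV_sum DERIV_cmult_right deriv_coef D)
      show "x \<in> ?U" using D by simp
      show "deriv (\<lambda>x. W n i j x y) w = (\<Sum>\<mu>\<in>idx n. deriv (coef n i \<mu>) w * C \<mu> j * expo \<mu> y)" if "w \<in> ?U" for w
        using that by (intro DERIV_imp_deriv x1) auto
    qed
    then show ?thesis by (simp add: numeral_2_eq_2 DERIV_imp_deriv)
  qed
  have y1: "((\<lambda>y. W n i j x y) has_field_derivative (\<Sum>\<mu>\<in>idx n. coef n i \<mu> x * C \<mu> j * (- of_real (lam \<mu>) * expo \<mu> y))) (at y)" for y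
    unfolding W_eq[OF D] by (intro DERIV_sum DERIV_cmult expo_deriv)
  have y2: "(deriv ^^ 2) (\<lambda>y. W n i j x y) y = (\<Sum>\<mu>\<in>idx n. (of_real (lam \<mu>))\<^sup>2 * coef n i \<mu> x * C \<mu> j * expo \<mu> y)"
  proof -
    have "((\<lambda>y. \<Sum>\<mu>\<in>idx n. coef n i \<mu> x * C \<mu> j * (- of_real (lam \<mu>) * expo \<mu> y)) has_field_derivative
      (\<Sum>\<mu>\<in>idx n. coef n i \<mu> x * C \<mu> j * (- of_real (lam \<mu>) * (- of_real (lam \<mu>) * expo \<mu> y)))) (at y)"
      by (intro DERIV_sum DERIV_cmult expo_deriv)
    moreover have "deriv (\<lambda>y. W n i j x y) = (\<lambda>y. \<Sum>\<mu>\<in>idx n. coef n i \<mu> x * C \<mu> j * (- of_real (lam \<mu>) * expo \<mu> y))"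
      using y1 by (intro ext DERIV_imp_deriv)
    ultimately show ?thesis by (simp add: numeral_2_eq_2 DERIV_imp_deriv power2_eq_square mult_ac)
  qed
  have "0 = (\<Sum>\<mu>\<in>idx n. q i \<mu> * C \<mu> j * expo \<mu> y)" using q0 by simp
  also have "\<dots> = (\<Sum>\<mu>\<in>idx n. p2 i \<mu> * C \<mu> j * expo \<mu> y)
     - (\<Sum>\<mu>\<in>idx n. (of_real (lam \<mu>))\<^sup>2 * coef n i \<mu> x * C \<mu> j * expo \<mu> y)
     + 2 * (\<Sum>\<mu>\<in>idx n. (\<Sum>k\<in>UNIV. h1 i k * coef n k \<mu> x) * C \<mu> j * expo \<mu> y)"
    
  proof -
    have "(\<Sum>\<mu>\<in>idx n. q i \<mu> * C \<mu> j * expo \<mu> y) = (\<Sum>\<mu>\<in>idx n. p2 i \<mu> * C \<mu> j * expo \<mu> y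
       - (of_real (lam \<mu>))\<^sup>2 * coef n i \<mu> x * C \<mu> j * expo \<mu> y
       + 2 * ((\<Sum>k\<in>UNIV. h1 i k * coef n k \<mu> x) * C \<mu> j * expo \<mu> y))"
      unfolding q_def by (intro sum.cong refl) (simp add: ring_distribs mult.assoc)
    then show ?thesis by (simp only: sum.distrib sum_subtractf sum_distrib_left)
  qed
  also have "(\<Sum>\<mu>\<in>idx n. (\<Sum>k\<in>UNIV. h1 i k * coef n k \<mu> x) * C \<mu> j * expo \<mu> y) = (\<Sum>k\<in>UNIV. h1 i k * W n k j x y)"
    unfolding W_eq[OF D] sum_distrib_left sum_distrib_right
    by (subst sum.swap) (simp only: mult.assoc)
  finally show ?thesis unfolding x2 y2 Hd by (simp add: algebra_simps)
qed

end

section \<open>Passage to infinite exponential sums\<close>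

context exp_kernel begin

definition Dinf :: "complex \<Rightarrow> complex" where "Dinf z = lim (\<lambda>n. D n z)"
definition Ninf :: "'k \<Rightarrow> 'k \<Rightarrow> complex \<Rightarrow> complex \<Rightarrow> complex" where "Ninf i j x y = lim (\<lambda>n. N n i j x y)"
definition Winf :: "'k \<Rightarrow> 'k \<Rightarrow> complex \<Rightarrow> complex \<Rightarrow> complex" where
  "Winf i j x y = Ninf i j x y / Dinf x - 1"
definition Hinf :: "'k \<Rightarrow> 'k \<Rightarrow> complex \<Rightarrow> complex" where
  "Hinf i k z = (\<Sum>j\<in>UNIV. Winf i j z z * S j k)"

lemma K_nonneg: "K \<ge> 0" using A_bound[of undefined undefined] norm_ge_zero order.trans by blast

lemma norm_expo: "norm (expo \<nu> z) = exp (- (lam \<nu> * Re z))"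
  by (simp add: expo_def)

lemma norm_expo_le: "\<epsilon> \<le> Re z \<Longrightarrow> norm (expo \<nu> z) \<le> exp (- (\<epsilon> * lam \<nu>))"
  using lam_pos[of \<nu>] by (simp add: norm_expo mult.commute)

lemma G_bounded: "\<exists>KG\<ge>0. \<forall>\<nu> \<mu>. norm (G \<nu> \<mu>) \<le> KG"
proof (intro exI conjI allI)
  show "norm (G \<nu> \<mu>) \<le> (\<Sum>k\<in>UNIV. (\<Sum>j\<in>UNIV. K * norm (S j k)) * K)" for \<nu> \<mu>
    unfolding G_def CS_def
    by (intro sum_norm_le order.trans[OF norm_mult_ineq] mult_mono)
      (auto intro!: mult_right_mono C_bound A_bound sum_nonneg mult_nonneg_nonneg K_nonneg simp: norm_mult)
  show "0 \<le> (\<Sum>k\<in>UNIV. (\<Sum>j\<in>UNIV. K * norm (S j k)) * K)"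
    by (intro sum_nonneg mult_nonneg_nonneg K_nonneg norm_ge_zero)
qed

lemma norm_E_le: "norm (E \<nu> \<mu> x) \<le> norm (expo \<nu> x) * norm (expo \<mu> x) / (2 * lam0)"
proof -
  have "norm (E \<nu> \<mu> x) = norm (expo \<nu> x) * norm (expo \<mu> x) / (lam \<nu> + lam \<mu>)"
    using lam_pos[of \<nu>] lam_pos[of \<mu>] by (simp add: E_def norm_divide norm_mult of_real_add[symmetric] del: of_real_add)
  also have "\<dots> \<le> norm (expo \<nu> x) * norm (expo \<mu> x) / (2 * lam0)"
    using lam[of \<nu>] lam[of \<mu>] lam0 by (intro divide_left_mono) auto
  finally show ?thesis .
qed

text \<open>The constant is independent of \<open>\<epsilon>\<close>; the decay as \<open>\<epsilon> \<rightarrow> \<infinity>\<close> is what makes the determinant tend to 1.\<close>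
lemma entry_bounds:
  obtains c where "c \<ge> 0"
    "\<And>\<epsilon> x \<nu> \<mu>. \<epsilon> \<le> Re x \<Longrightarrow> norm (M x \<nu> \<mu>) \<le> c * exp (- (\<epsilon> * lam \<nu>)) * exp (- (\<epsilon> * lam \<mu>))"
    "\<And>\<epsilon> x y \<nu> \<mu> i j. \<epsilon> \<le> Re x \<Longrightarrow> \<epsilon> \<le> Re y \<Longrightarrow>
      norm (M x \<nu> \<mu> + (C \<nu> j * expo \<nu> y) * (A i \<mu> * expo \<mu> x)) \<le> c * exp (- (\<epsilon> * lam \<nu>)) * exp (- (\<epsilon> * lam \<mu>))"
proof -
  obtain KG where KG: "KG \<ge> 0" "\<And>\<nu> \<mu>. norm (G \<nu> \<mu>) \<le> KG" using G_bounded by auto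
  define c where "c = KG / (2 * lam0) + K * K"
  have M: "norm (M x \<nu> \<mu>) \<le> KG / (2 * lam0) * exp (- (\<epsilon> * lam \<nu>)) * exp (- (\<epsilon> * lam \<mu>))" if "\<epsilon> \<le> Re x" for \<epsilon> x \<nu> \<mu>
  proof -
    have "norm (M x \<nu> \<mu>) \<le> KG * (norm (expo \<nu> x) * norm (expo \<mu> x) / (2 * lam0))"
      unfolding M_def norm_minus_cancel norm_mult
      by (intro mult_mono KG norm_E_le) auto
    also have "\<dots> \<le> KG * (exp (- (\<epsilon> * lam \<nu>)) * exp (- (\<epsilon> * lam \<mu>)) / (2 * lam0))"
      by (intro mult_left_mono divide_right_mono mult_mono norm_expo_le that KG) (use lam0 in auto)
    finally show ?thesis by (simp add: mult_ac)
  qed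
  have k: "0 \<le> K * K" using K_nonneg by simp
  show ?thesis
  proof (rule that[of c])
    show "c \<ge> 0" using KG lam0 k by (auto simp: c_def)
    show "norm (M x \<nu> \<mu>) \<le> c * exp (- (\<epsilon> * lam \<nu>)) * exp (- (\<epsilon> * lam \<mu>))" if "\<epsilon> \<le> Re x" for \<epsilon> x \<nu> \<mu>
      unfolding c_def distrib_right using M[OF that, of \<nu> \<mu>] k by (intro add_increasing2) auto
    fix \<epsilon> x y \<nu> \<mu> i j assume xy: "\<epsilon> \<le> Re x" "\<epsilon> \<le> Re y"
    have "norm ((C \<nu> j * expo \<nu> y) * (A i \<mu> * expo \<mu> x)) \<le> (K * exp (- (\<epsilon> * lam \<nu>))) * (K * exp (- (\<epsilon> * lam \<mu>)))"
      unfolding norm_mult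
      by (intro mult_mono norm_expo_le A_bound C_bound xy) (use K_nonneg in auto)
    also have "\<dots> = K * K * exp (- (\<epsilon> * lam \<nu>)) * exp (- (\<epsilon> * lam \<mu>))" by (simp add: mult_ac)
    finally show "norm (M x \<nu> \<mu> + (C \<nu> j * expo \<nu> y) * (A i \<mu> * expo \<mu> x)) \<le> c * exp (- (\<epsilon> * lam \<nu>)) * exp (- (\<epsilon> * lam \<mu>))"
      unfolding c_def distrib_right by (intro norm_triangle_mono M[OF xy(1)])
  qed
qed

lemma row_bounds:
  assumes "0 < \<epsilon>"
  obtains r B where "\<And>\<nu>. r \<nu> \<ge> 0" "\<And>n. (\<Sum>\<nu>\<in>idx n. r \<nu>) \<le> B"
    "\<And>x \<nu> n. \<epsilon> \<le> Re x \<Longrightarrow> (\<Sum>\<mu>\<in>idx n. norm (M x \<nu> \<mu>)) \<le> r \<nu>"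
    "\<And>x y \<nu> n i j. \<epsilon> \<le> Re x \<Longrightarrow> \<epsilon> \<le> Re y \<Longrightarrow>
      (\<Sum>\<mu>\<in>idx n. norm (M x \<nu> \<mu> + (C \<nu> j * expo \<nu> y) * (A i \<mu> * expo \<mu> x))) \<le> r \<nu>"
proof -
  obtain c where c: "c \<ge> 0"
    "\<And>\<epsilon> x \<nu> \<mu>. \<epsilon> \<le> Re x \<Longrightarrow> norm (M x \<nu> \<mu>) \<le> c * exp (- (\<epsilon> * lam \<nu>)) * exp (- (\<epsilon> * lam \<mu>))"
    "\<And>\<epsilon> x y \<nu> \<mu> i j. \<epsilon> \<le> Re x \<Longrightarrow> \<epsilon> \<le> Re y \<Longrightarrow>
      norm (M x \<nu> \<mu> + (C \<nu> j * expo \<nu> y) * (A i \<mu> * expo \<mu> x)) \<le> c * exp (- (\<epsilon> * lam \<nu>)) * exp (- (\<epsilon> * lam \<mu>))"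
    by (rule entry_bounds) (rule that)
  obtain B where B: "\<And>n. (\<Sum>\<nu>\<in>idx n. exp (- (\<epsilon> * lam \<nu>))) \<le> B" using exp_summable[OF assms] by auto
  have B0: "B \<ge> 0" using order.trans[OF _ B[of 0]] by (simp add: sum_nonneg)
  define r where "r \<nu> = c * exp (- (\<epsilon> * lam \<nu>)) * B" for \<nu>
  have row: "(\<Sum>\<mu>\<in>idx n. f \<mu>) \<le> r \<nu>"
    if "\<And>\<mu>. f \<mu> \<le> c * exp (- (\<epsilon> * lam \<nu>)) * exp (- (\<epsilon> * lam \<mu>))" for f n \<nu>
  proof -
    have "(\<Sum>\<mu>\<in>idx n. f \<mu>) \<le> c * exp (- (\<epsilon> * lam \<nu>)) * (\<Sum>\<mu>\<in>idx n. exp (- (\<epsilon> * lam \<mu>)))"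
      unfolding sum_distrib_left by (intro sum_mono that)
    also have "\<dots> \<le> r \<nu>" unfolding r_def using c(1) by (intro mult_left_mono B) auto
    finally show ?thesis .
  qed
  show ?thesis
  proof (rule that[of r "c * B * B"])
    show "r \<nu> \<ge> 0" for \<nu> using c(1) B0 by (simp add: r_def)
    show "(\<Sum>\<nu>\<in>idx n. r \<nu>) \<le> c * B * B" for n
    proof -
      have "(\<Sum>\<nu>\<in>idx n. r \<nu>) = c * B * (\<Sum>\<nu>\<in>idx n. exp (- (\<epsilon> * lam \<nu>)))"
        unfolding r_def sum_distrib_left by (simp add: mult_ac)
      also have "\<dots> \<le> c * B * B" using c(1) B0 by (intro mult_left_mono B) auto
      finally show ?thesis .
    qed
  qed (auto intro!: row c)
qed

lemma D_uniform:
  assumes "0 < \<epsilon>"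
  shows "uniform_limit {x. \<epsilon> \<le> Re x} D Dinf sequentially"
proof -
  obtain r B where rB: "\<And>\<nu>. r \<nu> \<ge> 0" "\<And>n. (\<Sum>\<nu>\<in>idx n. r \<nu>) \<le> B"
    "\<And>x \<nu> n. \<epsilon> \<le> Re x \<Longrightarrow> (\<Sum>\<mu>\<in>idx n. norm (M x \<nu> \<mu>)) \<le> r \<nu>"
    by (rule row_bounds[OF assms]) (rule that)
  have "uniform_limit {x. \<epsilon> \<le> Re x} (\<lambda>n x. det_id_minus (idx n) (M x)) (\<lambda>x. lim (\<lambda>n. det_id_minus (idx n) (M x))) sequentially"
    by (rule det_id_minus_uniform_limit[OF fin mono rB(1,2)]) (use rB(3) in auto)
  then show ?thesis by (simp add: D_def[abs_def] Dinf_def[abs_def])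
qed

lemma N_uniform:
  assumes "0 < \<epsilon>"
  shows "uniform_limit {p. \<epsilon> \<le> Re (fst p) \<and> \<epsilon> \<le> Re (snd p)} (\<lambda>n p. N n i j (fst p) (snd p))
    (\<lambda>p. Ninf i j (fst p) (snd p)) sequentially"
proof -
  obtain r B where rB: "\<And>\<nu>. r \<nu> \<ge> 0" "\<And>n. (\<Sum>\<nu>\<in>idx n. r \<nu>) \<le> B"
    "\<And>x y \<nu> n i j. \<epsilon> \<le> Re x \<Longrightarrow> \<epsilon> \<le> Re y \<Longrightarrow>
      (\<Sum>\<mu>\<in>idx n. norm (M x \<nu> \<mu> + (C \<nu> j * expo \<nu> y) * (A i \<mu> * expo \<mu> x))) \<le> r \<nu>"
    by (rule row_bounds[OF assms]) (rule that)
  show ?thesis unfolding N_def Ninf_def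
    by (rule det_id_minus_uniform_limit[OF fin mono rB(1,2)]) (use rB(3) in auto)
qed

lemma D_N_bounded:
  assumes "0 < \<epsilon>"
  obtains B where "B > 0" "\<And>n x. \<epsilon> \<le> Re x \<Longrightarrow> norm (D n x) \<le> B"
    "\<And>n i j x y. \<epsilon> \<le> Re x \<Longrightarrow> \<epsilon> \<le> Re y \<Longrightarrow> norm (N n i j x y) \<le> B"
proof -
  obtain r B where rB: "\<And>\<nu>. r \<nu> \<ge> 0" "\<And>n. (\<Sum>\<nu>\<in>idx n. r \<nu>) \<le> B"
    "\<And>x \<nu> n. \<epsilon> \<le> Re x \<Longrightarrow> (\<Sum>\<mu>\<in>idx n. norm (M x \<nu> \<mu>)) \<le> r \<nu>"
    "\<And>x y \<nu> n i j. \<epsilon> \<le> Re x \<Longrightarrow> \<epsilon> \<le> Re y \<Longrightarrow>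
      (\<Sum>\<mu>\<in>idx n. norm (M x \<nu> \<mu> + (C \<nu> j * expo \<nu> y) * (A i \<mu> * expo \<mu> x))) \<le> r \<nu>"
    by (rule row_bounds[OF assms]) (rule that)
  show ?thesis
  proof (rule that[of "exp B"])
    show "norm (D n x) \<le> exp B" if "\<epsilon> \<le> Re x" for n x
      unfolding D_def by (rule det_id_minus_bound[OF fin _ rB(2)]) (rule rB(3)[OF that])
    show "norm (N n i j x y) \<le> exp B" if "\<epsilon> \<le> Re x" "\<epsilon> \<le> Re y" for n i j x y
      unfolding N_def by (rule det_id_minus_bound[OF fin _ rB(2)]) (rule rB(4)[OF that])
  qed simp
qed

lemma D_lim: "0 < Re x \<Longrightarrow> (\<lambda>n. D n x) \<longlonglongrightarrow> Dinf x"
  using tendsto_uniform_limitI[OF D_uniform[of "Re x"]] by simp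

lemma N_lim: "0 < Re x \<Longrightarrow> 0 < Re y \<Longrightarrow> (\<lambda>n. N n i j x y) \<longlonglongrightarrow> Ninf i j x y"
  using tendsto_uniform_limitI[OF N_uniform[of "min (Re x) (Re y)" i j], of "(x, y)"] by simp

lemma uniform_limit_imp_holomorphic:
  assumes "open X" "\<And>n. f n holomorphic_on X" "uniform_limit X f g sequentially"
  shows "g holomorphic_on X"
proof (rule holomorphic_uniform_sequence[OF assms(1,2)])
  fix x assume "x \<in> X"
  then obtain d where "d > 0" "cball x d \<subseteq> X" using assms(1) open_contains_cball by blast
  then show "\<exists>d>0. cball x d \<subseteq> X \<and> uniform_limit (cball x d) f g sequentially"
    using uniform_limit_on_subset[OF assms(3)] by blast
qed

lemma halfplane_eq: "{x. 0 < Re x} = (\<Union>\<epsilon>\<in>{0<..}. {x. \<epsilon> < Re x})"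
  using dense by auto

lemma Dinf_holo: "Dinf holomorphic_on {x. 0 < Re x}"
  unfolding halfplane_eq
proof (rule holomorphic_on_UN_open)
  fix \<epsilon> :: real assume "\<epsilon> \<in> {0<..}"
  then have "uniform_limit {x. \<epsilon> < Re x} D Dinf sequentially"
    by (intro uniform_limit_on_subset[OF D_uniform[of \<epsilon>]]) auto
  then show "Dinf holomorphic_on {x. \<epsilon> < Re x}"
    by (rule uniform_limit_imp_holomorphic[OF open_halfspace_Re_gt D_holo])
qed (simp add: open_halfspace_Re_gt)

text \<open>Uniformity in both variables at once covers the three substitutions in use: \<open>x\<close> or \<open>y\<close> varying alone,
  and the diagonal \<open>x = y\<close>.\<close>
lemma N_uniform_comp:
  assumes "0 < \<epsilon>" "\<And>z. z \<in> X \<Longrightarrow> \<epsilon> \<le> Re (f z) \<and> \<epsilon> \<le> Re (g z)"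
  shows "uniform_limit X (\<lambda>n z. N n i j (f z) (g z)) (\<lambda>z. Ninf i j (f z) (g z)) sequentially"
  unfolding uniform_limit_iff
proof (intro allI impI)
  fix e :: real assume "e > 0"
  then have "\<forall>\<^sub>F n in sequentially. \<forall>p\<in>{p. \<epsilon> \<le> Re (fst p) \<and> \<epsilon> \<le> Re (snd p)}.
     dist (N n i j (fst p) (snd p)) (Ninf i j (fst p) (snd p)) < e"
    using N_uniform[OF assms(1), of i j] unfolding uniform_limit_iff by blast
  then show "\<forall>\<^sub>F n in sequentially. \<forall>z\<in>X. dist (N n i j (f z) (g z)) (Ninf i j (f z) (g z)) < e"
  proof eventually_elim
    case (elim n)
    show ?case
    proof
      fix z assume "z \<in> X"
      then show "dist (N n i j (f z) (g z)) (Ninf i j (f z) (g z)) < e"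
        using assms(2)[of z] elim[rule_format, of "(f z, g z)"] by simp
    qed
  qed
qed

lemma Ninf_holo:
  assumes X: "open X" and f: "f holomorphic_on X" and g: "g holomorphic_on X"
    and pos: "\<And>z. z \<in> X \<Longrightarrow> 0 < Re (f z) \<and> 0 < Re (g z)"
  shows "(\<lambda>z. Ninf i j (f z) (g z)) holomorphic_on X"
proof -
  define Y where "Y \<epsilon> = (X \<inter> f -` {w. \<epsilon> < Re w}) \<inter> (X \<inter> g -` {w. \<epsilon> < Re w})" for \<epsilon>
  have "(\<lambda>z. Ninf i j (f z) (g z)) holomorphic_on (\<Union>\<epsilon>\<in>{0<..}. Y \<epsilon>)"
  proof (rule holomorphic_on_UN_open)
    show "open (Y \<epsilon>)" for \<epsilon>
      unfolding Y_def
      by (intro open_Int continuous_open_preimage holomorphic_on_imp_continuous_on f g X open_halfspace_Re_gt)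
    fix \<epsilon> :: real assume "\<epsilon> \<in> {0<..}"
    then have "uniform_limit (Y \<epsilon>) (\<lambda>n z. N n i j (f z) (g z)) (\<lambda>z. Ninf i j (f z) (g z)) sequentially"
      by (intro N_uniform_comp[of \<epsilon>]) (auto simp: Y_def)
    then show "(\<lambda>z. Ninf i j (f z) (g z)) holomorphic_on Y \<epsilon>"
      by (rule uniform_limit_imp_holomorphic[OF \<open>open (Y \<epsilon>)\<close>, rotated])
        (intro N_holo holomorphic_on_subset[OF f] holomorphic_on_subset[OF g], auto simp: Y_def)
  qed
  moreover have "X \<subseteq> (\<Union>\<epsilon>\<in>{0<..}. Y \<epsilon>)"
  proof
    fix z assume z: "z \<in> X"
    obtain \<epsilon> where "0 < \<epsilon>" "\<epsilon> < min (Re (f z)) (Re (g z))" using dense[of 0 "min (Re (f z)) (Re (g z))"] pos[OF z] by auto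
    then show "z \<in> (\<Union>\<epsilon>\<in>{0<..}. Y \<epsilon>)" using z by (auto simp: Y_def)
  qed
  ultimately show ?thesis by (rule holomorphic_on_subset)
qed

text \<open>The points at which the limiting system is invertible.\<close>
abbreviation good :: "complex set" where "good \<equiv> {z. 0 < Re z \<and> Dinf z \<noteq> 0}"

lemma open_good: "open good"
proof -
  have c: "continuous_on {x. 0 < Re x} Dinf" by (rule holomorphic_on_imp_continuous_on[OF Dinf_holo])
  have "open ({x. 0 < Re x} \<inter> Dinf -` (- {0}))"
    by (rule continuous_open_preimage[OF c]) (auto simp: open_halfspace_Re_gt)
  moreover have "{x. 0 < Re x} \<inter> Dinf -` (- {0}) = good" by auto
  ultimately show ?thesis by simp
qed

lemma Winf_holo_x:
  assumes "0 < Re y"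
  shows "(\<lambda>x. Winf i j x y) holomorphic_on good"
  unfolding Winf_def
  by (intro holomorphic_intros Ninf_holo open_good holomorphic_on_subset[OF Dinf_holo]) (use assms in auto)

lemma Winf_holo_diag: "(\<lambda>x. Winf i j x x) holomorphic_on good"
  unfolding Winf_def
  by (intro holomorphic_intros Ninf_holo open_good holomorphic_on_subset[OF Dinf_holo]) auto

lemma Hinf_holo: "(\<lambda>x. Hinf i k x) holomorphic_on good"
  unfolding Hinf_def by (intro holomorphic_intros Winf_holo_diag)

lemma Winf_holo_y:
  assumes "0 < Re x"
  shows "(\<lambda>y. Winf i j x y) holomorphic_on {y. 0 < Re y}"
  unfolding Winf_def divide_inverse
  by (intro holomorphic_intros Ninf_holo) (use assms in \<open>auto simp: open_halfspace_Re_gt\<close>)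

lemma good_nbhd:
  assumes "x0 \<in> good"
  obtains U \<epsilon> c n0 where "open U" "x0 \<in> U" "U \<subseteq> good" "0 < \<epsilon>" "\<And>x. x \<in> U \<Longrightarrow> \<epsilon> \<le> Re x" "0 < c"
    "\<And>x. x \<in> U \<Longrightarrow> c \<le> norm (Dinf x)" "\<And>n x. n \<ge> n0 \<Longrightarrow> x \<in> U \<Longrightarrow> c \<le> norm (D n x)"
proof -
  \<comment> \<open>on a neighbourhood where \<open>|Dinf| > |Dinf x0| / 2\<close>, the truncations stay above half of that value\<close>
  define \<epsilon> where "\<epsilon> = Re x0 / 2"
  define c where "c = norm (Dinf x0) / 4"
  have e: "\<epsilon> > 0" "c > 0" using assms by (auto simp: \<epsilon>_def c_def)
  have ct: "continuous_on good (\<lambda>x. norm (Dinf x))"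
    by (intro continuous_on_norm holomorphic_on_imp_continuous_on holomorphic_on_subset[OF Dinf_holo]) auto
  define U where "U = (good \<inter> (\<lambda>x. norm (Dinf x)) -` {2 * c<..}) \<inter> {x. \<epsilon> < Re x}"
  have 1: "open U" unfolding U_def
    by (intro open_Int open_halfspace_Re_gt continuous_open_preimage[OF ct open_good]) auto
  have 2: "x0 \<in> U" using assms by (auto simp: U_def \<epsilon>_def c_def)
  have "\<forall>\<^sub>F n in sequentially. \<forall>x\<in>{x. \<epsilon> \<le> Re x}. dist (D n x) (Dinf x) < c"
    using D_uniform[OF e(1)] e(2) unfolding uniform_limit_iff by blast
  then obtain n0 where n0: "\<And>n x. n \<ge> n0 \<Longrightarrow> \<epsilon> \<le> Re x \<Longrightarrow> dist (D n x) (Dinf x) < c"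
    unfolding eventually_sequentially by auto
  have 3: "c \<le> norm (D n x)" if "n \<ge> n0" "x \<in> U" for n x
  proof -
    have "norm (Dinf x) - norm (D n x) \<le> dist (D n x) (Dinf x)"
      by (simp add: dist_norm norm_triangle_ineq2 norm_minus_commute)
    also have "\<dots> < c" using n0[OF that(1), of x] that(2) by (auto simp: U_def)
    finally show ?thesis using that(2) by (auto simp: U_def)
  qed
  show ?thesis
    by (rule that[of U \<epsilon> c n0]) (use 1 2 3 e in \<open>auto simp: U_def\<close>)
qed

lemma W_lim:
  assumes "x \<in> good" "0 < Re y"
  shows "(\<lambda>n. W n i j x y) \<longlonglongrightarrow> Winf i j x y"
  unfolding W_def Winf_def using assms by (intro tendsto_intros D_lim N_lim) auto

lemma W_uniform_comp:
  assumes U: "\<And>x. x \<in> U \<Longrightarrow> c \<le> norm (Dinf (f x))" "0 < c"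
    and e: "0 < \<epsilon>" "\<And>x. x \<in> U \<Longrightarrow> \<epsilon> \<le> Re (f x) \<and> \<epsilon> \<le> Re (g x)"
  shows "uniform_limit U (\<lambda>n x. W n i j (f x) (g x)) (\<lambda>x. Winf i j (f x) (g x)) sequentially"
  unfolding W_def Winf_def
proof (intro uniform_limit_minus uniform_limit_const uniform_lim_divide[where b=c])
  show "uniform_limit U (\<lambda>n x. N n i j (f x) (g x)) (\<lambda>x. Ninf i j (f x) (g x)) sequentially"
    by (rule N_uniform_comp[OF e])
  show "uniform_limit U (\<lambda>n x. D n (f x)) (\<lambda>x. Dinf (f x)) sequentially"
    unfolding uniform_limit_iff
  proof (intro allI impI)
    fix d :: real assume "d > 0"
    then have "\<forall>\<^sub>F n in sequentially. \<forall>p\<in>{x. \<epsilon> \<le> Re x}. dist (D n p) (Dinf p) < d"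
      using D_uniform[OF e(1)] unfolding uniform_limit_iff by blast
    then show "\<forall>\<^sub>F n in sequentially. \<forall>z\<in>U. dist (D n (f z)) (Dinf (f z)) < d"
      by eventually_elim (use e(2) in auto)
  qed
  obtain B where B: "\<And>n i j x y. \<epsilon> \<le> Re x \<Longrightarrow> \<epsilon> \<le> Re y \<Longrightarrow> norm (N n i j x y) \<le> B"
    by (rule D_N_bounded[OF e(1)]) (rule that)
  have "norm (Ninf i j (f x) (g x)) \<le> B" if "x \<in> U" for x
  proof (rule tendsto_upperbound[OF tendsto_norm[OF N_lim]])
    show "\<forall>\<^sub>F n in sequentially. norm (N n i j (f x) (g x)) \<le> B" using B e(2)[OF that] by auto
  qed (use e(1) e(2)[OF that] in auto)
  then show "bounded ((\<lambda>x. Ninf i j (f x) (g x)) ` U)" by (auto simp: bounded_iff)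
qed (use U in auto)

lemma uniform_limit_finite_sum:
  fixes f :: "'j \<Rightarrow> 'a \<Rightarrow> 'b \<Rightarrow> complex"
  assumes "finite J" "\<And>j. j \<in> J \<Longrightarrow> uniform_limit X (f j) (g j) F"
  shows "uniform_limit X (\<lambda>n x. \<Sum>j\<in>J. f j n x) (\<lambda>x. \<Sum>j\<in>J. g j x) F"
  using assms
proof (induction J rule: finite_induct)
  case empty then show ?case by (simp add: uniform_limit_const)
next
  case (insert j J)
  then show ?case by (simp add: uniform_limit_add)
qed

text \<open>Holomorphic functions that converge locally uniformly may be differentiated in the limit, which carries
  over \<open>log_deriv_finite\<close>.\<close>
theorem log_deriv:
  assumes "x \<in> good"
  shows "(Dinf has_field_derivative Dinf x * (\<Sum>i\<in>UNIV. Hinf i i x)) (at x)"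
proof -
  obtain U \<epsilon> c n0 where U: "open U" "x \<in> U" "U \<subseteq> good" "0 < \<epsilon>" "\<And>x. x \<in> U \<Longrightarrow> \<epsilon> \<le> Re x" "0 < c"
    "\<And>x. x \<in> U \<Longrightarrow> c \<le> norm (Dinf x)" "\<And>n x. n \<ge> n0 \<Longrightarrow> x \<in> U \<Longrightarrow> c \<le> norm (D n x)"
    by (rule good_nbhd[OF assms]) (rule that)
  have "(\<lambda>n. (deriv ^^ 1) (D n) x) \<longlonglongrightarrow> (deriv ^^ 1) Dinf x"
  proof (rule higher_deriv_complex_uniform_limit[OF _ _ _ U(1,2)])
    show "uniform_limit U D Dinf sequentially"
      using U(5) by (intro uniform_limit_on_subset[OF D_uniform[OF U(4)]]) auto
    have "D n holomorphic_on U" for n by (rule D_holo)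
    then show "\<forall>\<^sub>F n in sequentially. D n holomorphic_on U" by simp
  qed simp
  hence 1: "(\<lambda>n. deriv (D n) x) \<longlonglongrightarrow> deriv Dinf x" by simp
  have "(\<lambda>n. D n x * (\<Sum>i\<in>UNIV. \<Sum>j\<in>UNIV. W n i j x x * S j i)) \<longlonglongrightarrow> Dinf x * (\<Sum>i\<in>UNIV. Hinf i i x)"
    unfolding Hinf_def using assms by (intro tendsto_intros D_lim W_lim) auto
  moreover have "\<forall>\<^sub>F n in sequentially. D n x * (\<Sum>i\<in>UNIV. \<Sum>j\<in>UNIV. W n i j x x * S j i) = deriv (D n) x"
    using eventually_ge_at_top[of n0]
  proof eventually_elim
    case (elim n)
    hence D: "D n x \<noteq> 0" using U(2,6) U(8)[of n x] by auto
    show ?case using DERIV_imp_deriv[OF log_deriv_finite[OF D]] by (simp add: H_fin_eq[OF D])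
  qed
  ultimately have "(\<lambda>n. deriv (D n) x) \<longlonglongrightarrow> Dinf x * (\<Sum>i\<in>UNIV. Hinf i i x)"
    by (rule Lim_transform_eventually)
  with 1 have "deriv Dinf x = Dinf x * (\<Sum>i\<in>UNIV. Hinf i i x)" by (rule LIMSEQ_unique)
  moreover have "(Dinf has_field_derivative deriv Dinf x) (at x)"
    by (rule holomorphic_derivI[OF Dinf_holo]) (use assms in \<open>auto simp: open_halfspace_Re_gt\<close>)
  ultimately show ?thesis by simp
qed

theorem PDE:
  assumes "x \<in> good" "0 < Re y"
  shows "(deriv ^^ 2) (\<lambda>x. Winf i j x y) x - (deriv ^^ 2) (\<lambda>y. Winf i j x y) y =
     - 2 * (\<Sum>k\<in>UNIV. deriv (Hinf i k) x * Winf k j x y)"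
proof -
  obtain U \<epsilon> c n0 where U: "open U" "x \<in> U" "U \<subseteq> good" "0 < \<epsilon>" "\<And>x. x \<in> U \<Longrightarrow> \<epsilon> \<le> Re x" "0 < c"
    "\<And>x. x \<in> U \<Longrightarrow> c \<le> norm (Dinf x)" "\<And>n x. n \<ge> n0 \<Longrightarrow> x \<in> U \<Longrightarrow> c \<le> norm (D n x)"
    by (rule good_nbhd[OF assms(1)]) (rule that)
  have Dn: "D n z \<noteq> 0" if "n \<ge> n0" "z \<in> U" for n z using U(6) U(8)[OF that] by auto
  have ev: "\<forall>\<^sub>F n in sequentially. n \<ge> n0" by (rule eventually_ge_at_top)
  have Whx: "(\<lambda>z. W n i j z y) holomorphic_on U" if "n \<ge> n0" for n
    unfolding W_def using Dn[OF that] by (intro holomorphic_intros) auto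
  have Whd: "(\<lambda>z. W n i j z z) holomorphic_on U" if "n \<ge> n0" for n i j
    unfolding W_def using Dn[OF that] by (intro holomorphic_intros) auto
  have Why: "(\<lambda>y. W n i j x y) holomorphic_on X" for n X
    unfolding W_def divide_inverse by (intro holomorphic_intros)
  have X: "(\<lambda>n. (deriv ^^ 2) (\<lambda>x. W n i j x y) x) \<longlonglongrightarrow> (deriv ^^ 2) (\<lambda>x. Winf i j x y) x"
  proof (rule higher_deriv_complex_uniform_limit[OF _ _ _ U(1,2)])
    show "uniform_limit U (\<lambda>n x. W n i j x y) (\<lambda>x. Winf i j x y) sequentially"
      by (rule W_uniform_comp[where \<epsilon>="min \<epsilon> (Re y)" and c=c]) (use U assms(2) in \<open>auto simp: min.coboundedI1\<close>)
    show "\<forall>\<^sub>F n in sequentially. (\<lambda>x. W n i j x y) holomorphic_on U"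
      using ev by eventually_elim (rule Whx)
  qed auto
  define V where "V = {z. Re y / 2 < Re z}"
  have Y: "(\<lambda>n. (deriv ^^ 2) (\<lambda>y. W n i j x y) y) \<longlonglongrightarrow> (deriv ^^ 2) (\<lambda>y. Winf i j x y) y"
  proof (rule higher_deriv_complex_uniform_limit[where A=V])
    show "uniform_limit V (\<lambda>n y. W n i j x y) (\<lambda>y. Winf i j x y) sequentially"
      by (rule W_uniform_comp[where \<epsilon>="min \<epsilon> (Re y / 2)" and c=c])
        (use U assms(2) in \<open>auto simp: min.coboundedI1 min.coboundedI2 V_def\<close>)
    show "open V" unfolding V_def by (rule open_halfspace_Re_gt)
    show "y \<in> V" using assms(2) by (simp add: V_def)
    show "\<forall>\<^sub>F n in sequentially. (\<lambda>y. W n i j x y) holomorphic_on V" using Why by simp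
  qed simp
  have H: "(\<lambda>n. (deriv ^^ 1) (H_fin n i k) x) \<longlonglongrightarrow> (deriv ^^ 1) (Hinf i k) x" for k
  proof (rule higher_deriv_complex_uniform_limit[OF _ _ _ U(1,2)])
    have "uniform_limit U (\<lambda>n x. \<Sum>j\<in>UNIV. W n i j x x * S j k) (\<lambda>x. \<Sum>j\<in>UNIV. Winf i j x x * S j k) sequentially"
      unfolding mult.commute[of _ "S _ k"]
      by (intro uniform_limit_finite_sum finite bounded_linear.uniform_limit[OF bounded_linear_mult_right]
          W_uniform_comp[where \<epsilon>=\<epsilon> and c=c]) (use U(4-7) in auto)
    moreover have "\<forall>\<^sub>F n in sequentially. \<forall>z\<in>U. (\<Sum>j\<in>UNIV. W n i j z z * S j k) = H_fin n i k z"
      using ev by eventually_elim (use H_fin_eq Dn in auto)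
    ultimately show "uniform_limit U (\<lambda>n. H_fin n i k) (Hinf i k) sequentially"
      unfolding Hinf_def[abs_def] using uniform_limit_cong by fastforce
    show "\<forall>\<^sub>F n in sequentially. H_fin n i k holomorphic_on U"
      using ev
    proof eventually_elim
      case (elim n)
      have "(\<lambda>z. \<Sum>j\<in>UNIV. W n i j z z * S j k) holomorphic_on U"
        by (intro holomorphic_intros Whd elim)
      then show ?case by (rule holomorphic_transform) (use H_fin_eq Dn elim in auto)
    qed
  qed auto
  have L: "(\<lambda>n. (deriv ^^ 2) (\<lambda>x. W n i j x y) x - (deriv ^^ 2) (\<lambda>y. W n i j x y) y) \<longlonglongrightarrow>
     (deriv ^^ 2) (\<lambda>x. Winf i j x y) x - (deriv ^^ 2) (\<lambda>y. Winf i j x y) y"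
    by (rule tendsto_diff[OF X Y])
  have R: "(\<lambda>n. - 2 * (\<Sum>k\<in>UNIV. deriv (H_fin n i k) x * W n k j x y)) \<longlonglongrightarrow>
     - 2 * (\<Sum>k\<in>UNIV. deriv (Hinf i k) x * Winf k j x y)"
    using H assms by (intro tendsto_intros W_lim) auto
  have "\<forall>\<^sub>F n in sequentially. - 2 * (\<Sum>k\<in>UNIV. deriv (H_fin n i k) x * W n k j x y) =
     (deriv ^^ 2) (\<lambda>x. W n i j x y) x - (deriv ^^ 2) (\<lambda>y. W n i j x y) y"
    using ev by eventually_elim (use PDE_finite Dn U(2) in auto)
  from Lim_transform_eventually[OF R this] show ?thesis
    by (intro LIMSEQ_unique[OF L])
qed

text \<open>The row sums of \<open>M x\<close> tend to 0 like \<open>exp(-2 \<lambda>\<^sub>0 x)\<close>.\<close>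
lemma Dinf_at_top: "((\<lambda>x. Dinf (of_real x)) \<longlongrightarrow> 1) at_top"
proof -
  obtain c where c: "c \<ge> 0"
    "\<And>\<epsilon> x \<nu> \<mu>. \<epsilon> \<le> Re x \<Longrightarrow> norm (M x \<nu> \<mu>) \<le> c * exp (- (\<epsilon> * lam \<nu>)) * exp (- (\<epsilon> * lam \<mu>))"
    by (rule entry_bounds) (rule that)
  obtain B where B: "\<And>n. (\<Sum>\<nu>\<in>idx n. exp (- (1 * lam \<nu>))) \<le> B" using exp_summable[of 1] by auto
  have B0: "B \<ge> 0" using order.trans[OF _ B[of 0]] by (simp add: sum_nonneg)
  define s where "s x = exp (- ((x - 1) * lam0))" for x
  have bd: "norm (Dinf (of_real x) - 1) \<le> exp (c * (s x)\<^sup>2 * B * B) - 1" if "x \<ge> 1" for x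
  proof (rule tendsto_upperbound[OF tendsto_norm[OF tendsto_diff[OF D_lim tendsto_const]]])
    have ex: "exp (- (x * lam \<nu>)) \<le> s x * exp (- lam \<nu>)" for \<nu>
    proof -
      have "(x - 1) * lam0 \<le> (x - 1) * lam \<nu>" using that lam by (intro mult_left_mono) auto
      then show ?thesis unfolding s_def exp_add[symmetric] exp_le_cancel_iff by (simp add: algebra_simps)
    qed
    have m: "norm (M (of_real x) \<nu> \<mu>) \<le> c * (s x)\<^sup>2 * exp (- lam \<nu>) * exp (- lam \<mu>)" for \<nu> \<mu>
    proof -
      have "norm (M (of_real x) \<nu> \<mu>) \<le> c * exp (- (x * lam \<nu>)) * exp (- (x * lam \<mu>))" using c(2)[of x] by simp
      also have "\<dots> \<le> c * (s x * exp (- lam \<nu>)) * (s x * exp (- lam \<mu>))"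
        by (intro mult_mono mult_left_mono ex c) (auto simp: s_def c)
      finally show ?thesis by (simp add: power2_eq_square mult_ac)
    qed
    have "norm (D n (of_real x) - 1) \<le> exp (c * (s x)\<^sup>2 * B * B) - 1" for n
      unfolding D_def
    proof (rule det_id_minus_minus_one_bound[where r="\<lambda>\<nu>. c * (s x)\<^sup>2 * exp (- lam \<nu>) * B", OF fin])
      have "(\<Sum>\<mu>\<in>idx n. norm (M (of_real x) \<nu> \<mu>)) \<le> c * (s x)\<^sup>2 * exp (- lam \<nu>) * (\<Sum>\<mu>\<in>idx n. exp (- lam \<mu>))" for \<nu>
        unfolding sum_distrib_left by (intro sum_mono m)
      also have "\<dots> \<nu> \<le> c * (s x)\<^sup>2 * exp (- lam \<nu>) * B" for \<nu>
        using B[of n] c(1) by (intro mult_left_mono) auto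
      finally show "(\<Sum>\<mu>\<in>idx n. norm (M (of_real x) \<nu> \<mu>)) \<le> c * (s x)\<^sup>2 * exp (- lam \<nu>) * B" for \<nu> .
      have "(\<Sum>\<nu>\<in>idx n. c * (s x)\<^sup>2 * exp (- lam \<nu>) * B) = c * (s x)\<^sup>2 * B * (\<Sum>\<nu>\<in>idx n. exp (- lam \<nu>))"
        unfolding sum_distrib_left by (simp add: mult_ac)
      also have "\<dots> \<le> c * (s x)\<^sup>2 * B * B" using B[of n] c(1) B0 by (intro mult_left_mono) auto
      finally show "(\<Sum>\<nu>\<in>idx n. c * (s x)\<^sup>2 * exp (- lam \<nu>) * B) \<le> c * (s x)\<^sup>2 * B * B" .
    qed
    then show "\<forall>\<^sub>F n in sequentially. norm (D n (of_real x) - 1) \<le> exp (c * (s x)\<^sup>2 * B * B) - 1" by simp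
  qed (use that in auto)
  have "filterlim (\<lambda>x. - ((x - 1) * lam0)) at_bot at_top" using lam0 by real_asymp
  hence "(s \<longlongrightarrow> 0) at_top" unfolding s_def by (rule filterlim_compose[OF exp_at_bot])
  hence "((\<lambda>x. exp (c * (s x)\<^sup>2 * B * B) - 1) \<longlongrightarrow> exp (c * 0\<^sup>2 * B * B) - 1) at_top" by (intro tendsto_intros)
  hence "((\<lambda>x. exp (c * (s x)\<^sup>2 * B * B) - 1) \<longlongrightarrow> 0) at_top" by simp
  hence "((\<lambda>x. Dinf (of_real x) - 1) \<longlongrightarrow> 0) at_top"
    by (rule Lim_null_comparison[rotated]) (use bd in \<open>auto intro!: eventually_mono[OF eventually_ge_at_top[of 1]]\<close>)
  then show ?thesis by (simp add: LIM_zero_iff)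
qed

end

section \<open>The Gelfand--Levitan integral equation\<close>

lemma has_bochner_integral_exp_tail:
  fixes a x :: real
  assumes "a > 0"
  shows "has_bochner_integral lborel (\<lambda>s. indicator {x<..} s * exp (- (a * s))) (exp (- (a * x)) / a)"
proof -
  have "has_bochner_integral lborel (\<lambda>s. indicator {x..} s * exp (- (a * s))) (exp (- (a * x)) / a)"
  proof (rule has_bochner_integral_nn_integral)
    have "(\<integral>\<^sup>+ s. ennreal (exp (- a * s)) * indicator {x..} s \<partial>lborel) = ennreal (exp (- a * x) / a)"
      by (rule nn_integral_has_integral_lebesgue'[OF _ has_integral_exp_minus_to_infinity[OF assms]]) auto
    moreover have "(\<integral>\<^sup>+ s. ennreal (indicator {x..} s * exp (- (a * s))) \<partial>lborel) =
      (\<integral>\<^sup>+ s. ennreal (exp (- a * s)) * indicator {x..} s \<partial>lborel)"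
      by (intro nn_integral_cong) (auto simp: indicator_def)
    ultimately show "(\<integral>\<^sup>+ s. ennreal (indicator {x..} s * exp (- (a * s))) \<partial>lborel) = ennreal (exp (- (a * x)) / a)"
      by (simp only: mult_minus_left)
  qed (use assms in auto)
  moreover have "AE s in lborel. indicator {x..} s * exp (- (a * s)) = indicator {x<..} s * exp (- (a * s))"
    using AE_lborel_singleton[of x] by eventually_elim (auto simp: indicator_def)
  ultimately show ?thesis by (subst has_bochner_integral_cong_AE[symmetric]) auto
qed

locale exp_kernel_sum = exp_kernel +
  fixes Psi :: "'b \<Rightarrow> 'b \<Rightarrow> real \<Rightarrow> complex"
  assumes Psi_lim: "0 < t \<Longrightarrow> (\<lambda>n. \<Sum>\<nu>\<in>idx n. A k \<nu> * C \<nu> j * expo \<nu> (of_real t)) \<longlonglongrightarrow> Psi k j t"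
begin

definition Psi_fin :: "nat \<Rightarrow> 'b \<Rightarrow> 'b \<Rightarrow> real \<Rightarrow> complex" where
  "Psi_fin n k j t = (\<Sum>\<nu>\<in>idx n. A k \<nu> * C \<nu> j * expo \<nu> (of_real t))"

lemma E_integral:
  "has_bochner_integral lborel (\<lambda>s. indicator {x<..} s *\<^sub>R (expo \<mu> (of_real s) * expo \<nu> (of_real s))) (E \<mu> \<nu> (of_real x))"
proof -
  have pos: "lam \<mu> + lam \<nu> > 0" using lam_pos[of \<mu>] lam_pos[of \<nu>] by simp
  have e: "expo \<mu> (of_real s) * expo \<nu> (of_real s) = of_real (exp (- ((lam \<mu> + lam \<nu>) * s)))" for s
    by (simp add: expo_def exp_add[symmetric] algebra_simps exp_of_real[symmetric])
  have "has_bochner_integral lborel (\<lambda>s. complex_of_real (indicator {x<..} s * exp (- ((lam \<mu> + lam \<nu>) * s))))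
     (of_real (exp (- ((lam \<mu> + lam \<nu>) * x)) / (lam \<mu> + lam \<nu>)))"
    by (rule has_bochner_integral_of_real[OF has_bochner_integral_exp_tail[OF pos]])
  then show ?thesis unfolding E_def e by (simp add: scaleR_conv_of_real)
qed

text \<open>Integrating the exponentials over \<open>(x,\<infinity>)\<close> produces the numbers \<open>E\<^sub>\<mu>\<^sub>\<nu>\<close>, and what remains is the linear
  system \<open>coef_eq\<close>.\<close>
lemma GL_finite:
  assumes "D n (of_real x) \<noteq> 0"
  shows "has_bochner_integral lborel
    (\<lambda>s. indicator {x<..} s *\<^sub>R (\<Sum>j\<in>UNIV. \<Sum>k\<in>UNIV. W n i j (of_real x) (of_real s) * S j k * Psi_fin n k l (s + y)))
    (- Psi_fin n i l (x + y) - W n i l (of_real x) (of_real y))"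
proof -
  let ?o = "\<lambda>\<mu>. coef n i \<mu> (of_real x)"
  have expo_add: "expo \<nu> (of_real (s + t)) = expo \<nu> (of_real s) * expo \<nu> (of_real t)" for \<nu> s t
    by (simp add: expo_def exp_add[symmetric] algebra_simps)
  have 1: "(\<Sum>j\<in>UNIV. \<Sum>k\<in>UNIV. W n i j (of_real x) (of_real s) * S j k * Psi_fin n k l (s + y)) =
     (\<Sum>\<mu>\<in>idx n. \<Sum>\<nu>\<in>idx n. (?o \<mu> * G \<mu> \<nu> * C \<nu> l * expo \<nu> (of_real y)) * (expo \<mu> (of_real s) * expo \<nu> (of_real s)))" for s
  proof -
    have "(\<Sum>j\<in>UNIV. \<Sum>k\<in>UNIV. W n i j (of_real x) (of_real s) * S j k * Psi_fin n k l (s + y)) =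
      (\<Sum>k\<in>UNIV. (\<Sum>j\<in>UNIV. W n i j (of_real x) (of_real s) * S j k) * Psi_fin n k l (s + y))"
      unfolding sum_distrib_right by (rule sum.swap)
    also have "\<dots> = (\<Sum>k\<in>UNIV. (\<Sum>\<mu>\<in>idx n. ?o \<mu> * expo \<mu> (of_real s) * CS \<mu> k) * Psi_fin n k l (s + y))"
    proof (intro sum.cong refl arg_cong2[where f="(*)"])
      fix k
      have "(\<Sum>j\<in>UNIV. W n i j (of_real x) (of_real s) * S j k) =
         (\<Sum>j\<in>UNIV. \<Sum>\<mu>\<in>idx n. ?o \<mu> * expo \<mu> (of_real s) * (C \<mu> j * S j k))"
        unfolding W_eq[OF assms] sum_distrib_right by (simp add: mult_ac)
      also have "\<dots> = (\<Sum>\<mu>\<in>idx n. ?o \<mu> * expo \<mu> (of_real s) * CS \<mu> k)"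
        unfolding CS_def sum_distrib_left by (rule sum.swap)
      finally show "(\<Sum>j\<in>UNIV. W n i j (of_real x) (of_real s) * S j k) =
        (\<Sum>\<mu>\<in>idx n. ?o \<mu> * expo \<mu> (of_real s) * CS \<mu> k)" .
    qed
    also have "\<dots> = (\<Sum>k\<in>UNIV. \<Sum>\<mu>\<in>idx n. \<Sum>\<nu>\<in>idx n. ?o \<mu> * (CS \<mu> k * A k \<nu>) * C \<nu> l * expo \<nu> (of_real y) * (expo \<mu> (of_real s) * expo \<nu> (of_real s)))"
      unfolding Psi_fin_def expo_add sum_product by (intro sum.cong refl) (simp only: mult_ac)
    also have "\<dots> = (\<Sum>\<mu>\<in>idx n. \<Sum>\<nu>\<in>idx n. \<Sum>k\<in>UNIV. ?o \<mu> * (CS \<mu> k * A k \<nu>) * C \<nu> l * expo \<nu> (of_real y) * (expo \<mu> (of_real s) * expo \<nu> (of_real s)))"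
      by (subst sum.swap, intro sum.cong refl, rule sum.swap)
    finally show ?thesis unfolding G_def sum_distrib_left sum_distrib_right .
  qed
  have 2: "has_bochner_integral lborel
     (\<lambda>s. \<Sum>\<mu>\<in>idx n. \<Sum>\<nu>\<in>idx n. (?o \<mu> * G \<mu> \<nu> * C \<nu> l * expo \<nu> (of_real y)) *
        (indicator {x<..} s *\<^sub>R (expo \<mu> (of_real s) * expo \<nu> (of_real s))))
     (\<Sum>\<mu>\<in>idx n. \<Sum>\<nu>\<in>idx n. (?o \<mu> * G \<mu> \<nu> * C \<nu> l * expo \<nu> (of_real y)) * E \<mu> \<nu> (of_real x))"
    by (intro has_bochner_integral_sum has_bochner_integral_mult_right E_integral)
  have 3: "(\<Sum>\<mu>\<in>idx n. \<Sum>\<nu>\<in>idx n. (?o \<mu> * G \<mu> \<nu> * C \<nu> l * expo \<nu> (of_real y)) * E \<mu> \<nu> (of_real x)) =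
      - Psi_fin n i l (x + y) - W n i l (of_real x) (of_real y)"
  proof -
    have "(\<Sum>\<mu>\<in>idx n. \<Sum>\<nu>\<in>idx n. (?o \<mu> * G \<mu> \<nu> * C \<nu> l * expo \<nu> (of_real y)) * E \<mu> \<nu> (of_real x)) =
      (\<Sum>\<nu>\<in>idx n. (\<Sum>\<mu>\<in>idx n. ?o \<mu> * G \<mu> \<nu> * E \<mu> \<nu> (of_real x)) * (C \<nu> l * expo \<nu> (of_real y)))"
      unfolding sum_distrib_right by (subst sum.swap, intro sum.cong refl) (simp only: mult_ac)
    also have "\<dots> = (\<Sum>\<nu>\<in>idx n. (- A i \<nu> * expo \<nu> (of_real x) - ?o \<nu>) * (C \<nu> l * expo \<nu> (of_real y)))"
    proof (intro sum.cong refl arg_cong2[where f="(*)"])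
      fix \<nu> assume "\<nu> \<in> idx n"
      from coef_eq[OF assms this, of i]
      show "(\<Sum>\<mu>\<in>idx n. ?o \<mu> * G \<mu> \<nu> * E \<mu> \<nu> (of_real x)) = - A i \<nu> * expo \<nu> (of_real x) - ?o \<nu>"
        by (simp add: eq_diff_eq add.commute)
    qed
    also have "\<dots> = - Psi_fin n i l (x + y) - W n i l (of_real x) (of_real y)"
      unfolding Psi_fin_def expo_add W_eq[OF assms]
      unfolding left_diff_distrib sum_subtractf minus_mult_left[symmetric] sum_negf by (simp only: mult_ac)
    finally show ?thesis .
  qed
  show ?thesis
    using 2 unfolding 3 1 scaleR_sum_right by (simp add: mult_scaleR_right)
qed

lemma Psi_fin_lim: "0 < t \<Longrightarrow> (\<lambda>n. Psi_fin n k j t) \<longlonglongrightarrow> Psi k j t"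
  unfolding Psi_fin_def by (rule Psi_lim)

lemma Psi_fin_bound:
  assumes "0 < y"
  obtains B where "B \<ge> 0" "\<And>n k j s. 0 \<le> s \<Longrightarrow> norm (Psi_fin n k j (s + y)) \<le> B * exp (- (lam0 * s))"
proof -
  obtain B where B: "\<And>n. (\<Sum>\<nu>\<in>idx n. exp (- (y * lam \<nu>))) \<le> B" using exp_summable[OF assms] by auto
  have B0: "B \<ge> 0" using order.trans[OF _ B[of 0]] by (simp add: sum_nonneg)
  show ?thesis
  proof (rule that[of "K * K * B"])
    show "0 \<le> K * K * B" using K_nonneg B0 by simp
    fix n k j and s :: real assume s: "0 \<le> s"
    have "norm (Psi_fin n k j (s + y)) \<le> (\<Sum>\<nu>\<in>idx n. K * K * exp (- (lam0 * s)) * exp (- (y * lam \<nu>)))"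
      unfolding Psi_fin_def
    proof (rule sum_norm_le)
      fix \<nu>
      have "norm (expo \<nu> (of_real (s + y))) = exp (- (lam \<nu> * s)) * exp (- (y * lam \<nu>))"
        by (simp add: norm_expo exp_add[symmetric] algebra_simps)
      also have "\<dots> \<le> exp (- (lam0 * s)) * exp (- (y * lam \<nu>))"
        using s lam[of \<nu>] by (intro mult_right_mono) (auto intro: mult_right_mono)
      finally have "norm (expo \<nu> (of_real (s + y))) \<le> exp (- (lam0 * s)) * exp (- (y * lam \<nu>))" .
      then show "norm (A k \<nu> * C \<nu> j * expo \<nu> (of_real (s + y))) \<le> K * K * exp (- (lam0 * s)) * exp (- (y * lam \<nu>))"
        unfolding norm_mult mult.assoc[of "K * K"] using A_bound C_bound K_nonneg
        by (intro mult_mono) auto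
    qed
    also have "\<dots> = K * K * exp (- (lam0 * s)) * (\<Sum>\<nu>\<in>idx n. exp (- (y * lam \<nu>)))"
      by (simp add: sum_distrib_left)
    also have "\<dots> \<le> K * K * exp (- (lam0 * s)) * B"
      using K_nonneg by (intro mult_left_mono B) auto
    finally show "norm (Psi_fin n k j (s + y)) \<le> K * K * B * exp (- (lam0 * s))" by (simp add: mult_ac)
  qed
qed

lemma W_bounded:
  assumes "x \<in> good"
  obtains B n0 where "B \<ge> 0" "\<And>n. n \<ge> n0 \<Longrightarrow> D n x \<noteq> 0"
    "\<And>n i j y. n \<ge> n0 \<Longrightarrow> Re x \<le> Re y \<Longrightarrow> norm (W n i j x y) \<le> B"
    "\<And>i j y. Re x \<le> Re y \<Longrightarrow> norm (Winf i j x y) \<le> B"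
proof -
  obtain U \<epsilon> c n0 where U: "open U" "x \<in> U" "U \<subseteq> good" "0 < \<epsilon>" "\<And>x. x \<in> U \<Longrightarrow> \<epsilon> \<le> Re x" "0 < c"
    "\<And>x. x \<in> U \<Longrightarrow> c \<le> norm (Dinf x)" "\<And>n x. n \<ge> n0 \<Longrightarrow> x \<in> U \<Longrightarrow> c \<le> norm (D n x)"
    by (rule good_nbhd[OF assms]) (rule that)
  have x: "0 < Re x" using assms by simp
  obtain B where B: "B > 0" "\<And>n i j x' y. Re x \<le> Re x' \<Longrightarrow> Re x \<le> Re y \<Longrightarrow> norm (N n i j x' y) \<le> B"
    by (rule D_N_bounded[OF x]) (rule that)
  have W: "norm (W n i j x y) \<le> B / c + 1" if "n \<ge> n0" "Re x \<le> Re y" for n i j y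
  proof -
    have "norm (N n i j x y / D n x) \<le> B / c"
      unfolding norm_divide using B U(6) U(8)[OF that(1) U(2)] that by (intro frac_le) auto
    then show ?thesis unfolding W_def using norm_triangle_ineq4[of "N n i j x y / D n x" 1] by simp
  qed
  show ?thesis
  proof (rule that[of "B / c + 1" n0])
    show "norm (Winf i j x y) \<le> B / c + 1" if "Re x \<le> Re y" for i j y
    proof (rule tendsto_upperbound[OF tendsto_norm[OF W_lim[OF assms]]])
      show "0 < Re y" using x that by simp
      show "\<forall>\<^sub>F n in sequentially. norm (W n i j x y) \<le> B / c + 1"
        using eventually_ge_at_top[of n0] by eventually_elim (rule W[OF _ that])
    qed simp
    show "D n x \<noteq> 0" if "n \<ge> n0" for n using U(8)[OF that U(2)] U(6) by auto
  qed (use W B U(6) in auto)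
qed

text \<open>Dominated convergence: \<open>W\<close> is bounded on \<open>(x,\<infinity>)\<close> uniformly in the truncation, because the bounds on
  determinants are, and the truncated kernels decay exponentially.\<close>
theorem GL:
  assumes "of_real x \<in> good" "0 < y"
  shows "set_integrable lborel {x<..} (\<lambda>s. \<Sum>j\<in>UNIV. \<Sum>k\<in>UNIV. Winf i j (of_real x) (of_real s) * S j k * Psi k l (s + y))" (is ?int)
    "Winf i l (of_real x) (of_real y) + Psi i l (x + y) +
      (LINT s:{x<..}|lborel. \<Sum>j\<in>UNIV. \<Sum>k\<in>UNIV. Winf i j (of_real x) (of_real s) * S j k * Psi k l (s + y)) = 0" (is ?eq)
proof -
  have x: "0 < x" using assms by simp
  obtain B n0 where B: "B \<ge> 0" "\<And>n. n \<ge> n0 \<Longrightarrow> D n (of_real x) \<noteq> 0"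
    "\<And>n i j y. n \<ge> n0 \<Longrightarrow> Re (of_real x) \<le> Re y \<Longrightarrow> norm (W n i j (of_real x) y) \<le> B"
    by (rule W_bounded[OF assms(1)]) (rule that)
  obtain P where P: "P \<ge> 0" "\<And>n k j s. 0 \<le> s \<Longrightarrow> norm (Psi_fin n k j (s + y)) \<le> P * exp (- (lam0 * s))"
    by (rule Psi_fin_bound[OF assms(2)]) (rule that)
  define f where "f s = indicator {x<..} s *\<^sub>R (\<Sum>j\<in>UNIV. \<Sum>k\<in>UNIV. Winf i j (of_real x) (of_real s) * S j k * Psi k l (s + y))" for s
  define F where "F n s = indicator {x<..} s *\<^sub>R (\<Sum>j\<in>UNIV. \<Sum>k\<in>UNIV. W (n + n0) i j (of_real x) (of_real s) * S j k * Psi_fin (n + n0) k l (s + y))" for n s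
  define c where "c = (\<Sum>j\<in>UNIV. \<Sum>k\<in>UNIV. B * norm (S j k) * P)"
  have FI: "has_bochner_integral lborel (F n) (- Psi_fin (n + n0) i l (x + y) - W (n + n0) i l (of_real x) (of_real y))" for n
    unfolding F_def by (rule GL_finite) (simp add: B(2))
  have Fm: "F n \<in> borel_measurable lborel" for n using FI by (rule borel_measurable_has_bochner_integral)
  have lim: "(\<lambda>n. F n s) \<longlonglongrightarrow> f s" for s
  proof (cases "x < s")
    case True
    have W': "(\<lambda>n. W (n + n0) i j (of_real x) (of_real s)) \<longlonglongrightarrow> Winf i j (of_real x) (of_real s)" for j
      using W_lim[OF assms(1), of "of_real s"] True x by (intro LIMSEQ_ignore_initial_segment) auto
    have P': "(\<lambda>n. Psi_fin (n + n0) k l (s + y)) \<longlonglongrightarrow> Psi k l (s + y)" for k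
      using True x assms(2) by (intro LIMSEQ_ignore_initial_segment Psi_fin_lim) auto
    show ?thesis unfolding F_def f_def by (intro tendsto_intros W' P')
  qed (simp add: F_def f_def)
  have fm: "f \<in> borel_measurable lborel"
    by (rule borel_measurable_LIMSEQ_metric[OF Fm lim])
  have wI: "integrable lborel (\<lambda>s. c * (indicator {x<..} s * exp (- (lam0 * s))))"
    using has_bochner_integral_exp_tail[OF lam0, of x] by (intro integrable_mult_right) (auto simp: has_bochner_integral_iff)
  have bd: "norm (F n s) \<le> c * (indicator {x<..} s * exp (- (lam0 * s)))" for n s
  proof (cases "x < s")
    case True
    have "norm (F n s) \<le> (\<Sum>j\<in>UNIV. \<Sum>k\<in>UNIV. B * norm (S j k) * (P * exp (- (lam0 * s))))"
      unfolding F_def using True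
      by (simp del: of_real_add)
         (intro sum_norm_le order.trans[OF norm_mult_ineq] mult_mono, (use B x P in \<open>auto simp: norm_mult intro!: mult_right_mono\<close>))
    also have "\<dots> = c * exp (- (lam0 * s))" unfolding c_def sum_distrib_right by (simp add: mult_ac)
    finally show ?thesis using True by simp
  qed (simp add: F_def)
  have fI: "integrable lborel f"
    by (rule integrable_dominated_convergence[where s=F, OF fm Fm wI]) (use lim bd in auto)
  have fL: "(\<lambda>n. integral\<^sup>L lborel (F n)) \<longlonglongrightarrow> integral\<^sup>L lborel f"
    by (rule integral_dominated_convergence[where s=F, OF fm Fm wI]) (use lim bd in auto)
  show ?int using fI unfolding set_integrable_def f_def .
  have "(\<lambda>n. - Psi_fin (n + n0) i l (x + y) - W (n + n0) i l (of_real x) (of_real y)) \<longlonglongrightarrow>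
     - Psi i l (x + y) - Winf i l (of_real x) (of_real y)"
    using x assms by (intro tendsto_intros LIMSEQ_ignore_initial_segment Psi_fin_lim W_lim) auto
  with fL have "integral\<^sup>L lborel f = - Psi i l (x + y) - Winf i l (of_real x) (of_real y)"
    using FI by (simp add: has_bochner_integral_iff LIMSEQ_unique)
  then show ?eq unfolding set_lebesgue_integral_def f_def by simp
qed

end

section \<open>The doubled exponential system of the symbol\<close>

lemma norm_vector_scalar_mult_complex: "norm (c *s v) = norm c * norm (v :: complex^'n)"
  unfolding norm_vec_def by (simp add: norm_mult L2_set_right_distrib)

lemma bounded_bilinear_vector_scalar_mult: "bounded_bilinear (\<lambda>(c::complex) (v::complex^'n). c *s v)"
  by (rule bounded_bilinear.intro)
    (auto simp: vec_eq_iff algebra_simps norm_vector_scalar_mult_complex intro!: exI[of _ 1])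

lemma exp_of_real_mult: "exp (- (complex_of_real a * of_real t)) = of_real (exp (- (a * t)))"
  by (metis exp_of_real of_real_minus of_real_mult)

text \<open>The symbol \<open>\<psi>\<close> with its exponents \<open>\<kappa> + l + 1/2\<close>.\<close>
locale exp_series =
  fixes chi :: "nat \<Rightarrow> complex^'h::finite" and \<kappa> :: real and \<psi> :: "real \<Rightarrow> complex^'h" and \<sigma> :: "complex^'h^'h"
  assumes kpos: "\<kappa> > 0" and chi_summable: "summable (\<lambda>l. norm (chi l))"
    and psi_sums: "t > 0 \<Longrightarrow> (\<lambda>l. exp (- (\<kappa> + real l + 1/2) * t) *\<^sub>R chi l) sums \<psi> t"
begin

definition rate :: "nat \<Rightarrow> real" where "rate l = \<kappa> + real l + 1/2"
definition rate0 :: real where "rate0 = \<kappa> + 1/2"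
definition chi_total :: real where "chi_total = (\<Sum>l. norm (chi l))"
text \<open>The sesquilinear form \<open>x\<^sup>\<dagger> \<sigma> y\<close>.\<close>
definition sform :: "complex^'h \<Rightarrow> complex^'h \<Rightarrow> complex" where "sform x y = dot (conj_vec x) (\<sigma> *v y)"

text \<open>Indices \<open>Inl m\<close> belong to the lower left block \<open>\<psi>\<^sup>\<dagger>\<close> of \<open>\<Psi>\<close>, indices \<open>Inr l\<close> to the upper right block \<open>\<psi>\<close>.\<close>
definition rate_sum :: "nat + nat \<Rightarrow> real" where "rate_sum \<nu> = (case \<nu> of Inl m \<Rightarrow> rate m | Inr l \<Rightarrow> rate l)"
definition row_coef :: "'h + unit \<Rightarrow> nat + nat \<Rightarrow> complex" where
  "row_coef k \<nu> = (case k of Inl a \<Rightarrow> (case \<nu> of Inl m \<Rightarrow> 0 | Inr l \<Rightarrow> chi l $ a)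
     | Inr _ \<Rightarrow> (case \<nu> of Inl m \<Rightarrow> 1 | Inr l \<Rightarrow> 0))"
definition col_coef :: "nat + nat \<Rightarrow> 'h + unit \<Rightarrow> complex" where
  "col_coef \<nu> j = (case \<nu> of Inl m \<Rightarrow> (case j of Inl b \<Rightarrow> cnj (chi m $ b) | Inr _ \<Rightarrow> 0)
     | Inr l \<Rightarrow> (case j of Inl b \<Rightarrow> 0 | Inr _ \<Rightarrow> 1))"
definition sig_ext :: "'h + unit \<Rightarrow> 'h + unit \<Rightarrow> complex" where
  "sig_ext j k = (case j of Inl a \<Rightarrow> (case k of Inl b \<Rightarrow> \<sigma> $ a $ b | Inr _ \<Rightarrow> 0)
     | Inr _ \<Rightarrow> (case k of Inl b \<Rightarrow> 0 | Inr _ \<Rightarrow> 1))"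

lemma rate0_pos: "rate0 > 0" using kpos by (simp add: rate0_def)
lemma rate_ge: "rate0 \<le> rate l" by (simp add: rate_def rate0_def)
lemma rate_pos: "0 < rate l" using rate0_pos rate_ge[of l] by linarith

lemma norm_chi_le: "norm (chi l) \<le> chi_total"
  unfolding chi_total_def using sum_le_suminf[OF chi_summable, of "{l}"] by simp

lemma chi_total_nonneg: "chi_total \<ge> 0" using norm_chi_le[of 0] norm_ge_zero order.trans by blast

lemma exp_sum_bound:
  assumes "0 < t"
  shows "(\<Sum>l<n. exp (- (t * rate l))) \<le> 1 / (1 - exp (- t))"
proof -
  have "(\<Sum>l<n. exp (- (t * rate l))) \<le> (\<Sum>l<n. exp (- t) ^ l)"
  proof (rule sum_mono)
    fix l
    have "t * real l \<le> t * rate l" using assms kpos by (intro mult_left_mono) (auto simp: rate_def)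
    then show "exp (- (t * rate l)) \<le> exp (- t) ^ l" by (simp add: exp_of_nat_mult[symmetric] mult.commute)
  qed
  also have "\<dots> \<le> (\<Sum>l. exp (- t) ^ l)"
    by (rule sum_le_suminf) (use assms in \<open>auto intro!: summable_geometric\<close>)
  also have "\<dots> = 1 / (1 - exp (- t))" using assms by (intro suminf_geometric) auto
  finally show ?thesis .
qed

lemma expo_lim:
  assumes "0 < t"
  shows "(\<lambda>n. \<Sum>l<n. (chi l $ a) * exp (- (of_real (rate l) * of_real t))) \<longlonglongrightarrow> \<psi> t $ a"
proof -
  have "(\<lambda>n. \<Sum>l<n. exp (- (\<kappa> + real l + 1/2) * t) *\<^sub>R chi l) \<longlonglongrightarrow> \<psi> t"
    using psi_sums[OF assms] by (simp add: sums_def)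
  hence "(\<lambda>n. (\<Sum>l<n. exp (- (\<kappa> + real l + 1/2) * t) *\<^sub>R chi l) $ a) \<longlonglongrightarrow> \<psi> t $ a"
    by (rule tendsto_vec_nth)
  moreover have "(\<Sum>l<n. exp (- (\<kappa> + real l + 1/2) * t) *\<^sub>R chi l) $ a =
    (\<Sum>l<n. (chi l $ a) * exp (- (of_real (rate l) * of_real t)))" for n
    unfolding sum_component exp_of_real_mult
    by (intro sum.cong refl) (simp add: rate_def scaleR_conv_of_real[where 'a=complex] algebra_simps)
  ultimately show ?thesis by simp
qed

sublocale K: exp_kernel "\<lambda>n. {..<n} <+> {..<n}" rate_sum row_coef col_coef sig_ext rate0 "max 1 chi_total"
proof
  show "finite ({..<n} <+> {..<n})" for n :: nat by simp
  show "{..<m} <+> {..<m} \<subseteq> {..<n} <+> {..<n}" if "m \<le> n" for m n :: nat using that by auto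
  show "rate0 > 0" by (rule rate0_pos)
  show "rate0 \<le> rate_sum \<nu>" for \<nu> by (auto simp: rate_sum_def rate_ge split: sum.split)
  have c: "norm (chi l $ a) \<le> max 1 chi_total" for l a
    using norm_chi_le[of l] Finite_Cartesian_Product.norm_nth_le[of "chi l" a] by linarith
  show "norm (row_coef k \<nu>) \<le> max 1 chi_total" for k \<nu> using c by (auto simp: row_coef_def split: sum.split)
  show "norm (col_coef \<nu> k) \<le> max 1 chi_total" for k \<nu> using c by (auto simp: col_coef_def split: sum.split)
  show "\<exists>B. \<forall>n. (\<Sum>\<nu>\<in>{..<n} <+> {..<n}. exp (- (t * rate_sum \<nu>))) \<le> B" if "0 < t" for t
  proof (intro exI allI)
    show "(\<Sum>\<nu>\<in>{..<n} <+> {..<n}. exp (- (t * rate_sum \<nu>))) \<le> 1 / (1 - exp (- t)) + 1 / (1 - exp (- t))" for n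
      unfolding sum.Plus[OF finite_lessThan finite_lessThan]
      by (simp only: rate_sum_def comp_def sum.case) (intro add_mono exp_sum_bound that)
  qed
qed

sublocale GL: exp_kernel_sum "\<lambda>n. {..<n} <+> {..<n}" rate_sum row_coef col_coef sig_ext rate0 "max 1 chi_total" "\<lambda>k j t. Psi \<psi> t $ k $ j"
proof
  fix t :: real and k j :: "'h + unit" assume t: "0 < t"
  have cnj_lim: "(\<lambda>n. \<Sum>l<n. cnj (chi l $ a) * exp (- (of_real (rate l) * of_real t))) \<longlonglongrightarrow> cnj (\<psi> t $ a)" for a
  proof -
    have "(\<lambda>n. cnj (\<Sum>l<n. (chi l $ a) * exp (- (of_real (rate l) * of_real t)))) \<longlonglongrightarrow> cnj (\<psi> t $ a)"
      by (intro tendsto_cnj expo_lim t)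
    then show ?thesis by (simp add: cnj_sum exp_cnj)
  qed
  show "(\<lambda>n. \<Sum>\<nu>\<in>{..<n} <+> {..<n}. row_coef k \<nu> * col_coef \<nu> j * K.expo \<nu> (of_real t)) \<longlonglongrightarrow> Psi \<psi> t $ k $ j"
    unfolding sum.Plus[OF finite_lessThan finite_lessThan]
    using expo_lim[OF t] cnj_lim
    by (auto simp: row_coef_def col_coef_def K.expo_def rate_sum_def Psi_def bmat_def conj_vec_def split: sum.split)
qed

lemma G_eq:
  "K.G (Inl m) (Inr l) = sform (chi m) (chi l)" "K.G (Inr m) (Inl l) = 1"
  "K.G (Inl m) (Inl l) = 0" "K.G (Inr m) (Inr l) = 0"
proof -
  have U: "(\<Sum>k\<in>(UNIV :: ('h + unit) set). f k) = (\<Sum>a\<in>UNIV. f (Inl a)) + f (Inr ())" for f :: "'h + unit \<Rightarrow> complex"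
    unfolding UNIV_Plus_UNIV[symmetric] by (subst sum.Plus) (auto simp: UNIV_unit)
  show "K.G (Inl m) (Inr l) = sform (chi m) (chi l)"
    by (simp add: K.G_def K.CS_def U row_coef_def col_coef_def sig_ext_def sform_def dot_def conj_vec_def matrix_vector_mult_def
        sum_distrib_left sum_distrib_right mult.assoc) (rule sum.swap)
  show "K.G (Inr m) (Inl l) = 1" "K.G (Inl m) (Inl l) = 0" "K.G (Inr m) (Inr l) = 0"
    by (simp_all add: K.G_def K.CS_def U row_coef_def col_coef_def sig_ext_def)
qed

text \<open>The number \<open>\<integral>\<^sub>x\<^sup>\<infinity> exp(-(\<lambda>\<^sub>i + \<lambda>\<^sub>j) s) ds\<close>.\<close>
definition gram :: "nat \<Rightarrow> nat \<Rightarrow> real \<Rightarrow> real" where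
  "gram i j x = exp (- ((rate i + rate j) * x)) / (rate i + rate j)"

text \<open>The matrix \<open>R E\<close> of size \<open>n\<close> left after eliminating one half of the doubled system.\<close>
definition RE_fin :: "nat \<Rightarrow> real \<Rightarrow> nat \<Rightarrow> nat \<Rightarrow> complex" where
  "RE_fin n x i k = (\<Sum>j<n. sform (chi i) (chi j) * of_real (gram i j x) * of_real (gram j k x))"

lemma D_eq: "K.D n (of_real x) = det_id_minus {..<n} (RE_fin n x)"
proof -
  have E: "K.E \<nu> \<mu> (of_real x) = of_real (exp (- ((rate_sum \<nu> + rate_sum \<mu>) * x)) / (rate_sum \<nu> + rate_sum \<mu>))" for \<nu> \<mu>
    unfolding K.E_def K.expo_def exp_of_real_mult
    unfolding of_real_mult[symmetric] exp_add[symmetric] of_real_divide[symmetric]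
    by (simp add: algebra_simps)
  have "K.D n (of_real x) = det_id_minus ({..<n} <+> {..<n}) (\<lambda>i j. case i of
      Inl a \<Rightarrow> (case j of Inl b \<Rightarrow> 0 | Inr b \<Rightarrow> - (sform (chi a) (chi b) * of_real (gram a b x)))
      | Inr a \<Rightarrow> (case j of Inl b \<Rightarrow> - of_real (gram a b x) | Inr b \<Rightarrow> 0))"
    unfolding K.D_def
    by (rule det_id_minus_cong) (auto simp: K.M_def E G_eq rate_sum_def gram_def split: sum.split)
  also have "\<dots> = det_id_minus {..<n} (RE_fin n x)"
    unfolding det_id_minus_block RE_fin_def ..
  finally show ?thesis .
qed

end

section \<open>The kernel of the operator in the tau function\<close>

context exp_series begin

lemma sform_bilinear: "bounded_bilinear sform"
proof (rule bounded_bilinear.intro)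
  show "sform (a + a') b = sform a b + sform a' b" "sform a (b + b') = sform a b + sform a b'"
    "sform (r *\<^sub>R a) b = r *\<^sub>R sform a b" "sform a (r *\<^sub>R b) = r *\<^sub>R sform a b" for a a' b b' r
    by (simp_all add: sform_def dot_def conj_vec_def matrix_vector_mult_def algebra_simps sum.distrib
        scaleR_conv_of_real[where 'a=complex] sum_distrib_left scaleR_sum_right)
  show "\<exists>K. \<forall>a b. norm (sform a b) \<le> norm a * norm b * K"
  proof (intro exI allI)
    fix a b :: "complex^'h"
    have "norm (sform a b) \<le> (\<Sum>i\<in>UNIV. norm a * (\<Sum>j\<in>UNIV. norm (\<sigma> $ i $ j) * norm b))"
      unfolding sform_def dot_def conj_vec_def matrix_vector_mult_def
      by (auto intro!: sum_norm_le order.trans[OF norm_mult_ineq] mult_mono mult_left_mono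
          Finite_Cartesian_Product.norm_nth_le sum_nonneg simp: norm_mult)
    also have "\<dots> = norm a * norm b * (\<Sum>i\<in>UNIV. \<Sum>j\<in>UNIV. norm (\<sigma> $ i $ j))"
      by (simp add: sum_distrib_left mult_ac)
    finally show "norm (sform a b) \<le> norm a * norm b * (\<Sum>i\<in>UNIV. \<Sum>j\<in>UNIV. norm (\<sigma> $ i $ j))" .
  qed
qed

lemma sform_bound: obtains c0 where "c0 > 0" "\<And>a b. norm (sform a b) \<le> c0 * norm a * norm b"
  using bounded_bilinear.pos_bounded[OF sform_bilinear] by (metis mult.assoc mult.commute)

lemma sform_scale_right: "sform a (c *s b) = c * sform a b"
  by (simp add: sform_def dot_def matrix_vector_mult_def sum_distrib_left mult_ac)

definition psi_fin :: "nat \<Rightarrow> real \<Rightarrow> complex^'h" where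
  "psi_fin n t = (\<Sum>l<n. exp (- (rate l * t)) *\<^sub>R chi l)"

lemma psi_fin_lim: "t > 0 \<Longrightarrow> (\<lambda>n. psi_fin n t) \<longlonglongrightarrow> \<psi> t"
  using psi_sums[of t] by (simp add: sums_def psi_fin_def rate_def algebra_simps)

lemma psi_fin_bound: "t \<ge> 0 \<Longrightarrow> norm (psi_fin n t) \<le> chi_total * exp (- (rate0 * t))"
proof -
  assume t: "t \<ge> 0"
  have "norm (psi_fin n t) \<le> (\<Sum>l<n. exp (- (rate0 * t)) * norm (chi l))"
    unfolding psi_fin_def
    by (rule sum_norm_le) (use t rate_ge in \<open>auto intro!: mult_right_mono\<close>)
  also have "\<dots> = exp (- (rate0 * t)) * (\<Sum>l<n. norm (chi l))" by (simp add: sum_distrib_left)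
  also have "\<dots> \<le> exp (- (rate0 * t)) * chi_total"
    unfolding chi_total_def by (intro mult_left_mono sum_le_suminf chi_summable) auto
  finally show ?thesis by (simp add: mult.commute)
qed

lemma psi_bound: "t > 0 \<Longrightarrow> norm (\<psi> t) \<le> chi_total * exp (- (rate0 * t))"
  by (rule tendsto_upperbound[OF tendsto_norm[OF psi_fin_lim]]) (auto intro!: always_eventually psi_fin_bound)

lemma psi_continuous: "continuous_on {0<..} \<psi>"
proof -
  have "uniform_limit {0<..} (\<lambda>n t. \<Sum>l<n. exp (- (rate l * t)) *\<^sub>R chi l) (\<lambda>t. \<Sum>l. exp (- (rate l * t)) *\<^sub>R chi l) sequentially"
  proof (rule Weierstrass_m_test[OF _ chi_summable])
    fix l t assume "t \<in> {0::real<..}"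
    then have "exp (- (rate l * t)) \<le> 1" using rate_pos[of l] by simp
    then show "norm (exp (- (rate l * t)) *\<^sub>R chi l) \<le> norm (chi l)" by (simp add: mult_left_le_one_le)
  qed
  moreover have eq: "(\<Sum>l. exp (- (rate l * t)) *\<^sub>R chi l) = \<psi> t" if "t \<in> {0<..}" for t
    using psi_sums[of t] that by (simp add: sums_iff rate_def algebra_simps)
  ultimately have "continuous_on {0<..} (\<lambda>t. \<Sum>l. exp (- (rate l * t)) *\<^sub>R chi l)"
    by (intro uniform_limit_theorem) (auto intro!: always_eventually continuous_intros)
  then show ?thesis by (rule continuous_on_eq) (rule eq)
qed

text \<open>Cut off at 0 to have a Borel function on the whole line.\<close>
definition psi0 :: "real \<Rightarrow> complex^'h" where "psi0 t = indicator {0<..} t *\<^sub>R \<psi> t"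

lemma psi0_eq: "t > 0 \<Longrightarrow> psi0 t = \<psi> t" by (simp add: psi0_def)

lemma psi0_measurable [measurable]: "psi0 \<in> borel_measurable borel"
  unfolding psi0_def[abs_def]
  using borel_measurable_continuous_on_indicator[OF _ psi_continuous] by simp

lemma psi0_bound: "t \<ge> 0 \<Longrightarrow> norm (psi0 t) \<le> chi_total * exp (- (rate0 * t))"
  using psi_bound[of t] chi_total_nonneg by (cases "t > 0") (auto simp: psi0_def)

lemma sform_measurable [measurable]:
  assumes [measurable]: "f \<in> borel_measurable Mm" "g \<in> borel_measurable Mm"
  shows "(\<lambda>x. sform (f x) (g x)) \<in> borel_measurable Mm"
proof (rule borel_measurable_continuous_Pair[where H=sform, OF assms])
  show "continuous_on UNIV (\<lambda>x. sform (fst x) (snd x))"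
    by (intro bounded_bilinear.continuous_on[OF sform_bilinear] continuous_intros)
qed

lemma smult_measurable [measurable]:
  fixes g :: "'m \<Rightarrow> complex^'h"
  assumes [measurable]: "f \<in> borel_measurable Mm" "g \<in> borel_measurable Mm"
  shows "(\<lambda>x. f x *s g x) \<in> borel_measurable Mm"
proof (rule borel_measurable_continuous_Pair[where H="\<lambda>c v. c *s v", OF assms])
  show "continuous_on UNIV (\<lambda>x. fst x *s (snd x :: complex^'h))"
    by (intro bounded_bilinear.continuous_on[OF bounded_bilinear_vector_scalar_mult] continuous_intros)
qed

definition hkernel_fin :: "nat \<Rightarrow> real \<Rightarrow> real \<Rightarrow> complex" where
  "hkernel_fin n s t = (\<Sum>i<n. \<Sum>j<n. of_real (exp (- (rate i * s)) * exp (- (rate j * t)) / (rate i + rate j)) * sform (chi i) (chi j))"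

text \<open>The kernel of \<open>\<Gamma>\<^sup>\<dagger> \<sigma> \<Gamma>\<close>.\<close>
definition hkernel :: "real \<Rightarrow> real \<Rightarrow> complex" where
  "hkernel s t = (LINT u:{0<..}|lborel. sform (\<psi> (s + u)) (\<psi> (u + t)))"

lemma hkernel_fin_integral:
  "has_bochner_integral lborel (\<lambda>u. indicator {0<..} u *\<^sub>R sform (psi_fin n (s + u)) (psi_fin n (u + t))) (hkernel_fin n s t)"
proof -
  have 1: "sform (psi_fin n (s + u)) (psi_fin n (u + t)) =
     (\<Sum>i<n. \<Sum>j<n. of_real (exp (- (rate i * s)) * exp (- (rate j * t)) * exp (- ((rate i + rate j) * u))) * sform (chi i) (chi j))" for u
  proof -
    have 1: "sform (psi_fin n (s + u)) (psi_fin n (u + t)) =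
      (\<Sum>i<n. \<Sum>j<n. sform (exp (- (rate i * (s + u))) *\<^sub>R chi i) (exp (- (rate j * (u + t))) *\<^sub>R chi j))"
      unfolding psi_fin_def bounded_bilinear.sum_left[OF sform_bilinear]
      by (intro sum.cong refl) (rule bounded_bilinear.sum_right[OF sform_bilinear])
    have 2: "sform (exp (- (rate i * (s + u))) *\<^sub>R chi i) (exp (- (rate j * (u + t))) *\<^sub>R chi j) =
      of_real (exp (- (rate i * s)) * exp (- (rate j * t)) * exp (- ((rate i + rate j) * u))) * sform (chi i) (chi j)" for i j
    proof -
      have e: "exp (- (rate i * (s + u))) * exp (- (rate j * (u + t))) =
        exp (- (rate i * s)) * exp (- (rate j * t)) * exp (- ((rate i + rate j) * u))"
        unfolding exp_add[symmetric] by (simp add: algebra_simps)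
      show ?thesis
        unfolding e[symmetric] bounded_bilinear.scaleR_left[OF sform_bilinear] bounded_bilinear.scaleR_right[OF sform_bilinear]
        by (simp only: scaleR_conv_of_real of_real_mult mult_ac)
    qed
    show ?thesis unfolding 1 2 ..
  qed
  have "has_bochner_integral lborel (\<lambda>u. \<Sum>i<n. \<Sum>j<n. of_real (exp (- (rate i * s)) * exp (- (rate j * t)) *
      (indicator {0<..} u * exp (- ((rate i + rate j) * u)))) * sform (chi i) (chi j))
    (\<Sum>i<n. \<Sum>j<n. of_real (exp (- (rate i * s)) * exp (- (rate j * t)) * (exp (- ((rate i + rate j) * 0)) / (rate i + rate j))) * sform (chi i) (chi j))"
    using rate_pos
    by (intro has_bochner_integral_sum has_bochner_integral_mult_left has_bochner_integral_of_real
        has_bochner_integral_mult_right has_bochner_integral_exp_tail) (auto intro: add_pos_pos)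
  then show ?thesis
    unfolding 1 hkernel_fin_def by (simp add: scaleR_conv_of_real sum_distrib_left mult_ac)
qed

lemma sform_psi_bound:
  obtains c where "c > 0"
    "\<And>n s t u. 0 \<le> s \<Longrightarrow> 0 \<le> t \<Longrightarrow> 0 \<le> u \<Longrightarrow>
      norm (sform (psi_fin n (s + u)) (psi_fin n (u + t))) \<le> c * exp (- (rate0 * (s + t))) * exp (- ((2 * rate0) * u))"
    "\<And>s t u. 0 \<le> s \<Longrightarrow> 0 \<le> t \<Longrightarrow> 0 \<le> u \<Longrightarrow>
      norm (sform (psi0 (s + u)) (psi0 (u + t))) \<le> c * exp (- (rate0 * (s + t))) * exp (- ((2 * rate0) * u))"
proof -
  obtain c0 where c0: "c0 > 0" "\<And>a b. norm (sform a b) \<le> c0 * norm a * norm b" by (rule sform_bound) (rule that)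
  have *: "norm (sform a b) \<le> (c0 * chi_total * chi_total + 1) * exp (- (rate0 * (s + t))) * exp (- ((2 * rate0) * u))"
    if "norm a \<le> chi_total * exp (- (rate0 * (s + u)))" "norm b \<le> chi_total * exp (- (rate0 * (u + t)))" for a b s t u
  proof -
    have "norm (sform a b) \<le> c0 * norm a * norm b" by (rule c0)
    also have "\<dots> \<le> c0 * (chi_total * exp (- (rate0 * (s + u)))) * (chi_total * exp (- (rate0 * (u + t))))"
      using c0 chi_total_nonneg that by (intro mult_mono) auto
    also have "\<dots> = c0 * chi_total * chi_total * exp (- (rate0 * (s + t))) * exp (- ((2 * rate0) * u))"
      by (simp add: mult_ac exp_add[symmetric]) (simp add: algebra_simps)
    also have "\<dots> \<le> (c0 * chi_total * chi_total + 1) * exp (- (rate0 * (s + t))) * exp (- ((2 * rate0) * u))"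
      by (intro mult_right_mono) auto
    finally show ?thesis .
  qed
  show ?thesis
    by (rule that[of "c0 * chi_total * chi_total + 1"]) (use c0 chi_total_nonneg in \<open>auto intro!: * psi_fin_bound psi0_bound add_nonneg_pos\<close>)
qed

lemma hkernel_psi0: "0 < s \<Longrightarrow> 0 < t \<Longrightarrow> hkernel s t = (LINT u|lborel. indicator {0<..} u *\<^sub>R sform (psi0 (s + u)) (psi0 (u + t)))"
  unfolding hkernel_def set_lebesgue_integral_def
  by (intro Bochner_Integration.integral_cong) (auto simp: indicator_def psi0_eq)

lemma hkernel_lim: assumes "0 < s" "0 < t" shows "(\<lambda>n. hkernel_fin n s t) \<longlonglongrightarrow> hkernel s t"
proof -
  obtain c where c: "c > 0"
    "\<And>n s t u. 0 \<le> s \<Longrightarrow> 0 \<le> t \<Longrightarrow> 0 \<le> u \<Longrightarrow>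
      norm (sform (psi_fin n (s + u)) (psi_fin n (u + t))) \<le> c * exp (- (rate0 * (s + t))) * exp (- ((2 * rate0) * u))"
    by (rule sform_psi_bound) (rule that)
  have "(\<lambda>n. integral\<^sup>L lborel (\<lambda>u. indicator {0<..} u *\<^sub>R sform (psi_fin n (s + u)) (psi_fin n (u + t)))) \<longlonglongrightarrow>
     integral\<^sup>L lborel (\<lambda>u. indicator {0<..} u *\<^sub>R sform (psi0 (s + u)) (psi0 (u + t)))"
  proof (rule integral_dominated_convergence[where w="\<lambda>u. c * exp (- (rate0 * (s + t))) * (indicator {0<..} u * exp (- ((2 * rate0) * u)))"])
    show "integrable lborel (\<lambda>u. c * exp (- (rate0 * (s + t))) * (indicator {0<..} u * exp (- ((2 * rate0) * u))))"
      using has_bochner_integral_exp_tail[of "2 * rate0" 0] rate0_pos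
      by (intro integrable_mult_right) (auto simp: has_bochner_integral_iff)
    show "AE u in lborel. (\<lambda>n. indicator {0<..} u *\<^sub>R sform (psi_fin n (s + u)) (psi_fin n (u + t))) \<longlonglongrightarrow>
       indicator {0<..} u *\<^sub>R sform (psi0 (s + u)) (psi0 (u + t))"
      using assms by (auto intro!: AE_I2 tendsto_scaleR tendsto_const bounded_bilinear.tendsto[OF sform_bilinear] psi_fin_lim
          simp: psi0_eq indicator_def)
    show "AE u in lborel. norm (indicator {0<..} u *\<^sub>R sform (psi_fin n (s + u)) (psi_fin n (u + t))) \<le>
        c * exp (- (rate0 * (s + t))) * (indicator {0<..} u * exp (- ((2 * rate0) * u)))" for n
      using assms c(2)[of s t] by (auto intro!: AE_I2 simp: indicator_def)
    show "(\<lambda>u. indicator {0<..} u *\<^sub>R sform (psi_fin n (s + u)) (psi_fin n (u + t))) \<in> borel_measurable lborel" for n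
      using hkernel_fin_integral by (rule borel_measurable_has_bochner_integral)
  qed measurable
  then show ?thesis using hkernel_fin_integral hkernel_psi0[OF assms] by (simp add: has_bochner_integral_iff)
qed

lemma hkernel_bound:
  obtains c where "c > 0" "\<And>s t n. 0 < s \<Longrightarrow> 0 < t \<Longrightarrow> norm (hkernel_fin n s t) \<le> c * exp (- (rate0 * (s + t)))"
    "\<And>s t. 0 < s \<Longrightarrow> 0 < t \<Longrightarrow> norm (hkernel s t) \<le> c * exp (- (rate0 * (s + t)))"
proof -
  obtain c where c: "c > 0"
    "\<And>n s t u. 0 \<le> s \<Longrightarrow> 0 \<le> t \<Longrightarrow> 0 \<le> u \<Longrightarrow>
      norm (sform (psi_fin n (s + u)) (psi_fin n (u + t))) \<le> c * exp (- (rate0 * (s + t))) * exp (- ((2 * rate0) * u))"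
    by (rule sform_psi_bound) (rule that)
  have I: "has_bochner_integral lborel (\<lambda>u. indicator {0<..} u * exp (- ((2 * rate0) * u))) (exp (- ((2 * rate0) * 0)) / (2 * rate0))"
    using rate0_pos by (intro has_bochner_integral_exp_tail) auto
  have 1: "norm (hkernel_fin n s t) \<le> c / (2 * rate0) * exp (- (rate0 * (s + t)))" if "0 < s" "0 < t" for n s t
  proof -
    have "norm (hkernel_fin n s t) = norm (integral\<^sup>L lborel (\<lambda>u. indicator {0<..} u *\<^sub>R sform (psi_fin n (s + u)) (psi_fin n (u + t))))"
      using hkernel_fin_integral[of n s t] by (simp add: has_bochner_integral_iff)
    also have "\<dots> \<le> (LINT u|lborel. c * exp (- (rate0 * (s + t))) * (indicator {0<..} u * exp (- ((2 * rate0) * u))))"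
    proof (rule Bochner_Integration.integral_norm_bound_integral)
      show "integrable lborel (\<lambda>u. indicator {0<..} u *\<^sub>R sform (psi_fin n (s + u)) (psi_fin n (u + t)))"
        using hkernel_fin_integral by (auto simp: has_bochner_integral_iff)
      show "integrable lborel (\<lambda>u. c * exp (- (rate0 * (s + t))) * (indicator {0<..} u * exp (- ((2 * rate0) * u))))"
        using I by (intro integrable_mult_right) (auto simp: has_bochner_integral_iff)
    qed (use c(2)[of s t] that in \<open>auto simp: indicator_def\<close>)
    also have "\<dots> = c / (2 * rate0) * exp (- (rate0 * (s + t)))"
      using I by (simp add: has_bochner_integral_iff)
    finally show ?thesis .
  qed
  show ?thesis
  proof (rule that[of "c / (2 * rate0)"])
    show "norm (hkernel s t) \<le> c / (2 * rate0) * exp (- (rate0 * (s + t)))" if "0 < s" "0 < t" for s t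
      by (rule tendsto_upperbound[OF tendsto_norm[OF hkernel_lim[OF that]]])
        (use 1[OF that] in \<open>simp_all only: eventually_True trivial_limit_sequentially not_False_eq_True\<close>)
  qed (use 1 c rate0_pos in auto)
qed

text \<open>Dominated convergence along sequences, using continuity of \<open>\<psi>\<close> on \<open>(0,\<infinity>)\<close>.\<close>
lemma hkernel_continuous: "continuous_on ({0<..} \<times> {0<..}) (\<lambda>(s, t). hkernel s t)"
  unfolding continuous_on_sequentially
proof (intro allI ballI impI)
  fix p :: "nat \<Rightarrow> real \<times> real" and a :: "real \<times> real"
  assume a: "a \<in> {0<..} \<times> {0<..}" and p: "(\<forall>n. p n \<in> {0<..} \<times> {0<..}) \<and> p \<longlonglongrightarrow> a"
  define s t where "s = fst a" and "t = snd a"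
  have st: "0 < s" "0 < t" using a by (auto simp: s_def t_def)
  define S T where "S n = fst (p n)" and "T n = snd (p n)" for n
  have ST: "0 < S n" "0 < T n" for n using p by (auto simp: S_def T_def mem_Times_iff)
  have lim: "S \<longlonglongrightarrow> s" "T \<longlonglongrightarrow> t" unfolding S_def[abs_def] T_def[abs_def] s_def t_def
    using p by (auto intro: tendsto_fst tendsto_snd)
  obtain c where c: "c > 0"
    "\<And>s t u. 0 \<le> s \<Longrightarrow> 0 \<le> t \<Longrightarrow> 0 \<le> u \<Longrightarrow>
      norm (sform (psi0 (s + u)) (psi0 (u + t))) \<le> c * exp (- (rate0 * (s + t))) * exp (- ((2 * rate0) * u))"
    by (rule sform_psi_bound) (rule that)
  have ct: "isCont \<psi> r" if "0 < r" for r
    using psi_continuous that by (simp add: continuous_on_eq_continuous_at)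
  have "(\<lambda>n. integral\<^sup>L lborel (\<lambda>u. indicator {0<..} u *\<^sub>R sform (psi0 (S n + u)) (psi0 (u + T n)))) \<longlonglongrightarrow>
     integral\<^sup>L lborel (\<lambda>u. indicator {0<..} u *\<^sub>R sform (psi0 (s + u)) (psi0 (u + t)))"
  proof (rule integral_dominated_convergence[where w="\<lambda>u. c * (indicator {0<..} u * exp (- ((2 * rate0) * u)))"])
    show "integrable lborel (\<lambda>u. c * (indicator {0<..} u * exp (- ((2 * rate0) * u))))"
      using has_bochner_integral_exp_tail[of "2 * rate0" 0] rate0_pos
      by (intro integrable_mult_right) (auto simp: has_bochner_integral_iff)
    have "(\<lambda>n. indicator {0<..} u *\<^sub>R sform (psi0 (S n + u)) (psi0 (u + T n))) \<longlonglongrightarrow>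
       indicator {0<..} u *\<^sub>R sform (psi0 (s + u)) (psi0 (u + t))" for u
    proof (cases "0 < u")
      case True
      have "(\<lambda>n. sform (\<psi> (S n + u)) (\<psi> (u + T n))) \<longlonglongrightarrow> sform (\<psi> (s + u)) (\<psi> (u + t))"
        by (intro bounded_bilinear.tendsto[OF sform_bilinear] isCont_tendsto_compose[OF ct] tendsto_intros lim)
          (use True st in auto)
      then show ?thesis using True ST st by (simp add: psi0_eq add_pos_pos)
    qed simp
    then show "AE u in lborel. (\<lambda>n. indicator {0<..} u *\<^sub>R sform (psi0 (S n + u)) (psi0 (u + T n))) \<longlonglongrightarrow>
       indicator {0<..} u *\<^sub>R sform (psi0 (s + u)) (psi0 (u + t))" by simp
    have "norm (indicator {0<..} u *\<^sub>R sform (psi0 (S n + u)) (psi0 (u + T n))) \<le>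
        c * (indicator {0<..} u * exp (- ((2 * rate0) * u)))" for n u
    proof (cases "0 < u")
      case True
      have "norm (sform (psi0 (S n + u)) (psi0 (u + T n))) \<le> c * exp (- (rate0 * (S n + T n))) * exp (- ((2 * rate0) * u))"
        using c(2)[of "S n" "T n" u] ST[of n] True by auto
      also have "\<dots> \<le> c * 1 * exp (- ((2 * rate0) * u))"
        using c(1) ST[of n] rate0_pos by (intro mult_right_mono mult_left_mono) auto
      finally show ?thesis using True by simp
    qed simp
    then show "AE u in lborel. norm (indicator {0<..} u *\<^sub>R sform (psi0 (S n + u)) (psi0 (u + T n))) \<le>
        c * (indicator {0<..} u * exp (- ((2 * rate0) * u)))" for n by simp
  qed measurable
  hence "(\<lambda>n. hkernel (S n) (T n)) \<longlonglongrightarrow> hkernel s t" using ST st by (simp add: hkernel_psi0)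
  then show "((\<lambda>(s, t). hkernel s t) \<circ> p) \<longlonglongrightarrow> (\<lambda>(s, t). hkernel s t) a"
    by (simp add: S_def T_def s_def t_def comp_def case_prod_beta)
qed

end

text \<open>Test the difference \<open>d(z)\<close> of two kernels at a fixed \<open>x\<close> against its own conjugate, restricted to a compact
  interval around \<open>y\<close>: the integral of \<open>|d|\<^sup>2\<close> vanishes, hence \<open>d\<close> does by continuity.\<close>
lemma has_kernel_unique:
  assumes k: "has_kernel T k" and l: "has_kernel T l" and xy: "0 < x" "0 < y"
  shows "k x y = l x y"
proof -
  define d where "d z = k x z - l x z" for z
  define a b where "a = y / 2" and "b = 2 * y"
  have ab: "0 < a" "a < y" "y < b" using xy by (auto simp: a_def b_def)
  have cont: "continuous_on {0<..} d"
  proof -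
    have "continuous_on {0<..} (\<lambda>z. (\<lambda>(s, t). q s t) (x, z))" if "has_kernel T q" for q
      by (rule continuous_on_compose2[where g="\<lambda>(s, t). q s t" and t="{0<..} \<times> {0<..}"])
        (use that xy in \<open>auto simp: has_kernel_def intro!: continuous_intros\<close>)
    from this[OF k] this[OF l] show ?thesis unfolding d_def by (auto intro!: continuous_intros)
  qed
  have cab: "continuous_on {a..b} d" using cont by (rule continuous_on_subset) (use ab in auto)
  define f where "f z = indicator {a..b} z *\<^sub>R cnj (d z)" for z
  have fm: "f \<in> borel_measurable borel"
    unfolding f_def[abs_def]
    by (rule borel_measurable_continuous_on_indicator) (auto intro!: continuous_intros cab)
  have I2: "integrable lborel (\<lambda>z. indicator {a..b} z *\<^sub>R (cmod (d z))\<^sup>2)"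
    by (rule borel_integrable_compact) (auto intro!: continuous_intros cab)
  have L2: "in_L2 f"
    unfolding in_L2_def
  proof (intro conjI fm)
    have "integrable lborel (\<lambda>z. indicator {0<..} z *\<^sub>R (cmod (f z))\<^sup>2)"
    proof (rule Bochner_Integration.integrable_bound[OF I2])
      show "(\<lambda>z. indicator {0<..} z *\<^sub>R (cmod (f z))\<^sup>2) \<in> borel_measurable lborel"
        using fm by measurable
    qed (auto simp: f_def indicator_def)
    then show "set_integrable lborel {0<..} (\<lambda>x. (cmod (f x))\<^sup>2)" by (simp add: set_integrable_def)
  qed
  have kf: "set_integrable lborel {0<..} (\<lambda>z. k x z * f z)" "T f x = (LINT z:{0<..}|lborel. k x z * f z)"
    using k L2 xy by (auto simp: has_kernel_def)
  have lf: "set_integrable lborel {0<..} (\<lambda>z. l x z * f z)" "T f x = (LINT z:{0<..}|lborel. l x z * f z)"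
    using l L2 xy by (auto simp: has_kernel_def)
  have "(LINT z:{0<..}|lborel. k x z * f z - l x z * f z) = 0"
    using set_integral_diff(2)[OF kf(1) lf(1)] kf(2) lf(2) by simp
  moreover have "(LINT z:{0<..}|lborel. k x z * f z - l x z * f z) =
     (LINT z|lborel. of_real (indicator {a..b} z *\<^sub>R (cmod (d z))\<^sup>2))"
    unfolding set_lebesgue_integral_def
    by (intro Bochner_Integration.integral_cong)
      (use ab in \<open>auto simp: f_def indicator_def left_diff_distrib[symmetric] d_def[symmetric] complex_norm_square[symmetric]\<close>)
  ultimately have "(LINT z|lborel. indicator {a..b} z *\<^sub>R (cmod (d z))\<^sup>2) = 0"
    using integral_complex_of_real[of lborel "\<lambda>z. indicator {a..b} z *\<^sub>R (cmod (d z))\<^sup>2"] by simp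
  moreover have "((\<lambda>z. (cmod (d z))\<^sup>2) has_integral (LINT z:{a..b}|lborel. (cmod (d z))\<^sup>2)) {a..b}"
    using set_borel_integral_eq_integral[of "{a..b}" "\<lambda>z. (cmod (d z))\<^sup>2"] I2
    by (auto simp: set_integrable_def intro: integrable_integral)
  ultimately have "((\<lambda>z. (cmod (d z))\<^sup>2) has_integral 0) (cbox a b)"
    by (simp add: set_lebesgue_integral_def)
  hence "(cmod (d y))\<^sup>2 = 0"
    by (rule has_integral_0_cbox_imp_0[rotated 2]) (use ab cab in \<open>auto intro!: continuous_intros\<close>)
  then show ?thesis by (simp add: d_def)
qed

context exp_series begin

definition tau_op :: "(real \<Rightarrow> complex) \<Rightarrow> real \<Rightarrow> complex" where
  "tau_op f = hankel_adj \<psi> (\<lambda>s. \<sigma> *v hankel \<psi> f s)"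

lemma L2_exp_integrable:
  assumes "in_L2 f"
  shows "integrable lborel (\<lambda>y. indicator {0<..} y * (norm (f y) * exp (- (rate0 * y))))"
proof (rule Bochner_Integration.integrable_bound)
  have fm[measurable]: "f \<in> borel_measurable borel" using assms by (simp add: in_L2_def)
  have 1: "integrable lborel (\<lambda>y. indicator {0<..} y *\<^sub>R (cmod (f y))\<^sup>2)"
    using assms by (simp add: in_L2_def set_integrable_def)
  have 2: "integrable lborel (\<lambda>y. indicator {0<..} y * exp (- ((2 * rate0) * y)))"
    using has_bochner_integral_exp_tail[of "2 * rate0" 0] rate0_pos by (auto simp: has_bochner_integral_iff)
  show "integrable lborel (\<lambda>y. indicator {0<..} y *\<^sub>R (cmod (f y))\<^sup>2 + indicator {0<..} y * exp (- ((2 * rate0) * y)))"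
    by (rule Bochner_Integration.integrable_add[OF 1 2])
  show "(\<lambda>y. indicator {0<..} y * (norm (f y) * exp (- (rate0 * y)))) \<in> borel_measurable lborel" by measurable
  have am: "u * v \<le> u\<^sup>2 + v\<^sup>2" if "0 \<le> u" "0 \<le> v" for u v :: real
    using sum_squares_bound[of u v] mult_nonneg_nonneg[OF that] by linarith
  show "AE y in lborel. norm (indicator {0<..} y * (norm (f y) * exp (- (rate0 * y)))) \<le>
      norm (indicator {0<..} y *\<^sub>R (cmod (f y))\<^sup>2 + indicator {0<..} y * exp (- ((2 * rate0) * y)))"
  proof (rule AE_I2)
    fix y :: real
    have e: "(exp (- (rate0 * y)))\<^sup>2 = exp (- ((2 * rate0) * y))" by (simp add: power2_eq_square exp_add[symmetric])
    have "norm (f y) * exp (- (rate0 * y)) \<le> (norm (f y))\<^sup>2 + (exp (- (rate0 * y)))\<^sup>2" by (rule am) auto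
    then show "norm (indicator {0<..} y * (norm (f y) * exp (- (rate0 * y)))) \<le>
      norm (indicator {0<..} y *\<^sub>R (cmod (f y))\<^sup>2 + indicator {0<..} y * exp (- ((2 * rate0) * y)))"
      unfolding e by (auto simp: indicator_def)
  qed
qed

text \<open>Fubini, with the majorant \<open>exp(-2 \<lambda>\<^sub>0 u) |f(y)| exp(-\<lambda>\<^sub>0 y)\<close>.\<close>
lemma hkernel_has_kernel: "has_kernel tau_op hkernel"
  unfolding has_kernel_def
proof (intro conjI hkernel_continuous allI impI)
  fix f and x :: real assume f: "in_L2 f" and x: "0 < x"
  have fm[measurable]: "f \<in> borel_measurable borel" using f by (simp add: in_L2_def)
  obtain c where c: "c > 0"
    "\<And>s t u. 0 \<le> s \<Longrightarrow> 0 \<le> t \<Longrightarrow> 0 \<le> u \<Longrightarrow>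
      norm (sform (psi0 (s + u)) (psi0 (u + t))) \<le> c * exp (- (rate0 * (s + t))) * exp (- ((2 * rate0) * u))"
    by (rule sform_psi_bound) (rule that)
  define a where "a u = indicator {0<..} u * exp (- ((2 * rate0) * u))" for u :: real
  define b where "b y = indicator {0<..} y * (norm (f y) * exp (- (rate0 * y)))" for y
  have aI: "integrable lborel a" unfolding a_def
    using has_bochner_integral_exp_tail[of "2 * rate0" 0] rate0_pos by (auto simp: has_bochner_integral_iff)
  have bI: "integrable lborel b" unfolding b_def by (rule L2_exp_integrable[OF f])
  have [measurable]: "a \<in> borel_measurable borel" "b \<in> borel_measurable borel"
    unfolding a_def[abs_def] b_def[abs_def] by measurable
  define P where "P u y = (indicator {0<..} u * indicator {0<..} y) *\<^sub>R (f y * sform (psi0 (x + u)) (psi0 (u + y)))" for u y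
  have qI: "integrable (lborel \<Otimes>\<^sub>M lborel) (\<lambda>(u, y). c * (a u * b y))"
  proof (rule lborel_pair.Fubini_integrable)
    show "integrable lborel (\<lambda>u. LINT y|lborel. norm (case (u, y) of (u, y) \<Rightarrow> c * (a u * b y)))"
      using aI c(1) by (simp add: abs_mult)
    show "AE u in lborel. integrable lborel (\<lambda>y. case (u, y) of (u, y) \<Rightarrow> c * (a u * b y))"
      using bI by simp
  qed measurable
  have PI: "integrable (lborel \<Otimes>\<^sub>M lborel) (\<lambda>(u, y). P u y)"
  proof (rule Bochner_Integration.integrable_bound[OF qI])
    show "(\<lambda>(u, y). P u y) \<in> borel_measurable (lborel \<Otimes>\<^sub>M lborel)"
      unfolding P_def by measurable
    have "norm (P u y) \<le> c * (a u * b y)" for u y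
    proof (cases "0 < u \<and> 0 < y")
      case True
      have "norm (sform (psi0 (x + u)) (psi0 (u + y))) \<le> c * exp (- (rate0 * (x + y))) * exp (- ((2 * rate0) * u))"
        using c(2)[of x y u] x True by auto
      also have "\<dots> \<le> c * exp (- (rate0 * y)) * exp (- ((2 * rate0) * u))"
        using c(1) x rate0_pos by (intro mult_right_mono mult_left_mono) auto
      finally have "norm (f y) * norm (sform (psi0 (x + u)) (psi0 (u + y))) \<le> norm (f y) * (c * exp (- (rate0 * y)) * exp (- ((2 * rate0) * u)))"
        by (intro mult_left_mono) auto
      then show ?thesis using True by (simp add: P_def a_def b_def norm_mult mult_ac)
    qed (auto simp: P_def a_def b_def)
    then show "AE p in lborel \<Otimes>\<^sub>M lborel. norm (case p of (u, y) \<Rightarrow> P u y) \<le> norm (case p of (u, y) \<Rightarrow> c * (a u * b y))"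
      by (auto intro!: AE_I2 order.trans[OF _ abs_ge_self])
  qed
  \<comment> \<open>the inner integrals in the two orders\<close>
  have in1: "(LINT u|lborel. P u y) = indicator {0<..} y *\<^sub>R (hkernel x y * f y)" for y
  proof (cases "0 < y")
    case True
    have "(LINT u|lborel. P u y) = (LINT u|lborel. (indicator {0<..} u *\<^sub>R sform (psi0 (x + u)) (psi0 (u + y))) * f y)"
      using True by (intro Bochner_Integration.integral_cong) (auto simp: P_def indicator_def)
    also have "\<dots> = (LINT u|lborel. indicator {0<..} u *\<^sub>R sform (psi0 (x + u)) (psi0 (u + y))) * f y"
      by (rule integral_mult_left_zero)
    finally show ?thesis using True hkernel_psi0[OF x True] by simp
  qed (simp add: P_def)
  have in2: "(LINT y|lborel. P u y) = indicator {0<..} u *\<^sub>R sform (\<psi> (x + u)) (hankel \<psi> f u)" for u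
  proof (cases "0 < u")
    case True
    have I: "integrable lborel (\<lambda>y. indicator {0<..} y *\<^sub>R (f y *s psi0 (u + y)))"
    proof (rule Bochner_Integration.integrable_bound)
      show "integrable lborel (\<lambda>y. chi_total * b y)" using bI by simp
      have "norm (indicator {0<..} y *\<^sub>R (f y *s psi0 (u + y))) \<le> chi_total * b y" for y
      proof (cases "0 < y")
        case y: True
        have "norm (psi0 (u + y)) \<le> chi_total * exp (- (rate0 * (u + y)))" using y True by (intro psi0_bound) auto
        also have "\<dots> \<le> chi_total * exp (- (rate0 * y))" using True rate0_pos chi_total_nonneg by (intro mult_left_mono) auto
        finally have "norm (f y) * norm (psi0 (u + y)) \<le> norm (f y) * (chi_total * exp (- (rate0 * y)))"
          by (intro mult_left_mono) auto
        then show ?thesis using y by (simp add: b_def norm_vector_scalar_mult_complex mult_ac)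
      qed (simp add: b_def)
      then show "AE y in lborel. norm (indicator {0<..} y *\<^sub>R (f y *s psi0 (u + y))) \<le> norm (chi_total * b y)"
        by (auto intro!: AE_I2 order.trans[OF _ abs_ge_self])
    qed measurable
    have h: "hankel \<psi> f u = (LINT y|lborel. indicator {0<..} y *\<^sub>R (f y *s psi0 (u + y)))"
      unfolding hankel_def set_lebesgue_integral_def
      by (intro Bochner_Integration.integral_cong) (use True in \<open>auto simp: indicator_def psi0_eq\<close>)
    have "sform (psi0 (x + u)) (hankel \<psi> f u) =
       (LINT y|lborel. sform (psi0 (x + u)) (indicator {0<..} y *\<^sub>R (f y *s psi0 (u + y))))"
      unfolding h by (rule integral_bounded_linear[OF bounded_bilinear.bounded_linear_right[OF sform_bilinear] I, symmetric])
    also have "\<dots> = (LINT y|lborel. P u y)"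
      using True by (intro Bochner_Integration.integral_cong)
        (auto simp: P_def sform_scale_right bounded_bilinear.scaleR_right[OF sform_bilinear])
    finally show ?thesis using True x by (simp add: psi0_eq)
  qed (simp add: P_def)
  have "integrable lborel (\<lambda>y. LINT u|lborel. P u y)"
    by (rule lborel_pair.integrable_snd[OF PI])
  then show "set_integrable lborel {0<..} (\<lambda>y. hkernel x y * f y)"
    unfolding set_integrable_def in1 .
  have "tau_op f x = (LINT u|lborel. LINT y|lborel. P u y)"
    unfolding in2 tau_op_def hankel_adj_def set_lebesgue_integral_def sform_def ..
  also have "\<dots> = (LINT y|lborel. LINT u|lborel. P u y)"
    by (rule lborel_pair.Fubini_integral[OF PI, symmetric])
  finally show "tau_op f x = (LINT y:{0<..}|lborel. hkernel x y * f y)"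
    unfolding set_lebesgue_integral_def in1 .
qed

text \<open>Hence the kernel chosen in the Fredholm determinant is \<open>hkernel\<close>.\<close>
lemma kernel_SOME:
  assumes "0 < x" "0 < y"
  shows "(SOME k. has_kernel tau_op k) x y = hkernel x y"
  by (rule has_kernel_unique[OF someI[of "has_kernel tau_op", OF hkernel_has_kernel] hkernel_has_kernel assms])

end

section \<open>The tau function as an infinite determinant\<close>

text \<open>Multiply out \<open>\<Prod>\<^sub>a \<Sum>\<^sub>i f\<^sub>i(s\<^sub>a) h\<^sub>i(s\<^sub>\<pi>\<^sub>a)\<close> into a sum over tuples \<open>l\<close>. Moving the factors \<open>h\<close> along the permutation
  separates the variables: \<open>s\<^sub>b\<close> only enters through \<open>f\<close> with index \<open>l\<^sub>b\<close> and \<open>h\<close> with index \<open>l\<close> at the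
  preimage of \<open>b\<close>.\<close>
lemma tuple_integral:
  fixes f h :: "nat \<Rightarrow> real \<Rightarrow> complex" and E :: "real set"
  assumes E: "E \<in> sets borel"
    and int: "\<And>i k. i < n \<Longrightarrow> k < n \<Longrightarrow> set_integrable lborel E (\<lambda>t. h i t * f k t)"
  shows "integrable (\<Pi>\<^sub>M i\<in>{..<m}. lborel) (\<lambda>s. indicator ({..<m} \<rightarrow>\<^sub>E E) s *\<^sub>R
      det_on {..<m} (\<lambda>a b. \<Sum>i<n. f i (s a) * h i (s b)))"
    "(LINT s:({..<m} \<rightarrow>\<^sub>E E)|(\<Pi>\<^sub>M i\<in>{..<m}. lborel).
      det_on {..<m} (\<lambda>a b. \<Sum>i<n. f i (s a) * h i (s b))) =
     tuple_sum {..<n} m (\<lambda>i k. LINT t:E|lborel. h i t * f k t)"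
proof -
  interpret product_sigma_finite "\<lambda>_::nat. lborel :: real measure" ..
  define g where "g i k t = indicator E t *\<^sub>R (h i t * f k t)" for i k t
  define Mx where "Mx i k = (LINT t:E|lborel. h i t * f k t)" for i k
  have gI: "integrable lborel (g i k)" if "i < n" "k < n" for i k
    using int[OF that] by (simp add: set_integrable_def g_def[abs_def])
  have ind: "indicator ({..<m} \<rightarrow>\<^sub>E E) s = (\<Prod>b<m. indicator E (s b) :: real)"
    if "s \<in> space (\<Pi>\<^sub>M i\<in>{..<m}. lborel)" for s
    using that by (auto simp: indicator_def space_PiM PiE_iff prod_zero_iff)
  have expand: "indicator ({..<m} \<rightarrow>\<^sub>E E) s *\<^sub>R
      det_on {..<m} (\<lambda>a b. \<Sum>i<n. f i (s a) * h i (s b)) =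
     (\<Sum>\<pi> | \<pi> permutes {..<m}. \<Sum>l\<in>{..<m} \<rightarrow>\<^sub>E {..<n}. of_int (sign \<pi>) * (\<Prod>b<m. g (l (inv_into UNIV \<pi> b)) (l b) (s b)))"
    if s: "s \<in> space (\<Pi>\<^sub>M i\<in>{..<m}. lborel)" for s
    unfolding det_on_def scaleR_sum_right
  proof (intro sum.cong refl)
    fix \<pi> assume "\<pi> \<in> {\<pi>. \<pi> permutes {..<m}}"
    hence p: "\<pi> permutes {..<m}" by simp
    have "(\<Prod>a<m. \<Sum>i<n. f i (s a) * h i (s (\<pi> a))) =
      (\<Sum>l\<in>{..<m} \<rightarrow>\<^sub>E {..<n}. \<Prod>a<m. f (l a) (s a) * h (l a) (s (\<pi> a)))"
      by (rule prod_sum_PiE) auto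
    moreover have "of_real (indicator ({..<m} \<rightarrow>\<^sub>E E) s) * (\<Prod>a<m. f (l a) (s a) * h (l a) (s (\<pi> a))) =
       (\<Prod>b<m. g (l (inv_into UNIV \<pi> b)) (l b) (s b))" for l
    proof -
      have "(\<Prod>a<m. h (l a) (s (\<pi> a))) = (\<Prod>b<m. h (l (inv_into UNIV \<pi> b)) (s b))"
        using prod.permute[OF p, of "\<lambda>b. h (l (inv_into UNIV \<pi> b)) (s b)"] p
        by (simp add: comp_def permutes_inverses(2)[OF p])
      then show ?thesis
        unfolding ind[OF s] by (simp add: g_def prod.distrib scaleR_conv_of_real mult_ac)
    qed
    ultimately show "indicator ({..<m} \<rightarrow>\<^sub>E E) s *\<^sub>R (of_int (sign \<pi>) * (\<Prod>a<m. \<Sum>i<n. f i (s a) * h i (s (\<pi> a)))) =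
      (\<Sum>l\<in>{..<m} \<rightarrow>\<^sub>E {..<n}. of_int (sign \<pi>) * (\<Prod>b<m. g (l (inv_into UNIV \<pi> b)) (l b) (s b)))"
      by (simp only: scaleR_conv_of_real sum_distrib_left[symmetric] mult.left_commute[of _ "of_int (sign \<pi>)"])
        (simp only: sum_distrib_left)
  qed
  \<comment> \<open>indices of the factors stay below \<open>n\<close>\<close>
  have lt: "l (inv_into UNIV \<pi> b) < n" "l b < n" if "\<pi> permutes {..<m}" "l \<in> {..<m} \<rightarrow>\<^sub>E {..<n}" "b < m" for \<pi> l b
    using permutes_in_image[OF permutes_inv[OF that(1)], of b] that by (auto simp: PiE_iff)
  have prodI: "integrable (\<Pi>\<^sub>M i\<in>{..<m}. lborel) (\<lambda>s. \<Prod>b<m. g (l (inv_into UNIV \<pi> b)) (l b) (s b))"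
    "(LINT s|(\<Pi>\<^sub>M i\<in>{..<m}. lborel). (\<Prod>b<m. g (l (inv_into UNIV \<pi> b)) (l b) (s b))) = (\<Prod>b<m. Mx (l (inv_into UNIV \<pi> b)) (l b))"
    if p: "\<pi> permutes {..<m}" and l: "l \<in> {..<m} \<rightarrow>\<^sub>E {..<n}" for \<pi> l
  proof -
    show "integrable (\<Pi>\<^sub>M i\<in>{..<m}. lborel) (\<lambda>s. \<Prod>b<m. g (l (inv_into UNIV \<pi> b)) (l b) (s b))"
      by (rule product_integrable_prod) (use gI lt[OF p l] in auto)
    have "(LINT s|(\<Pi>\<^sub>M i\<in>{..<m}. lborel). (\<Prod>b<m. g (l (inv_into UNIV \<pi> b)) (l b) (s b))) =
       (\<Prod>b<m. integral\<^sup>L lborel (g (l (inv_into UNIV \<pi> b)) (l b)))"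
      by (rule product_integral_prod) (use gI lt[OF p l] in auto)
    then show "(LINT s|(\<Pi>\<^sub>M i\<in>{..<m}. lborel). (\<Prod>b<m. g (l (inv_into UNIV \<pi> b)) (l b) (s b))) = (\<Prod>b<m. Mx (l (inv_into UNIV \<pi> b)) (l b))"
      by (simp add: Mx_def g_def[abs_def] set_lebesgue_integral_def)
  qed
  have I: "integrable (\<Pi>\<^sub>M i\<in>{..<m}. lborel) (\<lambda>s. \<Sum>\<pi> | \<pi> permutes {..<m}. \<Sum>l\<in>{..<m} \<rightarrow>\<^sub>E {..<n}.
      of_int (sign \<pi>) * (\<Prod>b<m. g (l (inv_into UNIV \<pi> b)) (l b) (s b)))"
    by (intro Bochner_Integration.integrable_sum integrable_mult_right prodI) auto
  show "integrable (\<Pi>\<^sub>M i\<in>{..<m}. lborel) (\<lambda>s. indicator ({..<m} \<rightarrow>\<^sub>E E) s *\<^sub>R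
      det_on {..<m} (\<lambda>a b. \<Sum>i<n. f i (s a) * h i (s b)))"
    using I by (simp only: expand cong: Bochner_Integration.integrable_cong)
  have "(LINT s:({..<m} \<rightarrow>\<^sub>E E)|(\<Pi>\<^sub>M i\<in>{..<m}. lborel).
      det_on {..<m} (\<lambda>a b. \<Sum>i<n. f i (s a) * h i (s b))) =
     (LINT s|(\<Pi>\<^sub>M i\<in>{..<m}. lborel). (\<Sum>\<pi> | \<pi> permutes {..<m}. \<Sum>l\<in>{..<m} \<rightarrow>\<^sub>E {..<n}.
      of_int (sign \<pi>) * (\<Prod>b<m. g (l (inv_into UNIV \<pi> b)) (l b) (s b))))"
    unfolding set_lebesgue_integral_def by (rule Bochner_Integration.integral_cong[OF refl expand])
  also have "\<dots> = (\<Sum>\<pi> | \<pi> permutes {..<m}. \<Sum>l\<in>{..<m} \<rightarrow>\<^sub>E {..<n}.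
      of_int (sign \<pi>) * (\<Prod>b<m. Mx (l (inv_into UNIV \<pi> b)) (l b)))"
    by (subst Bochner_Integration.integral_sum)
      (auto intro!: Bochner_Integration.integrable_sum prodI sum.cong simp: Bochner_Integration.integral_sum prodI)
  also have "\<dots> = (\<Sum>\<pi> | \<pi> permutes {..<m}. \<Sum>l\<in>{..<m} \<rightarrow>\<^sub>E {..<n}.
      of_int (sign \<pi>) * (\<Prod>a<m. Mx (l a) (l (\<pi> a))))"
  proof (intro sum.cong refl arg_cong2[where f="(*)"])
    fix \<pi> l assume "\<pi> \<in> {\<pi>. \<pi> permutes {..<m}}"
    hence p: "\<pi> permutes {..<m}" by simp
    show "(\<Prod>b<m. Mx (l (inv_into UNIV \<pi> b)) (l b)) = (\<Prod>a<m. Mx (l a) (l (\<pi> a)))"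
      using prod.permute[OF p, of "\<lambda>b. Mx (l (inv_into UNIV \<pi> b)) (l b)"]
      by (simp add: comp_def permutes_inverses(2)[OF p])
  qed
  also have "\<dots> = tuple_sum {..<n} m Mx" unfolding tuple_sum_def det_on_def by (rule sum.swap)
  finally show "(LINT s:({..<m} \<rightarrow>\<^sub>E E)|(\<Pi>\<^sub>M i\<in>{..<m}. lborel).
      det_on {..<m} (\<lambda>a b. \<Sum>i<n. f i (s a) * h i (s b))) =
     tuple_sum {..<n} m (\<lambda>i k. LINT t:E|lborel. h i t * f k t)" unfolding Mx_def .
qed

context exp_series begin

lemma gram_eq: "gram i j x = exp (- (rate i * x)) * exp (- (rate j * x)) / (rate i + rate j)"
  unfolding gram_def by (simp add: exp_add[symmetric] algebra_simps)

lemma RE_fin_row_bounds: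
  assumes x: "0 < x"
  obtains r B where "\<And>n i. (\<Sum>k<n. norm (RE_fin n x i k)) \<le> r i" "\<And>n. (\<Sum>i<n. r i) \<le> B"
proof -
  obtain c0 where c0: "c0 > 0" "\<And>a b. norm (sform a b) \<le> c0 * norm a * norm b" by (rule sform_bound) (rule that)
  define S where "S = 1 / (1 - exp (- x))"
  define e where "e i = exp (- (x * rate i))" for i
  have S: "(\<Sum>i<n. e i) \<le> S" for n unfolding S_def e_def by (rule exp_sum_bound[OF x])
  have S0: "S \<ge> 0" using S[of 0] by simp
  have e: "0 < e i" "e i \<le> 1" for i using x rate_pos[of i] by (auto simp: e_def)
  define c where "c = c0 * chi_total * chi_total / (2 * rate0) / (2 * rate0)"
  have c: "c \<ge> 0" using c0 chi_total_nonneg rate0_pos by (simp add: c_def)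
  have gram: "0 \<le> gram i j x" "gram i j x \<le> e i * e j / (2 * rate0)" for i j
  proof -
    show "0 \<le> gram i j x" using rate_pos[of i] rate_pos[of j] by (simp add: gram_def)
    show "gram i j x \<le> e i * e j / (2 * rate0)"
      unfolding gram_eq e_def mult.commute[of x]
      using rate_ge[of i] rate_ge[of j] rate0_pos by (intro divide_left_mono) auto
  qed
  have entry: "norm (sform (chi i) (chi j) * of_real (gram i j x) * of_real (gram j k x)) \<le> c * (e i * e j * e k)" for i j k
  proof -
    have "norm (sform (chi i) (chi j)) \<le> c0 * chi_total * chi_total"
      using c0(2)[of "chi i" "chi j"] c0(1) norm_chi_le chi_total_nonneg
      by (intro order.trans[OF c0(2)] mult_mono) auto
    hence "norm (sform (chi i) (chi j)) * gram i j x * gram j k x \<le>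
        (c0 * chi_total * chi_total) * (e i * e j / (2 * rate0)) * (e j * e k / (2 * rate0))"
      using gram e(1) c0 chi_total_nonneg rate0_pos less_imp_le[OF e(1)] by (intro mult_mono) auto
    also have "\<dots> = c * (e i * e j * e k) * e j" by (simp add: c_def)
    also have "\<dots> \<le> c * (e i * e j * e k) * 1"
      using c e less_imp_le[OF e(1)] by (intro mult_left_mono) auto
    finally show ?thesis using gram(1) by (simp add: norm_mult)
  qed
  show ?thesis
  proof (rule that[of "\<lambda>i. c * S * S * e i" "c * S * S * S"])
    show "(\<Sum>k<n. norm (RE_fin n x i k)) \<le> c * S * S * e i" for n i
    proof -
      have "(\<Sum>k<n. norm (RE_fin n x i k)) \<le> (\<Sum>k<n. \<Sum>j<n. c * (e i * e j * e k))"
        unfolding RE_fin_def by (intro sum_mono sum_norm_le entry)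
      also have "\<dots> = c * e i * (\<Sum>j<n. e j) * (\<Sum>k<n. e k)"
        by (simp add: sum_distrib_left sum_distrib_right mult_ac)
      also have "\<dots> \<le> c * e i * S * S"
        using c S S0 less_imp_le[OF e(1)] by (intro mult_mono mult_left_mono) (auto intro!: sum_nonneg)
      finally show ?thesis by (simp add: mult_ac)
    qed
    show "(\<Sum>i<n. c * S * S * e i) \<le> c * S * S * S" for n
      unfolding sum_distrib_left[symmetric] using c S S0 by (intro mult_left_mono) auto
  qed
qed

text \<open>The splitting \<open>exp(-\<lambda>\<^sub>i s) = exp(-\<lambda>\<^sub>i (s - x)) exp(-\<lambda>\<^sub>i x)\<close> of the first variable is chosen so that the
  integrals of \<open>h\<^sub>i f\<^sub>k\<close> over \<open>(2x,\<infinity>)\<close> are the entries of \<open>R E\<close> themselves and not a conjugate matrix.\<close>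
lemma hkernel_fin_tuple_integral:
  fixes x :: real and m n :: nat
  defines "P \<equiv> (\<Pi>\<^sub>M i\<in>{..<m}. lborel :: real measure)"
  shows "integrable P (\<lambda>s. indicator ({..<m} \<rightarrow>\<^sub>E {2*x<..}) s *\<^sub>R
      det_on {..<m} (\<lambda>a b. hkernel_fin n (s a) (s b)))"
    "(LINT s:({..<m} \<rightarrow>\<^sub>E {2*x<..})|P. det_on {..<m} (\<lambda>a b. hkernel_fin n (s a) (s b))) =
      tuple_sum {..<n} m (RE_fin n x)"
proof -
  define f where "f i t = complex_of_real (exp (- (rate i * (t - x))))" for i t
  define h where "h i t = (\<Sum>j<n. of_real (exp (- (rate i * x)) * exp (- (rate j * t)) / (rate i + rate j)) * sform (chi i) (chi j))" for i t
  have k: "hkernel_fin n s t = (\<Sum>i<n. f i s * h i t)" for s t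
    unfolding hkernel_fin_def f_def h_def sum_distrib_left
  proof (intro sum.cong refl)
    fix i j
    have e: "exp (- (rate i * s)) = exp (- (rate i * (s - x))) * exp (- (rate i * x))"
      by (simp add: exp_add[symmetric] algebra_simps)
    show "of_real (exp (- (rate i * s)) * exp (- (rate j * t)) / (rate i + rate j)) * sform (chi i) (chi j) =
      of_real (exp (- (rate i * (s - x)))) *
        (of_real (exp (- (rate i * x)) * exp (- (rate j * t)) / (rate i + rate j)) * sform (chi i) (chi j))"
      unfolding e by simp
  qed
  have I: "has_bochner_integral lborel (\<lambda>t. indicator {2*x<..} t *\<^sub>R (h i t * f k t)) (RE_fin n x i k)" for i k
  proof -
    have "has_bochner_integral lborel
      (\<lambda>t. \<Sum>j<n. of_real (exp (- (rate i * x)) * exp (rate k * x) / (rate i + rate j) *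
          (indicator {2*x<..} t * exp (- ((rate j + rate k) * t)))) * sform (chi i) (chi j))
      (\<Sum>j<n. of_real (exp (- (rate i * x)) * exp (rate k * x) / (rate i + rate j) *
          (exp (- ((rate j + rate k) * (2 * x))) / (rate j + rate k))) * sform (chi i) (chi j))"
      using rate_pos
      by (intro has_bochner_integral_sum has_bochner_integral_mult_left has_bochner_integral_of_real
          has_bochner_integral_mult_right has_bochner_integral_exp_tail) (auto intro: add_pos_pos)
    moreover have "(\<Sum>j<n. of_real (exp (- (rate i * x)) * exp (rate k * x) / (rate i + rate j) *
          (indicator {2*x<..} t * exp (- ((rate j + rate k) * t)))) * sform (chi i) (chi j)) =
       indicator {2*x<..} t *\<^sub>R (h i t * f k t)" for t
      unfolding h_def sum_distrib_right scaleR_sum_right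
    proof (intro sum.cong refl)
      fix j
      have e: "exp (rate k * x) * exp (- ((rate j + rate k) * t)) = exp (- (rate j * t)) * exp (- (rate k * (t - x)))"
        by (simp add: exp_add[symmetric] algebra_simps)
      have "exp (- (rate i * x)) * exp (rate k * x) / (rate i + rate j) * (indicator {2*x<..} t * exp (- ((rate j + rate k) * t))) =
        indicator {2*x<..} t * (exp (- (rate i * x)) / (rate i + rate j) * (exp (rate k * x) * exp (- ((rate j + rate k) * t))))"
        by simp
      also have "\<dots> = indicator {2*x<..} t * (exp (- (rate i * x)) * exp (- (rate j * t)) / (rate i + rate j) * exp (- (rate k * (t - x))))"
        unfolding e by simp
      finally show "of_real (exp (- (rate i * x)) * exp (rate k * x) / (rate i + rate j) *
          (indicator {2*x<..} t * exp (- ((rate j + rate k) * t)))) * sform (chi i) (chi j) =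
        indicator {2*x<..} t *\<^sub>R (of_real (exp (- (rate i * x)) * exp (- (rate j * t)) / (rate i + rate j)) * sform (chi i) (chi j) * f k t)"
        unfolding f_def scaleR_conv_of_real by (simp only: of_real_mult mult_ac)
    qed
    moreover have "(\<Sum>j<n. of_real (exp (- (rate i * x)) * exp (rate k * x) / (rate i + rate j) *
          (exp (- ((rate j + rate k) * (2 * x))) / (rate j + rate k))) * sform (chi i) (chi j)) = RE_fin n x i k"
      unfolding RE_fin_def
    proof (intro sum.cong refl)
      fix j
      have e: "exp (- (rate i * x)) * exp (rate k * x) * exp (- ((rate j + rate k) * (2 * x))) =
         exp (- ((rate i + rate j) * x)) * exp (- ((rate j + rate k) * x))"
        by (simp add: exp_add[symmetric] algebra_simps)
      have "exp (- (rate i * x)) * exp (rate k * x) / (rate i + rate j) * (exp (- ((rate j + rate k) * (2 * x))) / (rate j + rate k)) =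
        (exp (- (rate i * x)) * exp (rate k * x) * exp (- ((rate j + rate k) * (2 * x)))) / (rate i + rate j) / (rate j + rate k)" by simp
      also have "\<dots> = gram i j x * gram j k x" unfolding e gram_def by simp
      finally show "of_real (exp (- (rate i * x)) * exp (rate k * x) / (rate i + rate j) *
          (exp (- ((rate j + rate k) * (2 * x))) / (rate j + rate k))) * sform (chi i) (chi j) =
         sform (chi i) (chi j) * of_real (gram i j x) * of_real (gram j k x)"
        by (simp only: of_real_mult mult_ac)
    qed
    ultimately show ?thesis by simp
  qed
  have si: "set_integrable lborel {2*x<..} (\<lambda>t. h i t * f k t)" for i k
    using I[of i k] by (simp add: set_integrable_def has_bochner_integral_iff)
  have Ie: "(LINT t:{2*x<..}|lborel. h i t * f k t) = RE_fin n x i k" for i k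
    using I[of i k] by (simp add: set_lebesgue_integral_def has_bochner_integral_iff)
  have b: "{2*x<..} \<in> sets borel" by simp
  show "integrable P (\<lambda>s. indicator ({..<m} \<rightarrow>\<^sub>E {2*x<..}) s *\<^sub>R
      det_on {..<m} (\<lambda>a b. hkernel_fin n (s a) (s b)))"
    unfolding P_def k by (rule tuple_integral(1)[OF b si])
  show "(LINT s:({..<m} \<rightarrow>\<^sub>E {2*x<..})|P. det_on {..<m} (\<lambda>a b. hkernel_fin n (s a) (s b))) =
      tuple_sum {..<n} m (RE_fin n x)"
    unfolding P_def k tuple_integral(2)[OF b si] Ie ..
qed

text \<open>Each term of a determinant has every variable once as a first and once as a second argument, so it is
  dominated by a product of \<open>exp(-2 \<lambda>\<^sub>0 s\<^sub>b)\<close>.\<close>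
lemma hkernel_tuple_limit:
  fixes x :: real and m :: nat
  defines "P \<equiv> (\<Pi>\<^sub>M i\<in>{..<m}. lborel :: real measure)"
  assumes x: "0 < x"
  shows "(\<lambda>n. tuple_sum {..<n} m (RE_fin n x)) \<longlonglongrightarrow>
    (LINT s:({..<m} \<rightarrow>\<^sub>E {2*x<..})|P. det_on {..<m} (\<lambda>a b. hkernel (s a) (s b)))"
proof -
  interpret product_sigma_finite "\<lambda>_::nat. lborel :: real measure" ..
  obtain c where c: "c > 0" "\<And>s t n. 0 < s \<Longrightarrow> 0 < t \<Longrightarrow> norm (hkernel_fin n s t) \<le> c * exp (- (rate0 * (s + t)))"
    by (rule hkernel_bound) (rule that)
  let ?A = "{..<m} \<rightarrow>\<^sub>E {2*x<..}"
  define F where "F n s = indicator ?A s *\<^sub>R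
      det_on {..<m} (\<lambda>a b. hkernel_fin n (s a) (s b))" for n s
  define F0 where "F0 s = indicator ?A s *\<^sub>R
      det_on {..<m} (\<lambda>a b. hkernel (s a) (s b))" for s
  define w where "w s = fact m * (\<Prod>b<m. c * (indicator {2*x<..} (s b) * exp (- ((2 * rate0) * s b))))" for s :: "nat \<Rightarrow> real"
  have FI: "integrable P (F n)" for n unfolding F_def P_def by (rule hkernel_fin_tuple_integral)
  have Fm: "F n \<in> borel_measurable P" for n using FI by (rule borel_measurable_integrable)
  have pos: "0 < s a" if "s \<in> ?A" "a < m" for s a
  proof -
    have "s a \<in> {2*x<..}" using that by (auto simp: PiE_iff)
    then show ?thesis using x by simp
  qed
  have perm: "\<pi> a < m" if "\<pi> permutes {..<m}" "a < m" for \<pi> a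
    using permutes_in_image[OF that(1), of a] that(2) by simp
  have lim: "(\<lambda>n. F n s) \<longlonglongrightarrow> F0 s" for s
  proof (cases "s \<in> ?A")
    case True
    have "(\<lambda>n. det_on {..<m} (\<lambda>a b. hkernel_fin n (s a) (s b))) \<longlonglongrightarrow>
      det_on {..<m} (\<lambda>a b. hkernel (s a) (s b))"
      unfolding det_on_def
      by (intro tendsto_sum tendsto_mult tendsto_const tendsto_prod hkernel_lim pos[OF True]) (auto intro: perm)
    then show ?thesis using True by (simp add: F_def F0_def)
  qed (simp add: F_def F0_def)
  have F0m: "F0 \<in> borel_measurable P" by (rule borel_measurable_LIMSEQ_metric[OF Fm lim])
  have wI: "integrable P w"
    unfolding w_def P_def
    using has_bochner_integral_exp_tail[of "2 * rate0" "2 * x"] rate0_pos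
    by (intro integrable_mult_right product_integrable_prod) (auto simp: has_bochner_integral_iff)
  have bd: "norm (F n s) \<le> w s" for n s
  proof (cases "s \<in> ?A")
    case True
    have t: "norm (of_int (sign \<pi>) * (\<Prod>a<m. hkernel_fin n (s a) (s (\<pi> a)))) \<le> (\<Prod>b<m. c * exp (- ((2 * rate0) * s b)))"
      if p: "\<pi> permutes {..<m}" for \<pi>
    proof -
      have "norm (of_int (sign \<pi>) * (\<Prod>a<m. hkernel_fin n (s a) (s (\<pi> a)))) = (\<Prod>a<m. norm (hkernel_fin n (s a) (s (\<pi> a))))"
        by (simp add: norm_mult prod_norm sign_def)
      also have "\<dots> \<le> (\<Prod>a<m. c * exp (- (rate0 * (s a + s (\<pi> a)))))"
        by (intro prod_mono) (auto intro!: c pos[OF True] perm[OF p])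
      also have "\<dots> = (\<Prod>a<m. c * exp (- (rate0 * s a))) * (\<Prod>a<m. exp (- (rate0 * s (\<pi> a))))"
        unfolding prod.distrib[symmetric] by (intro prod.cong refl) (simp add: exp_add[symmetric] algebra_simps)
      also have "(\<Prod>a<m. exp (- (rate0 * s (\<pi> a)))) = (\<Prod>a<m. exp (- (rate0 * s a)))"
        using prod.permute[OF p, of "\<lambda>a. exp (- (rate0 * s a))"] by (simp add: comp_def)
      also have "(\<Prod>a<m. c * exp (- (rate0 * s a))) * (\<Prod>a<m. exp (- (rate0 * s a))) = (\<Prod>b<m. c * exp (- ((2 * rate0) * s b)))"
        unfolding prod.distrib[symmetric] by (intro prod.cong refl) (simp add: exp_add[symmetric] algebra_simps)
      finally show ?thesis .
    qed
    have "norm (F n s) \<le> (\<Sum>\<pi> | \<pi> permutes {..<m}. (\<Prod>b<m. c * exp (- ((2 * rate0) * s b))))"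
      using True unfolding F_def det_on_def by (simp del: sum_constant) (intro sum_norm_le t, auto)
    also have "\<dots> = fact m * (\<Prod>b<m. c * exp (- ((2 * rate0) * s b)))"
      by (simp add: card_permutations)
    also have "\<dots> = w s"
      unfolding w_def using True by (intro arg_cong2[where f="(*)"] refl prod.cong) (auto simp: PiE_iff)
    finally show ?thesis .
  next
    case False
    have "0 \<le> w s" unfolding w_def using c(1) by (intro mult_nonneg_nonneg prod_nonneg) (auto simp: indicator_def)
    then show ?thesis using False by (simp add: F_def)
  qed
  have "(\<lambda>n. integral\<^sup>L P (F n)) \<longlonglongrightarrow> integral\<^sup>L P F0"
    by (rule integral_dominated_convergence[where s=F and w=w, OF F0m Fm wI]) (use lim bd in auto)
  moreover have "integral\<^sup>L P (F n) = tuple_sum {..<n} m (RE_fin n x)" for n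
    using hkernel_fin_tuple_integral(2)[of m x n] unfolding F_def P_def set_lebesgue_integral_def .
  ultimately show ?thesis unfolding F0_def set_lebesgue_integral_def by simp
qed

text \<open>Each coefficient of Fredholm's series is the limit of the coefficients for the truncated kernels, which
  are bounded geometrically and uniformly in the truncation; Tannery's theorem gives the limit of the sums.\<close>
theorem tau_eq:
  assumes x: "0 < x"
  shows "tau \<sigma> \<psi> (2 * x) = K.Dinf (of_real x)"
proof -
  define I where "I m = (LINT s:({..<m} \<rightarrow>\<^sub>E {2*x<..})|(\<Pi>\<^sub>M i\<in>{..<m}. lborel).
    det_on {..<m} (\<lambda>a b. hkernel (s a) (s b)))" for m :: nat
  have tau: "tau \<sigma> \<psi> (2 * x) = (\<Sum>m. (-1) ^ m / fact m * I m)"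
  proof -
    have T: "(\<lambda>f. hankel_adj \<psi> (\<lambda>s. \<sigma> *v hankel \<psi> f s)) = tau_op" by (simp add: tau_op_def[abs_def])
    have "(LINT s:({..<m} \<rightarrow>\<^sub>E {2*x<..})|(\<Pi>\<^sub>M i\<in>{..<m}. lborel).
          (\<Sum>\<pi> | \<pi> permutes {..<m}. of_int (sign \<pi>) * (\<Prod>i<m. (SOME k. has_kernel tau_op k) (s i) (s (\<pi> i))))) = I m" for m
      unfolding I_def set_lebesgue_integral_def
    proof (intro Bochner_Integration.integral_cong refl)
      fix s :: "nat \<Rightarrow> real"
      have "(\<Prod>i<m. (SOME k. has_kernel tau_op k) (s i) (s (\<pi> i))) = (\<Prod>a<m. hkernel (s a) (s (\<pi> a)))"
        if s: "s \<in> {..<m} \<rightarrow>\<^sub>E {2*x<..}" and p: "\<pi> permutes {..<m}" for \<pi>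
      proof (intro prod.cong refl kernel_SOME)
        fix a assume "a \<in> {..<m}"
        have "\<pi> a < m" using permutes_in_image[OF p, of a] \<open>a \<in> {..<m}\<close> by simp
        hence "s a \<in> {2*x<..}" "s (\<pi> a) \<in> {2*x<..}" using s \<open>a \<in> {..<m}\<close> by (auto simp: PiE_iff)
        then show "0 < s a" "0 < s (\<pi> a)" using x by auto
      qed
      then show "indicator ({..<m} \<rightarrow>\<^sub>E {2*x<..}) s *\<^sub>R
         (\<Sum>\<pi> | \<pi> permutes {..<m}. of_int (sign \<pi>) * (\<Prod>i<m. (SOME k. has_kernel tau_op k) (s i) (s (\<pi> i)))) =
         indicator ({..<m} \<rightarrow>\<^sub>E {2*x<..}) s *\<^sub>R
         det_on {..<m} (\<lambda>a b. hkernel (s a) (s b))"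
        by (cases "s \<in> {..<m} \<rightarrow>\<^sub>E {2*x<..}") (auto simp: det_on_def)
    qed
    then show ?thesis unfolding tau_def T fredholm_det_def Let_def by simp
  qed
  obtain r B where rB: "\<And>n i. (\<Sum>k<n. norm (RE_fin n x i k)) \<le> r i" "\<And>n. (\<Sum>i<n. r i) \<le> B"
    by (rule RE_fin_row_bounds[OF x]) (rule that)
  have "(\<lambda>n. \<Sum>m. (-1) ^ m / fact m * tuple_sum {..<n} m (RE_fin n x)) \<longlonglongrightarrow> (\<Sum>m. (-1) ^ m / fact m * I m)"
  proof (rule tannerys_theorem[THEN conjunct2, THEN conjunct2])
    show "(\<lambda>n. (-1) ^ m / fact m * tuple_sum {..<n} m (RE_fin n x)) \<longlonglongrightarrow> (-1) ^ m / fact m * I m" for m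
      unfolding I_def by (intro tendsto_intros hkernel_tuple_limit x)
    have "norm ((-1) ^ m / fact m * tuple_sum {..<n} m (RE_fin n x)) \<le> exp (2 * B) / 2 ^ m" for m n
      by (rule tuple_sum_bound[where r=r]) (use rB in auto)
    then show "\<forall>\<^sub>F (m, n) in sequentially \<times>\<^sub>F sequentially.
      norm ((-1) ^ m / fact m * tuple_sum {..<n} m (RE_fin n x)) \<le> exp (2 * B) / 2 ^ m"
      by (intro always_eventually) auto
    have "summable (\<lambda>m. exp (2 * B) * (1 / 2) ^ m)" by (intro summable_mult summable_geometric) auto
    then show "summable (\<lambda>m. exp (2 * B) / 2 ^ m)" by (simp add: power_divide)
  qed simp
  moreover have "(\<Sum>m. (-1) ^ m / fact m * tuple_sum {..<n} m (RE_fin n x)) = K.D n (of_real x)" for n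
    unfolding D_eq by (rule sums_unique[symmetric]) (rule tuple_sum_sums, simp)
  ultimately have "(\<lambda>n. K.D n (of_real x)) \<longlonglongrightarrow> tau \<sigma> \<psi> (2 * x)" unfolding tau by simp
  moreover have "(\<lambda>n. K.D n (of_real x)) \<longlonglongrightarrow> K.Dinf (of_real x)" by (rule K.D_lim) (use x in simp)
  ultimately show ?thesis by (rule LIMSEQ_unique)
qed

end

section \<open>The solution attached to the symbol\<close>

lemma vec_eq_sum_axis: "(v :: 'a::euclidean_space^'n) = (\<Sum>i\<in>UNIV. axis i (v $ i))"
  by (simp add: vec_eq_iff axis_def sum.delta' cong: if_cong)

lemma bounded_linear_axis: "bounded_linear (axis i :: 'a::euclidean_space \<Rightarrow> 'a^'n)"
  unfolding linear_conv_bounded_linear[symmetric] by (rule linearI) (auto simp: vec_eq_iff axis_def)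

lemma integrable_vec:
  fixes f :: "'m \<Rightarrow> 'a::euclidean_space^'n"
  assumes "\<And>i. integrable Mm (\<lambda>s. f s $ i)"
  shows "integrable Mm f"
proof -
  have "integrable Mm (\<lambda>s. \<Sum>i\<in>UNIV. axis i (f s $ i))"
    by (intro Bochner_Integration.integrable_sum integrable_bounded_linear[OF bounded_linear_axis] assms)
  then show ?thesis by (simp add: vec_eq_sum_axis[symmetric])
qed

lemma has_vector_derivative_vec:
  fixes f :: "real \<Rightarrow> 'a::euclidean_space^'n"
  assumes "\<And>i. ((\<lambda>s. f s $ i) has_vector_derivative f' $ i) F"
  shows "(f has_vector_derivative f') F"
proof -
  have "((\<lambda>s. \<Sum>i\<in>UNIV. axis i (f s $ i)) has_vector_derivative (\<Sum>i\<in>UNIV. axis i (f' $ i))) F"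
    by (intro has_vector_derivative_sum bounded_linear.has_vector_derivative[OF bounded_linear_axis] assms)
  then show ?thesis by (simp add: vec_eq_sum_axis[symmetric])
qed

lemma holomorphic_real_deriv:
  assumes "g holomorphic_on U" "open U" "of_real t \<in> U"
  shows "((\<lambda>t. g (of_real t)) has_vector_derivative deriv g (of_real t)) (at t)"
  by (rule has_vector_derivative_real_field, rule holomorphic_derivI[OF assms])

context exp_series begin

lemma UNIV_plus_unit: "(\<Sum>k\<in>(UNIV :: ('h + unit) set). f k) = (\<Sum>a\<in>UNIV. f (Inl a)) + (f (Inr ()) :: 'c::comm_monoid_add)"
  unfolding UNIV_Plus_UNIV[symmetric] by (subst sum.Plus) (auto simp: UNIV_unit)

definition GL_sol :: "real \<Rightarrow> real \<Rightarrow> 'h bmat" where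
  "GL_sol x y = (\<chi> i j. K.Winf i j (of_real x) (of_real y))"

lemma star_component:
  "star \<sigma> M (Psi \<psi> t) $ i $ l = (\<Sum>j\<in>UNIV. \<Sum>k\<in>UNIV. M $ i $ j * sig_ext j k * Psi \<psi> t $ k $ l)"
  by (cases i; cases l)
    (auto simp: star_def bmat_def block_U_def block_v_def block_r_def block_z_def Psi_def sig_ext_def UNIV_plus_unit
      matrix_vector_mult_def dot_def conj_vec_def sum_distrib_left mult.assoc)

lemma H_component: "H_mat \<sigma> W x $ i $ k = (\<Sum>j\<in>UNIV. W x x $ i $ j * sig_ext j k)"
  by (cases i; cases k)
    (auto simp: H_mat_def bmat_def block_U_def block_v_def block_r_def block_z_def sig_ext_def UNIV_plus_unit
      matrix_matrix_mult_def vector_matrix_mult_def mult.commute)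

lemma good_iff: "0 < x \<Longrightarrow> of_real x \<in> K.good \<longleftrightarrow> tau \<sigma> \<psi> (2 * x) \<noteq> 0"
  by (simp add: tau_eq)

lemma GL_sol_integral_equation:
  assumes x: "of_real x \<in> K.good" and y: "0 < y"
  shows "set_integrable lborel {x<..} (\<lambda>s. star \<sigma> (GL_sol x s) (Psi \<psi> (s + y)))" (is ?I)
    "GL_sol x y + Psi \<psi> (x + y) + (LINT s:{x<..}|lborel. star \<sigma> (GL_sol x s) (Psi \<psi> (s + y))) = 0" (is ?E)
proof -
  have c: "(\<lambda>s. (indicator {x<..} s *\<^sub>R star \<sigma> (GL_sol x s) (Psi \<psi> (s + y))) $ i $ l) =
    (\<lambda>s. indicator {x<..} s *\<^sub>R (\<Sum>j\<in>UNIV. \<Sum>k\<in>UNIV. K.Winf i j (of_real x) (of_real s) * sig_ext j k * Psi \<psi> (s + y) $ k $ l))" for i l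
    by (simp add: star_component GL_sol_def)
  have I: "integrable lborel (\<lambda>s. indicator {x<..} s *\<^sub>R star \<sigma> (GL_sol x s) (Psi \<psi> (s + y)))"
    by (intro integrable_vec) (use GL.GL(1)[OF x y] in \<open>simp only: c set_integrable_def\<close>)
  then show ?I by (simp add: set_integrable_def)
  show ?E
  proof (simp only: vec_eq_iff, intro allI)
    fix i l
    have "(LINT s:{x<..}|lborel. star \<sigma> (GL_sol x s) (Psi \<psi> (s + y))) $ i $ l =
      (LINT s|lborel. (indicator {x<..} s *\<^sub>R star \<sigma> (GL_sol x s) (Psi \<psi> (s + y))) $ i $ l)"
      unfolding set_lebesgue_integral_def
      using integral_bounded_linear[OF bounded_linear_compose[OF bounded_linear_vec_nth[of l] bounded_linear_vec_nth[of i]] I]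
      by simp
    also have "\<dots> = (LINT s:{x<..}|lborel. \<Sum>j\<in>UNIV. \<Sum>k\<in>UNIV. K.Winf i j (of_real x) (of_real s) * sig_ext j k * Psi \<psi> (s + y) $ k $ l)"
      unfolding c set_lebesgue_integral_def ..
    finally show "(GL_sol x y + Psi \<psi> (x + y) + (LINT s:{x<..}|lborel. star \<sigma> (GL_sol x s) (Psi \<psi> (s + y)))) $ i $ l = 0 $ i $ l"
      using GL.GL(2)[OF x y, of i l] by (simp add: GL_sol_def)
  qed
qed

lemma GL_sol_continuous:
  assumes "0 < x"
  shows "continuous_on {0<..} (GL_sol x)"
  unfolding GL_sol_def
proof (intro continuous_on_vec_lambda)
  fix i j
  show "continuous_on {0<..} (\<lambda>y. K.Winf i j (of_real x) (of_real y))"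
    by (rule continuous_on_compose2[OF holomorphic_on_imp_continuous_on[OF K.Winf_holo_y]])
      (use assms in \<open>auto intro!: continuous_intros\<close>)
qed

lemma GL_sol_is_solution:
  assumes "of_real x \<in> K.good"
  shows "GL_solution_at \<sigma> \<psi> GL_sol x"
  unfolding GL_solution_at_def
proof (intro conjI allI impI)
  have x: "0 < x" using assms by simp
  show "continuous_on {x..} (GL_sol x)"
    by (rule continuous_on_subset[OF GL_sol_continuous[OF x]]) (use x in auto)
  fix y assume "x < y"
  hence y: "0 < y" using x by simp
  show "set_integrable lborel {x<..} (\<lambda>s. star \<sigma> (GL_sol x s) (Psi \<psi> (s + y)))"
    "GL_sol x y + Psi \<psi> (x + y) + (LINT s:{x<..}|lborel. star \<sigma> (GL_sol x s) (Psi \<psi> (s + y))) = 0"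
    using GL_sol_integral_equation[OF assms y] .
qed

lemma trace_H: "trace (H_mat \<sigma> GL_sol x) = (\<Sum>i\<in>UNIV. K.Hinf i i (of_real x))"
  unfolding trace_def H_component K.Hinf_def by (simp add: GL_sol_def)

lemma Dinf_real_deriv:
  assumes "of_real x \<in> K.good"
  shows "((\<lambda>x. K.Dinf (of_real x)) has_vector_derivative K.Dinf (of_real x) * trace (H_mat \<sigma> GL_sol x)) (at x)"
  unfolding trace_H by (rule has_vector_derivative_real_field[OF K.log_deriv[OF assms]])

lemma tau_log_derivative:
  assumes "of_real x \<in> K.good"
  shows "has_log_derivative (\<lambda>x. tau \<sigma> \<psi> (2 * x)) (trace (H_mat \<sigma> GL_sol x)) x"
proof -
  have x: "0 < x" using assms by simp
  have "((\<lambda>x. tau \<sigma> \<psi> (2 * x)) has_vector_derivative K.Dinf (of_real x) * trace (H_mat \<sigma> GL_sol x)) (at x)"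
    by (rule has_vector_derivative_transform_within_open[OF Dinf_real_deriv[OF assms], of "{0<..}"])
      (use x tau_eq in auto)
  then show ?thesis
    unfolding has_log_derivative_def using assms by (intro conjI exI) (auto simp: tau_eq x)
qed

lemma tau_at_top: "\<forall>\<^sub>F x in at_top. tau \<sigma> \<psi> (2 * x) \<noteq> 0"
proof -
  have "\<forall>\<^sub>F x in at_top. dist (K.Dinf (of_real x)) 1 < 1"
    using K.Dinf_at_top by (rule tendstoD) simp
  then show ?thesis
    using eventually_gt_at_top[of 0] by eventually_elim (auto simp: tau_eq dist_norm)
qed

text \<open>On the real axis the derivatives are those of the holomorphic extensions.\<close>
lemma GL_sol_pde:
  assumes good: "\<And>x. 0 < x \<Longrightarrow> of_real x \<in> K.good"
  shows "GL_pde GL_sol (H_mat \<sigma> GL_sol)"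
proof -
  define Wx where "Wx x y = (\<chi> i j. deriv (\<lambda>\<xi>. K.Winf i j \<xi> (of_real y)) (of_real x))" for x y :: real
  define Wxx where "Wxx x y = (\<chi> i j. deriv (deriv (\<lambda>\<xi>. K.Winf i j \<xi> (of_real y))) (of_real x))" for x y :: real
  define Wy where "Wy x y = (\<chi> i j. deriv (\<lambda>\<eta>. K.Winf i j (of_real x) \<eta>) (of_real y))" for x y :: real
  define Wyy where "Wyy x y = (\<chi> i j. deriv (deriv (\<lambda>\<eta>. K.Winf i j (of_real x) \<eta>)) (of_real y))" for x y :: real
  define H' where "H' x = (\<chi> i k. deriv (K.Hinf i k) (of_real x))" for x :: real
  have oh: "open {y :: complex. 0 < Re y}" by (rule open_halfspace_Re_gt)
  show ?thesis
    unfolding GL_pde_def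
  proof (rule exI[of _ Wx], rule exI[of _ Wxx], rule exI[of _ Wy], rule exI[of _ Wyy], rule exI[of _ H'],
      intro allI impI conjI)
    fix x y :: real assume xy: "0 < x \<and> x < y"
    hence x: "0 < x" "of_real x \<in> K.good" and y: "0 < Re (complex_of_real y)" "of_real y \<in> {y. 0 < Re y}"
      using good by auto
    have xr: "0 < Re (complex_of_real x)" using x by simp
    show "((\<lambda>\<xi>. GL_sol \<xi> y) has_vector_derivative Wx x y) (at x)"
      by (intro has_vector_derivative_vec)
        (simp add: GL_sol_def Wx_def, rule holomorphic_real_deriv[OF K.Winf_holo_x[OF y(1)] K.open_good x(2)])
    show "((\<lambda>\<xi>. Wx \<xi> y) has_vector_derivative Wxx x y) (at x)"
      by (intro has_vector_derivative_vec)
        (simp add: Wx_def Wxx_def, rule holomorphic_real_deriv[OF holomorphic_deriv[OF K.Winf_holo_x[OF y(1)] K.open_good] K.open_good x(2)])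
    show "((\<lambda>\<eta>. GL_sol x \<eta>) has_vector_derivative Wy x y) (at y)"
      by (intro has_vector_derivative_vec)
        (simp add: GL_sol_def Wy_def, rule holomorphic_real_deriv[OF K.Winf_holo_y[OF xr] oh y(2)])
    show "((\<lambda>\<eta>. Wy x \<eta>) has_vector_derivative Wyy x y) (at y)"
      by (intro has_vector_derivative_vec)
        (simp add: Wy_def Wyy_def, rule holomorphic_real_deriv[OF holomorphic_deriv[OF K.Winf_holo_y[OF xr] oh] oh y(2)])
    show "(H_mat \<sigma> GL_sol has_vector_derivative H' x) (at x)"
    proof (intro has_vector_derivative_vec)
      fix i k
      have "(\<lambda>s. H_mat \<sigma> GL_sol s $ i $ k) = (\<lambda>s. K.Hinf i k (of_real s))"
        by (simp add: H_component K.Hinf_def GL_sol_def)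
      then show "((\<lambda>s. H_mat \<sigma> GL_sol s $ i $ k) has_vector_derivative H' x $ i $ k) (at x)"
        using holomorphic_real_deriv[OF K.Hinf_holo K.open_good x(2)] by (simp add: H'_def)
    qed
    show "Wxx x y - Wyy x y = (-2) *\<^sub>R (H' x ** GL_sol x y)"
      using K.PDE[OF x(2) y(1)]
      by (simp add: vec_eq_iff Wxx_def Wyy_def H'_def GL_sol_def matrix_matrix_mult_def numeral_2_eq_2 scaleR_conv_of_real[where 'a=complex])
  qed
qed

end

section \<open>Contraction of Hankel operators and zeros of the tau function\<close>

text \<open>Weighted Cauchy inequality. A weight \<open>e\<close> near 0 keeps the constant of \<open>b\<^sup>2\<close> near 1, which is needed to absorb
  a term with constant below 1.\<close>
lemma ennreal_weighted_square:
  assumes "0 < e"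
  shows "(ennreal a + b)\<^sup>2 \<le> ennreal (1 + 1 / e) * (ennreal a)\<^sup>2 + ennreal (1 + e) * b\<^sup>2"
proof (cases b)
  case (real r)
  define a' where "a' = max 0 a"
  have a': "ennreal a = ennreal a'" "a' \<ge> 0" by (auto simp: a'_def max_def ennreal_neg)
  have "2 * a' * r \<le> a'\<^sup>2 / e + e * r\<^sup>2"
  proof -
    have "0 \<le> (a' - e * r)\<^sup>2 / e" using assms by simp
    also have "\<dots> = a'\<^sup>2 / e + e * r\<^sup>2 - 2 * a' * r" using assms by (simp add: field_simps power2_eq_square)
    finally show ?thesis by simp
  qed
  hence "(a' + r)\<^sup>2 \<le> (1 + 1 / e) * a'\<^sup>2 + (1 + e) * r\<^sup>2" by (simp add: power2_sum algebra_simps)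
  then show ?thesis
    unfolding a'(1) real using a'(2) real(1) assms
    by (simp add: ennreal_plus[symmetric] ennreal_mult'[symmetric] ennreal_power ennreal_leI del: ennreal_plus)
next
  case top
  then show ?thesis using assms by (simp add: ennreal_mult_top power2_eq_square)
qed

lemma nn_integral_shift:
  fixes y :: real
  assumes [measurable]: "f \<in> borel_measurable borel"
  shows "(\<integral>\<^sup>+ s. f (s + y) \<partial>lborel) = (\<integral>\<^sup>+ s. f s \<partial>lborel)"
  using nn_integral_real_affine[of f 1 y] by (simp add: add.commute)

lemma Cauchy_Schwarz_shift:
  fixes A \<phi> :: "real \<Rightarrow> real"
  assumes [measurable]: "A \<in> borel_measurable borel" "\<phi> \<in> borel_measurable borel"
    and A0: "\<And>s. A s \<ge> 0" "\<And>s. s \<le> 0 \<Longrightarrow> A s = 0" and \<phi>0: "\<And>t. \<phi> t \<ge> 0"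
  shows "(\<integral>\<^sup>+ s. ennreal (A s * \<phi> (s + y)) \<partial>lborel)\<^sup>2 \<le>
    (\<integral>\<^sup>+ s. ennreal ((A s)\<^sup>2) \<partial>lborel) * (\<integral>\<^sup>+ s. ennreal ((\<phi> (s + y))\<^sup>2) * indicator {0<..} s \<partial>lborel)"
proof -
  have "(\<integral>\<^sup>+ s. ennreal (A s * \<phi> (s + y)) \<partial>lborel) =
    (\<integral>\<^sup>+ s. ennreal (A s) * (ennreal (\<phi> (s + y)) * indicator {0<..} s) \<partial>lborel)"
    using A0 \<phi>0 by (intro nn_integral_cong) (auto simp: ennreal_mult indicator_def)
  also have "\<dots>\<^sup>2 \<le> (\<integral>\<^sup>+ s. (ennreal (A s))\<^sup>2 \<partial>lborel) * (\<integral>\<^sup>+ s. (ennreal (\<phi> (s + y)) * indicator {0<..} s)\<^sup>2 \<partial>lborel)"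
    by (rule Cauchy_Schwarz_nn_integral) measurable
  also have "(\<integral>\<^sup>+ s. (ennreal (A s))\<^sup>2 \<partial>lborel) = (\<integral>\<^sup>+ s. ennreal ((A s)\<^sup>2) \<partial>lborel)"
    using A0 by (intro nn_integral_cong) (simp add: ennreal_power)
  also have "(\<integral>\<^sup>+ s. (ennreal (\<phi> (s + y)) * indicator {0<..} s)\<^sup>2 \<partial>lborel) =
      (\<integral>\<^sup>+ s. ennreal ((\<phi> (s + y))\<^sup>2) * indicator {0<..} s \<partial>lborel)"
    using \<phi>0 by (intro nn_integral_cong) (auto simp: ennreal_power indicator_def)
  finally show ?thesis .
qed

text \<open>The square of the Hilbert--Schmidt norm of the Hankel operator with symbol \<open>\<phi>\<close>: on the line \<open>s + y = u\<close> the
  parameter \<open>y\<close> ranges over an interval of length \<open>u\<close>.\<close>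
lemma hankel_square_norm:
  fixes \<phi> :: "real \<Rightarrow> real"
  assumes [measurable]: "\<phi> \<in> borel_measurable borel"
  shows "(\<integral>\<^sup>+ y. \<integral>\<^sup>+ s. ennreal ((\<phi> (s + y))\<^sup>2) * indicator {0<..} s * indicator {0<..} y \<partial>lborel \<partial>lborel) =
    (\<integral>\<^sup>+ u. ennreal (u * (\<phi> u)\<^sup>2) * indicator {0<..} u \<partial>lborel)"
proof -
  have "(\<integral>\<^sup>+ y. \<integral>\<^sup>+ s. ennreal ((\<phi> (s + y))\<^sup>2) * indicator {0<..} s * indicator {0<..} y \<partial>lborel \<partial>lborel) =
     (\<integral>\<^sup>+ y. \<integral>\<^sup>+ u. ennreal ((\<phi> u)\<^sup>2) * indicator {0<..} (u - y) * indicator {0<..} y \<partial>lborel \<partial>lborel)"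
  proof (rule nn_integral_cong)
    fix y :: real
    show "(\<integral>\<^sup>+ s. ennreal ((\<phi> (s + y))\<^sup>2) * indicator {0<..} s * indicator {0<..} y \<partial>lborel) =
       (\<integral>\<^sup>+ u. ennreal ((\<phi> u)\<^sup>2) * indicator {0<..} (u - y) * indicator {0<..} y \<partial>lborel)"
      using nn_integral_shift[of "\<lambda>u. ennreal ((\<phi> u)\<^sup>2) * indicator {0<..} (u - y) * indicator {0<..} y" y] by simp
  qed
  also have "\<dots> = (\<integral>\<^sup>+ u. \<integral>\<^sup>+ y. ennreal ((\<phi> u)\<^sup>2) * indicator {0<..} (u - y) * indicator {0<..} y \<partial>lborel \<partial>lborel)"
    by (rule lborel_pair.Fubini') measurable
  also have "\<dots> = (\<integral>\<^sup>+ u. ennreal (u * (\<phi> u)\<^sup>2) * indicator {0<..} u \<partial>lborel)"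
  proof (rule nn_integral_cong)
    fix u :: real
    have "(\<integral>\<^sup>+ y. ennreal ((\<phi> u)\<^sup>2) * indicator {0<..} (u - y) * indicator {0<..} y \<partial>lborel) =
       (\<integral>\<^sup>+ y. ennreal ((\<phi> u)\<^sup>2) * indicator {0<..<u} y \<partial>lborel)"
      by (intro nn_integral_cong) (auto simp: indicator_def)
    also have "\<dots> = ennreal ((\<phi> u)\<^sup>2) * emeasure lborel {0<..<u}"
      by (rule nn_integral_cmult_indicator) simp
    also have "\<dots> = ennreal (u * (\<phi> u)\<^sup>2) * indicator {0<..} u"
      by (cases "0 < u") (auto simp: ennreal_mult'[symmetric] mult.commute)
    finally show "(\<integral>\<^sup>+ y. ennreal ((\<phi> u)\<^sup>2) * indicator {0<..} (u - y) * indicator {0<..} y \<partial>lborel) =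
      ennreal (u * (\<phi> u)\<^sup>2) * indicator {0<..} u" .
  qed
  finally show ?thesis .
qed

text \<open>A priori estimate for functions below \<open>\<phi>(x + \<cdot>)\<close> plus their image under a contractive Hankel operator. Squaring
  with weights and integrating gives \<open>\<parallel>A\<parallel>\<^sup>2 \<le> (1 + 1/e) q + (1 + e) k \<parallel>A\<parallel>\<^sup>2\<close>, and the last term is absorbed. Finiteness
  of the norm has to be known beforehand; the bound depends neither on \<open>A\<close> nor on \<open>x\<close>.\<close>
lemma hankel_L2_bound:
  fixes \<phi> :: "real \<Rightarrow> real" and k q :: real
  assumes \<phi>[measurable]: "\<phi> \<in> borel_measurable borel" and \<phi>0: "\<And>t. \<phi> t \<ge> 0"
    and k: "0 \<le> k" "k < 1" "(\<integral>\<^sup>+ u. ennreal (u * (\<phi> u)\<^sup>2) * indicator {0<..} u \<partial>lborel) \<le> ennreal k"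
    and q: "0 \<le> q" "(\<integral>\<^sup>+ u. ennreal ((\<phi> u)\<^sup>2) * indicator {0<..} u \<partial>lborel) \<le> ennreal q"
  obtains b where "b \<ge> 0" "\<And>A x. A \<in> borel_measurable borel \<Longrightarrow> 0 < x \<Longrightarrow> \<forall>s. A s \<ge> 0 \<Longrightarrow> \<forall>s\<le>x. A s = 0 \<Longrightarrow>
    \<forall>y>x. ennreal (A y) \<le> ennreal (\<phi> (x + y)) + (\<integral>\<^sup>+ s. ennreal (A s * \<phi> (s + y)) \<partial>lborel) \<Longrightarrow>
    (\<integral>\<^sup>+ s. ennreal ((A s)\<^sup>2) \<partial>lborel) < \<infinity> \<Longrightarrow> (\<integral>\<^sup>+ s. ennreal ((A s)\<^sup>2) \<partial>lborel) \<le> ennreal b"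
proof -
  \<comment> \<open>any \<open>e > 0\<close> with \<open>(1 + e) k < 1\<close>\<close>
  define e where "e = (1 - k) / (2 * k + 1)"
  have e: "e > 0" using k by (simp add: e_def)
  have ek: "(1 + e) * k < 1"
  proof -
    have "k * (1 - k) < (1 - k) * (2 * k + 1)"
      using mult_strict_left_mono[of k "2 * k + 1" "1 - k"] k by (simp add: mult.commute)
    hence "e * k < 1 - k" unfolding e_def using k by (simp add: divide_less_eq mult.commute)
    then show ?thesis by (simp add: algebra_simps)
  qed
  define c where "c = (1 + 1 / e) * q"
  have c0: "c \<ge> 0" using e q by (simp add: c_def)
  show ?thesis
  proof (rule that[of "c / (1 - (1 + e) * k)"])
    show "0 \<le> c / (1 - (1 + e) * k)" using c0 ek by simp
    fix A :: "real \<Rightarrow> real" and x :: real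
    assume A[measurable]: "A \<in> borel_measurable borel" and x: "0 < x" and A0': "\<forall>s. A s \<ge> 0" "\<forall>s\<le>x. A s = 0"
      and ineq': "\<forall>y>x. ennreal (A y) \<le> ennreal (\<phi> (x + y)) + (\<integral>\<^sup>+ s. ennreal (A s * \<phi> (s + y)) \<partial>lborel)"
      and fin: "(\<integral>\<^sup>+ s. ennreal ((A s)\<^sup>2) \<partial>lborel) < \<infinity>"
    have A0: "A s \<ge> 0" "s \<le> x \<Longrightarrow> A s = 0" for s using A0' by auto
    have ineq: "ennreal (A y) \<le> ennreal (\<phi> (x + y)) + (\<integral>\<^sup>+ s. ennreal (A s * \<phi> (s + y)) \<partial>lborel)" if "x < y" for y
      using ineq' that by blast
    let ?a = "\<integral>\<^sup>+ s. ennreal ((A s)\<^sup>2) \<partial>lborel"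
    have cs: "(\<integral>\<^sup>+ s. ennreal (A s * \<phi> (s + y)) \<partial>lborel)\<^sup>2 \<le> ?a * (\<integral>\<^sup>+ s. ennreal ((\<phi> (s + y))\<^sup>2) * indicator {0<..} s \<partial>lborel)" for y
      by (rule Cauchy_Schwarz_shift) (use A0 \<phi>0 x in auto)
    have pt: "ennreal ((A y)\<^sup>2) \<le> ennreal (1 + 1 / e) * (ennreal ((\<phi> (x + y))\<^sup>2) * indicator {0<..} (x + y)) +
       ennreal (1 + e) * (?a * (\<integral>\<^sup>+ s. ennreal ((\<phi> (s + y))\<^sup>2) * indicator {0<..} s * indicator {0<..} y \<partial>lborel))" for y
    proof (cases "x < y")
      case True
      have "ennreal ((A y)\<^sup>2) = (ennreal (A y))\<^sup>2" using A0 by (simp add: ennreal_power)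
      also have "\<dots> \<le> (ennreal (\<phi> (x + y)) + (\<integral>\<^sup>+ s. ennreal (A s * \<phi> (s + y)) \<partial>lborel))\<^sup>2"
        by (intro power_mono ineq True) simp
      also have "\<dots> \<le> ennreal (1 + 1 / e) * (ennreal (\<phi> (x + y)))\<^sup>2 + ennreal (1 + e) * (\<integral>\<^sup>+ s. ennreal (A s * \<phi> (s + y)) \<partial>lborel)\<^sup>2"
        by (rule ennreal_weighted_square[OF e])
      also have "\<dots> \<le> ennreal (1 + 1 / e) * (ennreal (\<phi> (x + y)))\<^sup>2 + ennreal (1 + e) * (?a * (\<integral>\<^sup>+ s. ennreal ((\<phi> (s + y))\<^sup>2) * indicator {0<..} s \<partial>lborel))"
        by (intro add_left_mono mult_left_mono cs) simp
      finally show ?thesis using True x \<phi>0 by (simp add: ennreal_power)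
    qed (use A0 in simp)
    have "?a \<le> (\<integral>\<^sup>+ y. ennreal (1 + 1 / e) * (ennreal ((\<phi> (x + y))\<^sup>2) * indicator {0<..} (x + y)) +
       ennreal (1 + e) * (?a * (\<integral>\<^sup>+ s. ennreal ((\<phi> (s + y))\<^sup>2) * indicator {0<..} s * indicator {0<..} y \<partial>lborel)) \<partial>lborel)"
      by (intro nn_integral_mono pt)
    also have "\<dots> = ennreal (1 + 1 / e) * (\<integral>\<^sup>+ y. ennreal ((\<phi> (x + y))\<^sup>2) * indicator {0<..} (x + y) \<partial>lborel) +
       ennreal (1 + e) * (?a * (\<integral>\<^sup>+ y. \<integral>\<^sup>+ s. ennreal ((\<phi> (s + y))\<^sup>2) * indicator {0<..} s * indicator {0<..} y \<partial>lborel \<partial>lborel))"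
    proof -
      define f where "f y = ennreal ((\<phi> (x + y))\<^sup>2) * indicator {0<..} (x + y)" for y
      define J where "J y = (\<integral>\<^sup>+ s. ennreal ((\<phi> (s + y))\<^sup>2) * indicator {0<..} s * indicator {0<..} y \<partial>lborel)" for y
      have [measurable]: "f \<in> borel_measurable lborel" unfolding f_def by measurable
      have [measurable]: "J \<in> borel_measurable lborel" unfolding J_def by measurable
      have "(\<integral>\<^sup>+ y. ennreal (1 + 1 / e) * f y + ennreal (1 + e) * (?a * J y) \<partial>lborel) =
        (\<integral>\<^sup>+ y. ennreal (1 + 1 / e) * f y \<partial>lborel) + (\<integral>\<^sup>+ y. ennreal (1 + e) * (?a * J y) \<partial>lborel)"
        by (rule nn_integral_add) measurable
      also have "\<dots> = ennreal (1 + 1 / e) * (\<integral>\<^sup>+ y. f y \<partial>lborel) + ennreal (1 + e) * (?a * (\<integral>\<^sup>+ y. J y \<partial>lborel))"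
        by (simp add: nn_integral_cmult)
      finally show ?thesis unfolding f_def J_def .
    qed
    also have "(\<integral>\<^sup>+ y. ennreal ((\<phi> (x + y))\<^sup>2) * indicator {0<..} (x + y) \<partial>lborel) =
       (\<integral>\<^sup>+ u. ennreal ((\<phi> u)\<^sup>2) * indicator {0<..} u \<partial>lborel)"
      using nn_integral_shift[of "\<lambda>u. ennreal ((\<phi> u)\<^sup>2) * indicator {0<..} u" x] by (simp add: add.commute)
    also have "ennreal (1 + 1 / e) * (\<integral>\<^sup>+ u. ennreal ((\<phi> u)\<^sup>2) * indicator {0<..} u \<partial>lborel) +
       ennreal (1 + e) * (?a * (\<integral>\<^sup>+ y. \<integral>\<^sup>+ s. ennreal ((\<phi> (s + y))\<^sup>2) * indicator {0<..} s * indicator {0<..} y \<partial>lborel \<partial>lborel))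
       \<le> ennreal (1 + 1 / e) * ennreal q + ennreal (1 + e) * (?a * ennreal k)"
      unfolding hankel_square_norm[OF \<phi>] by (intro add_mono mult_left_mono q k) auto
    finally have main: "?a \<le> ennreal (1 + 1 / e) * ennreal q + ennreal (1 + e) * (?a * ennreal k)" .
    obtain r where r: "?a = ennreal r" "r \<ge> 0" using fin by (cases ?a) auto
    have "ennreal r \<le> ennreal (c + (1 + e) * k * r)"
      using main unfolding r(1) c_def using e k q r(2)
      by (simp add: ennreal_mult'[symmetric] ennreal_plus[symmetric] mult_ac del: ennreal_plus)
    hence "r \<le> c + (1 + e) * k * r" using r(2) c0 e k by (subst (asm) ennreal_le_iff) auto
    hence "r * (1 - (1 + e) * k) \<le> c" by (simp add: algebra_simps)
    hence "r \<le> c / (1 - (1 + e) * k)" using ek by (simp add: le_divide_eq)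
    then show "?a \<le> ennreal (c / (1 - (1 + e) * k))" unfolding r(1) by (rule ennreal_leI)
  qed
qed

lemma norm_vec_square: "(norm (v :: complex^'n))\<^sup>2 = (\<Sum>a\<in>UNIV. (norm (v $ a))\<^sup>2)"
  unfolding norm_vec_def L2_set_def by (simp add: sum_nonneg)

lemma norm_dot_le: "norm (dot u w) \<le> norm u * norm w"
proof -
  have "norm (dot u w) \<le> (\<Sum>a\<in>UNIV. \<bar>norm (u $ a)\<bar> * \<bar>norm (w $ a)\<bar>)"
    unfolding dot_def by (rule sum_norm_le) (simp add: norm_mult)
  also have "\<dots> \<le> norm u * norm w"
    unfolding norm_vec_def by (rule L2_set_mult_ineq)
  finally show ?thesis .
qed

text \<open>To the right of the largest zero \<open>z\<close> the function \<open>|F|\<^sup>2 exp(-2cx)\<close> is decreasing, so it cannot grow from the value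
  0 at \<open>z\<close> to a positive one.\<close>
lemma no_zero_of_bounded_log_derivative:
  fixes F :: "real \<Rightarrow> complex"
  assumes cont: "continuous_on {0<..} F" and lim: "(F \<longlongrightarrow> 1) at_top"
    and der: "\<And>x. 0 < x \<Longrightarrow> F x \<noteq> 0 \<Longrightarrow> (F has_vector_derivative F x * h x) (at x)"
    and h: "\<And>x. 0 < x \<Longrightarrow> F x \<noteq> 0 \<Longrightarrow> norm (h x) \<le> c" and x0: "0 < x0"
  shows "F x0 \<noteq> 0"
proof
  assume z0: "F x0 = 0"
  have "\<forall>\<^sub>F x in at_top. dist (F x) 1 < 1" using lim by (rule tendstoD) simp
  then obtain R where R: "\<And>x. x \<ge> R \<Longrightarrow> F x \<noteq> 0"
    unfolding eventually_at_top_linorder by (force simp: dist_norm)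
  have x0R: "x0 < R" using R[of x0] z0 by (meson not_le)
  define Z where "Z = {x\<in>{x0..R}. F x = 0}"
  have contR: "continuous_on {x0..R} F" by (rule continuous_on_subset[OF cont]) (use x0 in auto)
  have cZ: "compact Z"
  proof -
    have "closed ({x0..R} \<inter> F -` {0})" by (rule continuous_closed_preimage[OF contR]) auto
    moreover have "Z = {x0..R} \<inter> F -` {0}" by (auto simp: Z_def)
    ultimately show ?thesis by (auto simp: compact_eq_bounded_closed intro: bounded_subset[of "{x0..R}"])
  qed
  have "x0 \<in> Z" using z0 x0R by (auto simp: Z_def)
  then obtain z where z: "z \<in> Z" "\<And>y. y \<in> Z \<Longrightarrow> y \<le> z"
    using compact_attains_sup[OF cZ] by auto
  have z0': "0 < z" "F z = 0" "z < R" using z(1) x0 R[of z] by (auto simp: Z_def less_le)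
  have nz: "F x \<noteq> 0" if "z < x" for x
  proof
    assume "F x = 0"
    hence "x \<le> R" using R[of x] by (meson not_le less_imp_le)
    hence "x \<in> Z" using that z(1) \<open>F x = 0\<close> by (auto simp: Z_def)
    then show False using z(2)[of x] that by simp
  qed
  define g where "g x = ((Re (F x))\<^sup>2 + (Im (F x))\<^sup>2) * exp (- (2 * c * x))" for x
  have "g R \<le> g z"
  proof (rule DERIV_nonpos_imp_decreasing_open[OF less_imp_le[OF z0'(3)]])
    fix x assume x: "z < x" "x < R"
    hence x': "0 < x" "F x \<noteq> 0" using z0' nz by auto
    let ?d = "F x * h x"
    have re: "((\<lambda>x. Re (F x)) has_real_derivative Re ?d) (at x)"
      unfolding has_real_derivative_iff_has_vector_derivative
      by (rule bounded_linear.has_vector_derivative[OF bounded_linear_Re der[OF x']])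
    have im: "((\<lambda>x. Im (F x)) has_real_derivative Im ?d) (at x)"
      unfolding has_real_derivative_iff_has_vector_derivative
      by (rule bounded_linear.has_vector_derivative[OF bounded_linear_Im der[OF x']])
    have re2: "((\<lambda>x. (Re (F x))\<^sup>2) has_real_derivative 2 * Re (F x) * Re ?d) (at x)"
      using DERIV_mult[OF re re] by (simp add: power2_eq_square mult_ac)
    have im2: "((\<lambda>x. (Im (F x))\<^sup>2) has_real_derivative 2 * Im (F x) * Im ?d) (at x)"
      using DERIV_mult[OF im im] by (simp add: power2_eq_square mult_ac)
    have ex: "((\<lambda>x. exp (- (2 * c * x))) has_real_derivative - (2 * c) * exp (- (2 * c * x))) (at x)"
      by (auto intro!: derivative_eq_intros)
    have "(g has_real_derivative ((2 * Re (F x) * Re ?d + 2 * Im (F x) * Im ?d) * exp (- (2 * c * x))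
      + (- (2 * c) * exp (- (2 * c * x))) * ((Re (F x))\<^sup>2 + (Im (F x))\<^sup>2))) (at x)"
      unfolding g_def by (rule DERIV_mult[OF DERIV_add[OF re2 im2] ex])
    moreover have "(2 * Re (F x) * Re ?d + 2 * Im (F x) * Im ?d) * exp (- (2 * c * x))
      + (- (2 * c) * exp (- (2 * c * x))) * ((Re (F x))\<^sup>2 + (Im (F x))\<^sup>2) =
      2 * (((Re (F x))\<^sup>2 + (Im (F x))\<^sup>2) * (Re (h x) - c)) * exp (- (2 * c * x))"
      by (simp add: algebra_simps power2_eq_square)
    moreover have "\<dots> \<le> 0"
    proof -
      have "Re (h x) \<le> c" using h[OF x'] complex_Re_le_cmod[of "h x"] by linarith
      then show ?thesis by (intro mult_nonpos_nonneg mult_nonneg_nonpos) (auto intro!: mult_nonneg_nonpos)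
    qed
    ultimately show "\<exists>y. (g has_real_derivative y) (at x) \<and> y \<le> 0" by auto
  next
    have "continuous_on {z..R} F" by (rule continuous_on_subset[OF cont]) (use z0' in auto)
    then show "continuous_on {z..R} g" unfolding g_def by (intro continuous_intros)
  qed
  moreover have "g z = 0" using z0' by (simp add: g_def)
  moreover have "g R > 0" using R[of R] complex_neq_0[of "F R"] by (simp add: g_def)
  ultimately show False by simp
qed

context exp_series begin

lemma norm_Psi_row_le: "norm (Psi \<psi> t $ i) \<le> norm (\<psi> t)"
proof (rule power2_le_imp_le)
  show "(norm (Psi \<psi> t $ i))\<^sup>2 \<le> (norm (\<psi> t))\<^sup>2"
  proof (cases i)
    case (Inl a)
    have "(norm (\<psi> t $ a))\<^sup>2 \<le> (norm (\<psi> t))\<^sup>2"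
      by (intro power_mono Finite_Cartesian_Product.norm_nth_le) auto
    then show ?thesis using Inl
      unfolding norm_vec_square[of "Psi \<psi> t $ i"] UNIV_plus_unit by (simp add: Psi_def bmat_def)
  next
    case (Inr u)
    then show ?thesis
      unfolding norm_vec_square UNIV_plus_unit by (simp add: Psi_def bmat_def conj_vec_def)
  qed
qed auto

text \<open>A row \<open>(u, w)\<close> is sent to \<open>(w \<psi>\<^sup>\<dagger>, u \<sigma> \<psi>)\<close>.\<close>
lemma norm_star_row_le:
  assumes contr: "\<And>v. norm (\<sigma> *v v) \<le> norm v"
  shows "norm (star \<sigma> M (Psi \<psi> t) $ i) \<le> norm (M $ i) * norm (\<psi> t)"
proof (rule power2_le_imp_le)
  define u where "u = (\<chi> a. M $ i $ Inl a)"
  define w where "w = M $ i $ Inr ()"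
  have M: "(norm (M $ i))\<^sup>2 = (norm u)\<^sup>2 + (norm w)\<^sup>2"
    unfolding norm_vec_square UNIV_plus_unit by (simp add: u_def w_def)
  have l: "star \<sigma> M (Psi \<psi> t) $ i $ Inl b = w * cnj (\<psi> t $ b)" for b
    by (cases i) (auto simp: star_def bmat_def block_v_def block_r_def block_z_def Psi_def w_def conj_vec_def)
  have r: "star \<sigma> M (Psi \<psi> t) $ i $ Inr () = dot u (\<sigma> *v \<psi> t)"
    by (cases i) (auto simp: star_def bmat_def block_U_def block_v_def block_r_def Psi_def u_def conj_vec_def dot_def
        matrix_vector_mult_def)
  have d: "norm (dot u (\<sigma> *v \<psi> t)) \<le> norm u * norm (\<psi> t)"
    by (rule order.trans[OF norm_dot_le]) (intro mult_left_mono contr norm_ge_zero)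
  have "(norm (star \<sigma> M (Psi \<psi> t) $ i))\<^sup>2 = (norm w)\<^sup>2 * (norm (\<psi> t))\<^sup>2 + (norm (dot u (\<sigma> *v \<psi> t)))\<^sup>2"
    unfolding norm_vec_square[of "star \<sigma> M (Psi \<psi> t) $ i"] norm_vec_square[of "\<psi> t"] UNIV_plus_unit l r
    by (simp add: norm_mult power_mult_distrib sum_distrib_left)
  also have "\<dots> \<le> (norm w)\<^sup>2 * (norm (\<psi> t))\<^sup>2 + (norm u * norm (\<psi> t))\<^sup>2"
    by (intro add_left_mono power_mono d) auto
  also have "\<dots> = (norm (M $ i) * norm (\<psi> t))\<^sup>2"
    unfolding power_mult_distrib M by (simp add: algebra_simps)
  finally show "(norm (star \<sigma> M (Psi \<psi> t) $ i))\<^sup>2 \<le> (norm (M $ i) * norm (\<psi> t))\<^sup>2" .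
qed auto

text \<open>Apply \<open>\<Psi>\<close> to the last unit vector.\<close>
lemma norm_psi_le_op_norm: "norm (\<psi> t) \<le> op_norm (Psi \<psi> t)"
proof -
  let ?e = "axis (Inr ()) 1 :: complex^('h + unit)"
  have bl: "bounded_linear (\<lambda>x. Psi \<psi> t *v x)"
    unfolding linear_conv_bounded_linear[symmetric]
    by (rule linearI) (auto simp: vec_eq_iff matrix_vector_mult_def scaleR_sum_right distrib_left sum.distrib)
  have c: "Psi \<psi> t *v ?e = (\<chi> i. Psi \<psi> t $ i $ Inr ())"
    by (simp add: vec_eq_iff matrix_vector_mult_def axis_def if_distrib[of "\<lambda>x. _ * x"] sum.delta cong: if_cong)
  have "(norm (Psi \<psi> t *v ?e))\<^sup>2 = (norm (\<psi> t))\<^sup>2"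
    unfolding c norm_vec_square UNIV_plus_unit by (simp add: Psi_def bmat_def)
  hence 1: "norm (Psi \<psi> t *v ?e) = norm (\<psi> t)" by simp
  have "(norm ?e)\<^sup>2 = 1" unfolding norm_vec_square UNIV_plus_unit by (simp add: axis_def)
  hence 2: "norm ?e = 1" by (simp add: power2_eq_1_iff)
  show ?thesis
    using onorm[OF bl, of ?e] unfolding 1 2 op_norm_def by simp
qed

text \<open>The norm \<open>A(y)\<close> of a row of \<open>W(x,y)\<close> satisfies \<open>A(y) \<le> |\<psi>(x+y)| + \<integral> A(s) |\<psi>(s+y)| ds\<close>, so \<open>hankel_L2_bound\<close> bounds
  its \<open>L\<^sup>2\<close> norm independently of \<open>x\<close>. Inserted once more at \<open>y = x\<close>, the inequality bounds \<open>W(x,x)\<close>.\<close>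
lemma trace_bound:
  assumes contr: "\<And>v. norm (\<sigma> *v v) \<le> norm v"
    and hyp: "(\<integral>\<^sup>+ x\<in>{0<..}. ennreal (x * (op_norm (Psi \<psi> x))\<^sup>2) \<partial>lborel) < 1"
  obtains c where "\<And>x. of_real x \<in> K.good \<Longrightarrow> norm (trace (H_mat \<sigma> GL_sol x)) \<le> c"
proof -
  define \<phi> where "\<phi> u = norm (psi0 u)" for u
  have \<phi>m[measurable]: "\<phi> \<in> borel_measurable borel" unfolding \<phi>_def[abs_def] by measurable
  have \<phi>0: "\<phi> u \<ge> 0" for u by (simp add: \<phi>_def)
  have \<phi>b: "\<phi> u \<le> chi_total * exp (- (rate0 * u))" if "u \<ge> 0" for u unfolding \<phi>_def by (rule psi0_bound[OF that])
  have \<phi>e: "\<phi> u = norm (\<psi> u)" if "u > 0" for u using that by (simp add: \<phi>_def psi0_eq)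
  have e2: "(exp (- (rate0 * u)))\<^sup>2 = exp (- ((2 * rate0) * u))" for u
    by (simp add: power2_eq_square exp_add[symmetric])
  define I where "I = (\<integral>\<^sup>+ u. ennreal (u * (\<phi> u)\<^sup>2) * indicator {0<..} u \<partial>lborel)"
  have "I \<le> (\<integral>\<^sup>+ x\<in>{0<..}. ennreal (x * (op_norm (Psi \<psi> x))\<^sup>2) \<partial>lborel)"
    unfolding I_def
  proof (rule nn_integral_mono)
    fix u :: real
    show "ennreal (u * (\<phi> u)\<^sup>2) * indicator {0<..} u \<le> ennreal (u * (op_norm (Psi \<psi> u))\<^sup>2) * indicator {0<..} u"
      using norm_psi_le_op_norm[of u] by (cases "0 < u") (auto simp: \<phi>e intro!: ennreal_leI mult_left_mono power_mono)
  qed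
  hence I1: "I < 1" using hyp by (rule le_less_trans)
  define k where "k = enn2real I"
  have k: "0 \<le> k" "I \<le> ennreal k" "k < 1"
    using I1 by (cases I; simp add: k_def ennreal_less_one_iff)+
  define q where "q = chi_total\<^sup>2 / (2 * rate0)"
  have tail: "(\<integral>\<^sup>+ u. ennreal (a\<^sup>2 * (indicator {z<..} u * exp (- ((2 * rate0) * u)))) \<partial>lborel) = ennreal (a\<^sup>2 * (exp (- ((2 * rate0) * z)) / (2 * rate0)))" for a z
  proof -
    have "has_bochner_integral lborel (\<lambda>u. a\<^sup>2 * (indicator {z<..} u * exp (- ((2 * rate0) * u)))) (a\<^sup>2 * (exp (- ((2 * rate0) * z)) / (2 * rate0)))"
      using rate0_pos by (intro has_bochner_integral_mult_right has_bochner_integral_exp_tail) auto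
    then show ?thesis by (subst nn_integral_eq_integral) (auto simp: has_bochner_integral_iff)
  qed
  have q: "0 \<le> q" "(\<integral>\<^sup>+ u. ennreal ((\<phi> u)\<^sup>2) * indicator {0<..} u \<partial>lborel) \<le> ennreal q"
  proof -
    show "0 \<le> q" using rate0_pos by (simp add: q_def)
    have "(\<integral>\<^sup>+ u. ennreal ((\<phi> u)\<^sup>2) * indicator {0<..} u \<partial>lborel) \<le>
      (\<integral>\<^sup>+ u. ennreal (chi_total\<^sup>2 * (indicator {0<..} u * exp (- ((2 * rate0) * u)))) \<partial>lborel)"
    proof (rule nn_integral_mono)
      fix u :: real
      have "(\<phi> u)\<^sup>2 \<le> chi_total\<^sup>2 * exp (- ((2 * rate0) * u))" if "0 < u"
      proof -
        have "(\<phi> u)\<^sup>2 \<le> (chi_total * exp (- (rate0 * u)))\<^sup>2" using that \<phi>0 by (intro power_mono \<phi>b) auto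
        then show ?thesis unfolding power_mult_distrib e2 .
      qed
      then show "ennreal ((\<phi> u)\<^sup>2) * indicator {0<..} u \<le> ennreal (chi_total\<^sup>2 * (indicator {0<..} u * exp (- ((2 * rate0) * u))))"
        by (cases "0 < u") (auto intro: ennreal_leI)
    qed
    then show "(\<integral>\<^sup>+ u. ennreal ((\<phi> u)\<^sup>2) * indicator {0<..} u \<partial>lborel) \<le> ennreal q"
      unfolding tail q_def by simp
  qed
  obtain b where b: "b \<ge> 0" "\<And>A x. A \<in> borel_measurable borel \<Longrightarrow> 0 < x \<Longrightarrow> \<forall>s. A s \<ge> 0 \<Longrightarrow> \<forall>s\<le>x. A s = 0 \<Longrightarrow>
    \<forall>y>x. ennreal (A y) \<le> ennreal (\<phi> (x + y)) + (\<integral>\<^sup>+ s. ennreal (A s * \<phi> (s + y)) \<partial>lborel) \<Longrightarrow>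
    (\<integral>\<^sup>+ s. ennreal ((A s)\<^sup>2) \<partial>lborel) < \<infinity> \<Longrightarrow> (\<integral>\<^sup>+ s. ennreal ((A s)\<^sup>2) \<partial>lborel) \<le> ennreal b"
    by (rule hankel_L2_bound[OF \<phi>m \<phi>0 k(1,3) k(2)[unfolded I_def] q]) (rule that)
  define Bd where "Bd = chi_total + sqrt (b * q)"
  have diag: "norm (GL_sol x x $ i) \<le> Bd" if g: "of_real x \<in> K.good" for x i
  proof -
    have x: "0 < x" using g by simp
    define A where "A y = indicator {x<..} y * norm (GL_sol x y $ i)" for y
    have Am[measurable]: "A \<in> borel_measurable borel"
    proof -
      have "continuous_on {x<..} (\<lambda>y. norm (GL_sol x y $ i))"
        by (intro continuous_intros continuous_on_subset[OF GL_sol_continuous[OF x]]) (use x in auto)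
      then show ?thesis
        unfolding A_def[abs_def] using borel_measurable_continuous_on_indicator[of "{x<..}" "\<lambda>y. norm (GL_sol x y $ i)"] by simp
    qed
    have A0: "A s \<ge> 0" "s \<le> x \<Longrightarrow> A s = 0" for s by (auto simp: A_def)
    have ineq: "ennreal (norm (GL_sol x y $ i)) \<le> ennreal (\<phi> (x + y)) + (\<integral>\<^sup>+ s. ennreal (A s * \<phi> (s + y)) \<partial>lborel)" if y: "0 < y" for y
    proof -
      let ?f = "\<lambda>s. indicator {x<..} s *\<^sub>R star \<sigma> (GL_sol x s) (Psi \<psi> (s + y))"
      have I: "integrable lborel ?f" using GL_sol_integral_equation(1)[OF g y] by (simp add: set_integrable_def)
      have "GL_sol x y + Psi \<psi> (x + y) + integral\<^sup>L lborel ?f = 0"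
        using GL_sol_integral_equation(2)[OF g y] by (simp add: set_lebesgue_integral_def)
      hence "GL_sol x y = - Psi \<psi> (x + y) - integral\<^sup>L lborel ?f" by (simp add: algebra_simps add_eq_0_iff)
      hence "GL_sol x y $ i = - Psi \<psi> (x + y) $ i - integral\<^sup>L lborel ?f $ i" by simp
      hence "norm (GL_sol x y $ i) \<le> norm (Psi \<psi> (x + y) $ i) + norm (integral\<^sup>L lborel ?f $ i)"
        using norm_triangle_ineq4[of "- Psi \<psi> (x + y) $ i" "integral\<^sup>L lborel ?f $ i"] by simp
      also have "\<dots> \<le> \<phi> (x + y) + norm (integral\<^sup>L lborel ?f $ i)"
        using norm_Psi_row_le[of "x + y" i] x y by (simp add: \<phi>e)
      finally have "ennreal (norm (GL_sol x y $ i)) \<le> ennreal (\<phi> (x + y)) + ennreal (norm (integral\<^sup>L lborel ?f $ i))"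
        using \<phi>0 by (simp add: ennreal_plus[symmetric] ennreal_leI del: ennreal_plus)
      moreover have "ennreal (norm (integral\<^sup>L lborel ?f $ i)) \<le> (\<integral>\<^sup>+ s. ennreal (A s * \<phi> (s + y)) \<partial>lborel)"
      proof -
        have "integral\<^sup>L lborel ?f $ i = integral\<^sup>L lborel (\<lambda>s. ?f s $ i)"
          by (rule integral_bounded_linear[OF bounded_linear_vec_nth I, symmetric])
        moreover have "integrable lborel (\<lambda>s. ?f s $ i)"
          by (rule integrable_bounded_linear[OF bounded_linear_vec_nth I])
        ultimately have "ennreal (norm (integral\<^sup>L lborel ?f $ i)) \<le> (\<integral>\<^sup>+ s. ennreal (norm (?f s $ i)) \<partial>lborel)"
          using integral_norm_bound_ennreal[of lborel "\<lambda>s. ?f s $ i"] by simp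
        also have "\<dots> \<le> (\<integral>\<^sup>+ s. ennreal (A s * \<phi> (s + y)) \<partial>lborel)"
        proof (intro nn_integral_mono ennreal_leI)
          fix s :: real
          show "norm (?f s $ i) \<le> A s * \<phi> (s + y)"
            using norm_star_row_le[OF contr, of "GL_sol x s" "s + y" i] x y
            by (cases "x < s") (auto simp: A_def \<phi>e)
        qed
        finally show ?thesis .
      qed
      ultimately show ?thesis by (meson add_left_mono order.trans)
    qed
    \<comment> \<open>a bound depending on \<open>x\<close>: boundedness of \<open>W(x,\<cdot>)\<close>, put into the inequality once, gives exponential decay\<close>
    have fin: "(\<integral>\<^sup>+ s. ennreal ((A s)\<^sup>2) \<partial>lborel) < \<infinity>"
    proof -
      obtain B where B: "B \<ge> 0" "\<And>i j y. Re (of_real x) \<le> Re y \<Longrightarrow> norm (K.Winf i j (of_real x) y) \<le> B"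
        by (rule GL.W_bounded[OF g]) (rule that)
      define B1 where "B1 = (\<Sum>j\<in>(UNIV :: ('h + unit) set). B)"
      have B1: "B1 \<ge> 0" unfolding B1_def using B by (intro sum_nonneg) auto
      have WB: "norm (GL_sol x y $ i) \<le> B1" if "x \<le> y" for y
      proof -
        have "norm (GL_sol x y $ i) \<le> (\<Sum>j\<in>UNIV. norm (GL_sol x y $ i $ j))"
          unfolding norm_vec_def[of "GL_sol x y $ i"] by (rule L2_set_le_sum) auto
        also have "\<dots> \<le> B1" unfolding B1_def using B(2)[of "of_real y"] that by (intro sum_mono) (simp add: GL_sol_def)
        finally show ?thesis .
      qed
      define d where "d = chi_total + B1 * chi_total / rate0"
      have d0: "d \<ge> 0" using chi_total_nonneg B1 rate0_pos by (simp add: d_def)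
      have Ad: "A y \<le> d * exp (- (rate0 * y))" if "x < y" for y
      proof -
        have "(\<integral>\<^sup>+ s. ennreal (A s * \<phi> (s + y)) \<partial>lborel) \<le>
          (\<integral>\<^sup>+ s. ennreal ((B1 * chi_total * exp (- (rate0 * y))) * (indicator {x<..} s * exp (- (rate0 * s)))) \<partial>lborel)"
        proof (intro nn_integral_mono ennreal_leI)
          fix s :: real
          show "A s * \<phi> (s + y) \<le> (B1 * chi_total * exp (- (rate0 * y))) * (indicator {x<..} s * exp (- (rate0 * s)))"
          proof (cases "x < s")
            case True
            have "norm (GL_sol x s $ i) * \<phi> (s + y) \<le> B1 * (chi_total * exp (- (rate0 * (s + y))))"
              using True x that \<phi>0 B1 by (intro mult_mono WB \<phi>b) auto
            also have "\<dots> = B1 * chi_total * exp (- (rate0 * y)) * exp (- (rate0 * s))"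
              by (simp add: mult.assoc exp_add[symmetric]) (simp add: algebra_simps)
            finally show ?thesis using True by (simp add: A_def)
          qed (simp add: A_def)
        qed
        also have "\<dots> = ennreal ((B1 * chi_total * exp (- (rate0 * y))) * (exp (- (rate0 * x)) / rate0))"
        proof -
          have "has_bochner_integral lborel (\<lambda>s. (B1 * chi_total * exp (- (rate0 * y))) * (indicator {x<..} s * exp (- (rate0 * s))))
             ((B1 * chi_total * exp (- (rate0 * y))) * (exp (- (rate0 * x)) / rate0))"
            using rate0_pos by (intro has_bochner_integral_mult_right has_bochner_integral_exp_tail)
          then show ?thesis using B1 chi_total_nonneg by (subst nn_integral_eq_integral) (auto simp: has_bochner_integral_iff)
        qed
        also have "\<dots> \<le> ennreal (B1 * chi_total / rate0 * exp (- (rate0 * y)))"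
        proof (rule ennreal_leI)
          have "(B1 * chi_total * exp (- (rate0 * y))) * (exp (- (rate0 * x)) / rate0) \<le> (B1 * chi_total * exp (- (rate0 * y))) * (1 / rate0)"
            using B1 chi_total_nonneg rate0_pos x by (intro mult_left_mono divide_right_mono) auto
          then show "(B1 * chi_total * exp (- (rate0 * y))) * (exp (- (rate0 * x)) / rate0) \<le> B1 * chi_total / rate0 * exp (- (rate0 * y))" by simp
        qed
        finally have J: "(\<integral>\<^sup>+ s. ennreal (A s * \<phi> (s + y)) \<partial>lborel) \<le> ennreal (B1 * chi_total / rate0 * exp (- (rate0 * y)))" .
        have "\<phi> (x + y) \<le> chi_total * exp (- (rate0 * (x + y)))" using x that by (intro \<phi>b) auto
        also have "\<dots> \<le> chi_total * exp (- (rate0 * y))" using chi_total_nonneg x rate0_pos by (intro mult_left_mono) auto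
        finally have p: "\<phi> (x + y) \<le> chi_total * exp (- (rate0 * y))" .
        have "ennreal (norm (GL_sol x y $ i)) \<le> ennreal (chi_total * exp (- (rate0 * y))) + ennreal (B1 * chi_total / rate0 * exp (- (rate0 * y)))"
          by (rule order.trans[OF ineq add_mono[OF ennreal_leI[OF p] J]]) (use x that in auto)
        also have "\<dots> = ennreal (d * exp (- (rate0 * y)))"
          using chi_total_nonneg B1 rate0_pos unfolding d_def by (subst ennreal_plus[symmetric]) (auto simp: distrib_right)
        finally have "norm (GL_sol x y $ i) \<le> d * exp (- (rate0 * y))"
          using d0 by (subst (asm) ennreal_le_iff) auto
        then show ?thesis using that by (simp add: A_def)
      qed
      have "(\<integral>\<^sup>+ s. ennreal ((A s)\<^sup>2) \<partial>lborel) \<le> (\<integral>\<^sup>+ u. ennreal (d\<^sup>2 * (indicator {x<..} u * exp (- ((2 * rate0) * u)))) \<partial>lborel)"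
      proof (intro nn_integral_mono ennreal_leI)
        fix s :: real
        show "(A s)\<^sup>2 \<le> d\<^sup>2 * (indicator {x<..} s * exp (- ((2 * rate0) * s)))"
        proof (cases "x < s")
          case True
          have "(A s)\<^sup>2 \<le> (d * exp (- (rate0 * s)))\<^sup>2" by (intro power_mono Ad True A0)
          then show ?thesis using True unfolding power_mult_distrib e2 by simp
        qed (simp add: A0)
      qed
      then show ?thesis unfolding tail using ennreal_less_top le_less_trans by fastforce
    qed
    have a: "(\<integral>\<^sup>+ s. ennreal ((A s)\<^sup>2) \<partial>lborel) \<le> ennreal b"
    proof (rule b(2)[OF Am x _ _ _ fin])
      show "\<forall>s. 0 \<le> A s" "\<forall>s\<le>x. A s = 0" using A0 by auto
      have "ennreal (A y) \<le> ennreal (\<phi> (x + y)) + (\<integral>\<^sup>+ s. ennreal (A s * \<phi> (s + y)) \<partial>lborel)" if "x < y" for y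
      proof -
        have "A y = norm (GL_sol x y $ i)" using that by (simp add: A_def)
        then show ?thesis using ineq[of y] x that by simp
      qed
      then show "\<forall>y>x. ennreal (A y) \<le> ennreal (\<phi> (x + y)) + (\<integral>\<^sup>+ s. ennreal (A s * \<phi> (s + y)) \<partial>lborel)" by blast
    qed
    have J2: "(\<integral>\<^sup>+ s. ennreal (A s * \<phi> (s + x)) \<partial>lborel)\<^sup>2 \<le> ennreal (b * q)"
    proof -
      have "(\<integral>\<^sup>+ s. ennreal (A s * \<phi> (s + x)) \<partial>lborel)\<^sup>2 \<le>
        (\<integral>\<^sup>+ s. ennreal ((A s)\<^sup>2) \<partial>lborel) * (\<integral>\<^sup>+ s. ennreal ((\<phi> (s + x))\<^sup>2) * indicator {0<..} s \<partial>lborel)"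
        by (rule Cauchy_Schwarz_shift[OF Am \<phi>m]) (use A0 \<phi>0 x in auto)
      also have "(\<integral>\<^sup>+ s. ennreal ((\<phi> (s + x))\<^sup>2) * indicator {0<..} s \<partial>lborel) \<le>
          (\<integral>\<^sup>+ s. ennreal ((\<phi> (s + x))\<^sup>2) * indicator {0<..} (s + x) \<partial>lborel)"
        using x by (intro nn_integral_mono) (auto simp: indicator_def)
      also have "\<dots> = (\<integral>\<^sup>+ u. ennreal ((\<phi> u)\<^sup>2) * indicator {0<..} u \<partial>lborel)"
        using nn_integral_shift[of "\<lambda>u. ennreal ((\<phi> u)\<^sup>2) * indicator {0<..} u" x] by simp
      also have "(\<integral>\<^sup>+ s. ennreal ((A s)\<^sup>2) \<partial>lborel) * \<dots> \<le> ennreal b * ennreal q"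
        by (intro mult_mono a q) auto
      finally show ?thesis using b(1) q(1) by (simp add: ennreal_mult mult_left_mono)
    qed
    have J: "(\<integral>\<^sup>+ s. ennreal (A s * \<phi> (s + x)) \<partial>lborel) \<le> ennreal (sqrt (b * q))"
    proof (cases "\<integral>\<^sup>+ s. ennreal (A s * \<phi> (s + x)) \<partial>lborel")
      case (real r)
      have "r\<^sup>2 \<le> b * q" using J2 unfolding real using real(1) b(1) q(1) by (simp add: ennreal_power)
      then show ?thesis unfolding real by (intro ennreal_leI real_le_rsqrt)
    next
      case top
      then show ?thesis using J2 by (simp add: power2_eq_square top_unique)
    qed
    have "ennreal (norm (GL_sol x x $ i)) \<le> ennreal chi_total + ennreal (sqrt (b * q))"
    proof (rule order.trans[OF ineq[OF x]], rule add_mono[OF _ J], rule ennreal_leI)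
      have "\<phi> (x + x) \<le> chi_total * exp (- (rate0 * (x + x)))" using x by (intro \<phi>b) auto
      also have "\<dots> \<le> chi_total * 1" using chi_total_nonneg x rate0_pos by (intro mult_left_mono) auto
      finally show "\<phi> (x + x) \<le> chi_total" by simp
    qed
    also have "\<dots> = ennreal Bd" unfolding Bd_def using chi_total_nonneg b(1) q(1) by (intro ennreal_plus[symmetric]) auto
    finally show ?thesis using chi_total_nonneg b(1) q(1) by (subst (asm) ennreal_le_iff) (auto simp: Bd_def)
  qed
  show ?thesis
  proof (rule that[of "\<Sum>i\<in>UNIV. \<Sum>j\<in>UNIV. Bd * norm (sig_ext j i)"])
    fix x assume g: "complex_of_real x \<in> K.good"
    have e: "norm (GL_sol x x $ i $ j) \<le> Bd" for i j
      using Finite_Cartesian_Product.norm_nth_le[of "GL_sol x x $ i" j] diag[OF g, of i] by linarith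
    show "norm (trace (H_mat \<sigma> GL_sol x)) \<le> (\<Sum>i\<in>UNIV. \<Sum>j\<in>UNIV. Bd * norm (sig_ext j i))"
      unfolding trace_def H_component
      by (intro sum_norm_le) (auto simp: norm_mult intro!: mult_right_mono e)
  qed
qed

theorem tau_nonzero:
  assumes contr: "\<And>v. norm (\<sigma> *v v) \<le> norm v"
    and hyp: "(\<integral>\<^sup>+ x\<in>{0<..}. ennreal (x * (op_norm (Psi \<psi> x))\<^sup>2) \<partial>lborel) < 1"
    and x: "0 < x"
  shows "of_real x \<in> K.good"
proof -
  obtain c where c: "\<And>x. of_real x \<in> K.good \<Longrightarrow> norm (trace (H_mat \<sigma> GL_sol x)) \<le> c"
    by (rule trace_bound[OF contr hyp]) (rule that)
  have "K.Dinf (of_real x) \<noteq> 0"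
  proof (rule no_zero_of_bounded_log_derivative[where F="\<lambda>x. K.Dinf (of_real x)" and h="\<lambda>x. trace (H_mat \<sigma> GL_sol x)", OF _ K.Dinf_at_top _ _ x])
    show "continuous_on {0<..} (\<lambda>x. K.Dinf (complex_of_real x))"
      by (rule continuous_on_compose2[OF holomorphic_on_imp_continuous_on[OF K.Dinf_holo]])
        (auto intro!: continuous_intros)
  qed (use Dinf_real_deriv c in auto)
  then show ?thesis using x by simp
qed

end

section \<open>The linear system and the theorem\<close>

lemma exp_op_diag:
  "exp_op (diag_op a) t f = (\<lambda>l. exp (- (of_real t * a l)) * f l)"
proof
  fix l
  have it: "((diag_op a) ^^ m) f l = a l ^ m * f l" for m
    by (induction m) (auto simp: diag_op_def)
  have "(\<lambda>m. (- (of_real t * a l)) ^ m /\<^sub>R fact m) sums exp (- (of_real t * a l))"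
    by (rule exp_converges)
  hence "(\<lambda>m. (- (of_real t * a l)) ^ m /\<^sub>R fact m * f l) sums (exp (- (of_real t * a l)) * f l)"
    by (rule sums_mult2)
  moreover have "(- (of_real t * a l)) ^ m /\<^sub>R fact m * f l = of_real ((- t) ^ m / fact m) * ((diag_op a) ^^ m) f l" for m
  proof -
    have "(- (of_real t * a l)) ^ m = of_real ((- t) ^ m) * a l ^ m"
      by (simp add: power_mult_distrib[symmetric])
    then show ?thesis unfolding it by (simp add: scaleR_conv_of_real divide_inverse mult_ac)
  qed
  ultimately show "exp_op (diag_op a) t f l = exp (- (of_real t * a l)) * f l"
    unfolding exp_op_def by (simp add: sums_iff)
qed

context exp_series begin

text \<open>Splitting \<open>\<chi>\<^sub>l\<close> evenly, with \<open>\<parallel>\<chi>\<^sub>l\<parallel>\<^sup>1\<^sup>/\<^sup>2\<close> in the input and the rest in the output, puts both into \<open>\<ell>\<^sup>2\<close>. Where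
  \<open>\<chi>\<^sub>l = 0\<close> the output coefficient is 0, as it should be, since \<open>1 / 0 = 0\<close>.\<close>
lemma psi_realised:
  "realised_by \<psi> (diag_op (\<lambda>l. of_real (real l + \<kappa> + 1/2)))
     (\<lambda>l. of_real (sqrt (norm (chi l)))) (\<lambda>l. (1 / sqrt (norm (chi l))) *\<^sub>R chi l)"
  unfolding realised_by_def
proof (intro conjI allI impI)
  let ?c = "\<lambda>l. (1 / sqrt (norm (chi l))) *\<^sub>R chi l"
  let ?A = "diag_op (\<lambda>l. of_real (real l + \<kappa> + 1/2))"
  have nc: "norm (?c l) = sqrt (norm (chi l))" for l
    by (simp add: real_div_sqrt)
  have bound: "summable (\<lambda>l. norm (f l *s ?c l))" "(\<Sum>l. norm (f l *s ?c l)) \<le> ell2_norm f * sqrt chi_total" if f: "in_ell2 f" for f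
  proof -
    have fin: "(\<Sum>l<n. norm (f l *s ?c l)) \<le> ell2_norm f * sqrt chi_total" for n
    proof -
      have "(\<Sum>l<n. norm (f l *s ?c l)) = (\<Sum>l<n. \<bar>cmod (f l)\<bar> * \<bar>sqrt (norm (chi l))\<bar>)"
        unfolding norm_vector_scalar_mult_complex nc by simp
      also have "\<dots> \<le> L2_set (\<lambda>l. cmod (f l)) {..<n} * L2_set (\<lambda>l. sqrt (norm (chi l))) {..<n}"
        by (rule L2_set_mult_ineq)
      also have "\<dots> \<le> ell2_norm f * sqrt chi_total"
      proof (intro mult_mono)
        show "L2_set (\<lambda>l. cmod (f l)) {..<n} \<le> ell2_norm f"
          unfolding L2_set_def ell2_norm_def using f
          by (intro real_sqrt_le_mono sum_le_suminf) (auto simp: in_ell2_def)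
        show "L2_set (\<lambda>l. sqrt (norm (chi l))) {..<n} \<le> sqrt chi_total"
          unfolding L2_set_def chi_total_def by (simp, intro sum_le_suminf chi_summable) auto
      qed (auto simp: ell2_norm_def L2_set_nonneg intro!: suminf_nonneg f[unfolded in_ell2_def])
      finally show ?thesis .
    qed
    show s: "summable (\<lambda>l. norm (f l *s ?c l))"
      by (rule summableI_nonneg_bounded[OF _ fin]) auto
    show "(\<Sum>l. norm (f l *s ?c l)) \<le> ell2_norm f * sqrt chi_total"
      by (rule suminf_le_const[OF s fin])
  qed
  show "in_ell2 (\<lambda>l. of_real (sqrt (norm (chi l))))"
    unfolding in_ell2_def using chi_summable by simp
  show "summable (\<lambda>l. f l *s ?c l)" if "in_ell2 f" for f
    by (rule summable_norm_cancel[OF bound(1)[OF that]])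
  show "\<exists>M. \<forall>f. in_ell2 f \<longrightarrow> norm (row_op ?c f) \<le> M * ell2_norm f"
  proof (intro exI allI impI)
    fix f assume f: "in_ell2 f"
    have "norm (row_op ?c f) \<le> (\<Sum>l. norm (f l *s ?c l))"
      unfolding row_op_def by (rule summable_norm[OF bound(1)[OF f]])
    also have "\<dots> \<le> ell2_norm f * sqrt chi_total" by (rule bound(2)[OF f])
    finally show "norm (row_op ?c f) \<le> sqrt chi_total * ell2_norm f" by (simp add: mult.commute)
  qed
  have ex: "exp (- (complex_of_real t * of_real (real l + \<kappa> + 1/2))) = of_real (exp (- (rate l * t)))" for t l
    unfolding rate_def mult.commute[of "complex_of_real t"] exp_of_real_mult by (simp add: add_ac)
  show "in_ell2 (exp_op ?A t f)" if t: "0 < t" and f: "in_ell2 f" for t f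
    unfolding in_ell2_def exp_op_diag ex
  proof (rule summable_comparison_test'[where N=0])
    show "summable (\<lambda>l. (cmod (f l))\<^sup>2)" using f by (simp add: in_ell2_def)
    fix l
    have "exp (- (rate l * t)) \<le> 1" using t rate_pos[of l] by simp
    hence "cmod (of_real (exp (- (rate l * t))) * f l) \<le> 1 * cmod (f l)"
      unfolding norm_mult by (intro mult_right_mono) auto
    then show "norm ((cmod (of_real (exp (- (rate l * t))) * f l))\<^sup>2) \<le> (cmod (f l))\<^sup>2"
      by (simp add: power_mono)
  qed
  show "\<psi> t = row_op ?c (exp_op ?A t (\<lambda>l. of_real (sqrt (norm (chi l)))))" if t: "0 < t" for t
  proof -
    have "(of_real (exp (- (rate l * t))) * of_real (sqrt (norm (chi l)))) *s ?c l = exp (- (\<kappa> + real l + 1/2) * t) *\<^sub>R chi l" for l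
    proof (cases "chi l = 0")
      case False
      then show ?thesis
        by (simp add: vec_eq_iff rate_def scaleR_conv_of_real[where 'a=complex] field_simps del: of_real_exp)
    qed simp
    then show ?thesis
      unfolding row_op_def exp_op_diag ex using psi_sums[OF t] by (simp add: sums_iff)
  qed
qed

end

lemma signature_norm_le:
  fixes sg :: "'k::finite \<Rightarrow> complex^2^2"
  assumes "\<And>k. signature_matrix (sg k)"
  shows "norm (block_diagonal sg *v v) \<le> norm v"
proof -
  have c: "(block_diagonal sg *v v) $ q = sg (fst q) $ snd q $ snd q * v $ q" for q
  proof -
    have "block_diagonal sg $ q $ r * v $ r = (if r = q then sg (fst q) $ snd q $ snd q * v $ q else 0)" for r
      using assms[of "fst q"] by (cases q; cases r) (auto simp: block_diagonal_def signature_matrix_def)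
    then show ?thesis by (simp add: matrix_vector_mult_def)
  qed
  have "(norm (block_diagonal sg *v v))\<^sup>2 \<le> (norm v)\<^sup>2"
    unfolding norm_vec_square c
  proof (intro sum_mono power_mono)
    fix q :: "'k \<times> 2"
    have "sg (fst q) $ snd q $ snd q \<in> {1, -1, 0}" using assms[of "fst q"] by (simp add: signature_matrix_def)
    then have "norm (sg (fst q) $ snd q $ snd q) \<le> 1" by auto
    then show "norm (sg (fst q) $ snd q $ snd q * v $ q) \<le> norm (v $ q)"
      unfolding norm_mult by (intro mult_left_le_one_le) auto
  qed auto
  then show ?thesis by (rule power2_le_imp_le) simp
qed

theorem theorem9p2:
  fixes v :: "real poly" and N g n :: nat and \<rho> :: "real measure" and \<delta> :: "nat \<Rightarrow> complex"
    and p :: "nat \<Rightarrow> real poly" and \<alpha> \<beta> :: "nat \<Rightarrow> complex^2^2" and \<kappa> :: real and Z :: "real \<Rightarrow> real^2"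
    and ix :: "'k::finite \<Rightarrow> nat" and sg gm :: "'k \<Rightarrow> complex^2^2"
    and \<sigma> \<gamma> :: "complex^('k \<times> 2)^('k \<times> 2)"
    and \<psi> :: "real \<Rightarrow> complex^('k \<times> 2)" and chi :: "nat \<Rightarrow> complex^('k \<times> 2)"
  assumes "N \<ge> 1" and "degree v = 2 * N" and "lead_coeff v > 0"
    and "equilibrium_measure v \<rho>"
    and "2 * g + 2 \<le> 4 * N - 2"
    and "\<And>j. j \<in> {1..2*g+2} \<Longrightarrow> \<delta> j \<in> \<real>"
    and "\<And>i j. 1 \<le> i \<Longrightarrow> i < j \<Longrightarrow> j \<le> 2*g+2 \<Longrightarrow> Re (\<delta> i) < Re (\<delta> j)"
    and "measure_support \<rho> = (\<Union>j\<in>{1..g+1}. {Re (\<delta> (2*j-1))..Re (\<delta> (2*j))})"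
    and "\<And>z. (poly (map_poly of_real (pderiv v)) z)\<^sup>2 - 4 * u_fun v \<rho> z =
           (2 * of_nat N * of_real (lead_coeff v))\<^sup>2 * (\<Prod>j=1..4*N-2. z - \<delta> j)"
    and "\<rho> = density lborel
           (\<lambda>x. ennreal (indicator (measure_support \<rho>) x * w_fun N (lead_coeff v) \<delta> x / (2 * pi)))"
    and "monic_orthogonal \<rho> p" and "n \<ge> 1"
    and "\<And>z. z \<notin> of_real ` measure_support \<rho> \<Longrightarrow> z \<notin> \<delta> ` {1..4*N-2} \<Longrightarrow>
           A_mat N (lead_coeff v) \<delta> \<rho> p n z = (\<Sum>j=1..4*N-2. mscale (1 / (z - \<delta> j)) (\<alpha> j))"
    and "\<And>j. \<beta> j = traceless (\<alpha> j)"
    and "\<delta> 1 = 0" and "1 < Re (\<delta> 2)"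
    and "is_eigenvalue (\<beta> 1) (of_real \<kappa>)" and "is_eigenvalue (\<beta> 1) (- of_real \<kappa>)"
    and "\<kappa> > 0" and "2 * \<kappa> \<notin> \<int>"
    and "\<And>x. 0 < x \<Longrightarrow> x < 1 \<Longrightarrow>
           ((\<lambda>x. of_real_vec (Z x)) has_vector_derivative
              B_mat N \<delta> \<beta> (of_real x) *v of_real_vec (Z x)) (at x)"
    and "(Z \<longlongrightarrow> 0) (at_right 0)"
    and "bij_betw ix (UNIV :: 'k set) {2..4*N-2}"
    and "\<And>k. signature_matrix (sg k)" and "\<And>k. invertible (gm k)"
    and "\<sigma> = block_diagonal sg" and "\<gamma> = block_diagonal gm"
    and "dagger \<gamma> ** \<sigma> ** \<gamma> = block_diagonal (\<lambda>k. mscale (- \<delta> (ix k)) (J_mat ** \<beta> (ix k)))"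
    and "\<And>t x. t > 0 \<Longrightarrow> x = exp (- t) \<Longrightarrow>
           \<psi> t = \<gamma> *v block_column (\<lambda>k. (of_real (sqrt x) / (of_real x - \<delta> (ix k))) *s of_real_vec (Z x))"
    and "summable (\<lambda>l. norm (chi l))"
    and "\<And>t. t > 0 \<Longrightarrow> (\<lambda>l. exp (- (\<kappa> + real l + 1/2) * t) *\<^sub>R chi l) sums \<psi> t"
  shows
    \<comment> \<open>(i)\<close>
    "realised_by \<psi> (diag_op (\<lambda>l. of_real (real l + \<kappa> + 1/2)))
       (\<lambda>l. of_real (sqrt (norm (chi l)))) (\<lambda>l. (1 / sqrt (norm (chi l))) *\<^sub>R chi l)
     \<and>
     \<comment> \<open>the logarithm of the tau function is defined for all large arguments\<close>
     (\<forall>\<^sub>F x in at_top. tau \<sigma> \<psi> (2 * x) \<noteq> 0)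
     \<and>
     (\<exists>W :: real \<Rightarrow> real \<Rightarrow> ('k \<times> 2) bmat.
       \<comment> \<open>(ii)\<close>
       (\<forall>x>0. tau \<sigma> \<psi> (2 * x) \<noteq> 0 \<longrightarrow>
          GL_solution_at \<sigma> \<psi> W x \<and>
          has_log_derivative (\<lambda>x. tau \<sigma> \<psi> (2 * x)) (trace (H_mat \<sigma> W x)) x)
       \<and>
       \<comment> \<open>(iii)\<close>
       ((\<integral>\<^sup>+x\<in>{0<..}. ennreal (x * (op_norm (Psi \<psi> x))\<^sup>2) \<partial>lborel) < 1 \<longrightarrow>
          (\<forall>x>0. tau \<sigma> \<psi> (2 * x) \<noteq> 0) \<and>
          GL_pde W (H_mat \<sigma> W)))"
proof -
  interpret exp_series chi \<kappa> \<psi> \<sigma>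
    by (rule exp_series.intro) fact+
  have contr: "norm (\<sigma> *v v) \<le> norm v" for v
    unfolding \<open>\<sigma> = block_diagonal sg\<close> by (rule signature_norm_le) fact
  have all_good: "of_real x \<in> K.good"
    if "(\<integral>\<^sup>+x\<in>{0<..}. ennreal (x * (op_norm (Psi \<psi> x))\<^sup>2) \<partial>lborel) < 1" "0 < x" for x
    by (rule tau_nonzero[OF contr that])
  show ?thesis
  proof (intro conjI exI[of _ GL_sol] allI impI psi_realised tau_at_top)
    fix x :: real assume "0 < x" "tau \<sigma> \<psi> (2 * x) \<noteq> 0"
    hence g: "of_real x \<in> K.good" using good_iff by blast
    show "GL_solution_at \<sigma> \<psi> GL_sol x" by (rule GL_sol_is_solution[OF g])
    show "has_log_derivative (\<lambda>x. tau \<sigma> \<psi> (2 * x)) (trace (H_mat \<sigma> GL_sol x)) x" by (rule tau_log_derivative[OF g])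
  next
    assume small: "(\<integral>\<^sup>+x\<in>{0<..}. ennreal (x * (op_norm (Psi \<psi> x))\<^sup>2) \<partial>lborel) < 1"
    show "tau \<sigma> \<psi> (2 * x) \<noteq> 0" if "0 < x" for x
      using all_good[OF small that] good_iff[OF that] by blast
    show "GL_pde GL_sol (H_mat \<sigma> GL_sol)" by (rule GL_sol_pde[OF all_good[OF small]])
  qed
qed

end
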